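(* Let $M,M'\subseteq\mathbb{C}^2$ be real analytic hypersurfaces through $0$, given near $0$ in normal coordinates by $w=Q(z,\bar z,\bar w)$ and $w'=Q'(z',\bar z',\bar w')$ respectively, with complexifications $\mathcal{M}$ and $\mathcal{M}'$. Assume that $M'$ is of finite type at $0$, and let $\mathcal{H}=(f,g,\tilde f,\tilde g)$ be a holomorphic Segre preserving map (HSPM) sending $(\mathcal{M},0)$ into $(\mathcal{M}',0)$. Then the following are equivalent: (1) $\mathcal{H}$ is totally Segre nondegenerate at $0$. (2) $M$ is of finite type at $0$, and $\mathcal{H}$ is not transversally null. (3) $M$ is of finite type at $0$, and $\mathcal{H}$ is Segre transversal to $\mathcal{M}'$ at $0$. Furthermore, if these conditions hold, then the order of vanishing of $f(z,0)$ at $0$ equals the order of vanishing of $\tilde f(\chi,0)$ at $0$; that is, if the lowest order nonzero term of the Taylor expansion of $f(z,0)$ is $cz^r$ for some nonzero constant $c$ and nonnegative integer $r$, then the lowest order nonzero term of the Taylor expansion of $\tilde f(\chi,0)$ is $\tilde c\chi^r$ for some nonzero constant $\tilde c$. If, in addition, $M=M'$, then $\mathcal{H}$ is a biholomorphism near $0$.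
   Context: Everything is local near $0$. Coordinates on $\mathbb{C}^{2}\times\mathbb{C}^{2}$ are $(z,w,\chi,\tau)$ (primed for the target). Normal coordinates: the real analytic hypersurface $M\subseteq\mathbb{C}^{2}$ is given near $0\in M$ by $w=Q(z,\bar z,\bar w)$, where $Q(z,\chi,\tau)$ is holomorphic near $0$ in $\mathbb{C}^3$ and $Q(0,\chi,\tau)\equiv Q(z,0,\tau)\equiv\tau$. Since $M$ is a real hypersurface, $Q(z,\chi,\overline{Q}(\chi,z,w))\equiv w$, where $\overline{\varphi}(x):=\overline{\varphi(\bar x)}$. Similarly for $M'$ and $Q'$. When $M=M'$, the same normal coordinates are used, so $Q=Q'$. Complexification: $\mathcal{M}$ is the holomorphic hypersurface $\{(z,w,\chi,\tau): w=Q(z,\chi,\tau)\}$ in $\mathbb{C}^{4}$ near $0$; similarly $\mathcal{M}'$ with $Q'$. HSPM: a holomorphic Segre preserving map sending $(\mathcal{M},0)$ into $(\mathcal{M}',0)$ is a holomorphic map, defined near $0$ in $\mathbb{C}^{4}$, of the form $\mathcal{H}(z,w,\chi,\tau)=\big(f(z,w),g(z,w),\tilde f(\chi,\tau),\tilde g(\chi,\tau)\big)$ with $f,g,\tilde f,\tilde g$ $\mathbb{C}$-valued holomorphic functions, $\mathcal{H}(0)=0$, and $\mathcal{H}$ mapping $\mathcal{M}$ (near $0$) into $\mathcal{M}'$. (The pair $(\tilde f,\tilde g)$ need not be related to the conjugate of $(f,g)$.) Finite type at $0$: $Q(z,\chi,0)\not\equiv 0$ (for $M'$: $Q'(z',\chi',0)\not\equiv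 0$). Transversally null: $g(z,w)\equiv 0$ and $\tilde g(\chi,\tau)\equiv 0$. Segre transversal to $\mathcal{M}'$ at $0$: $g_w(0)=\tilde g_\tau(0)\ne 0$ (the equality $g_w(0)=\tilde g_\tau(0)$ always holds in normal coordinates). Totally Segre nondegenerate at $0$: $f_z(z,0)\not\equiv 0$ and $\tilde f_\chi(\chi,0)\not\equiv 0$. *)

theory Defs
  imports "HOL-Complex_Analysis.Complex_Analysis"
begin

section \<open>Holomorphic maps of several complex variables\<close>

text \<open>
  \<open>\<complex>\<^sup>n\<close> is represented by iterated products of the type of complex numbers. The library gives them
  their real normed space structure; the class below adds multiplication by complex scalars.
\<close>

class complex_normed_space = real_normed_vector +
  fixes cscale :: "complex \<Rightarrow> 'a \<Rightarrow> 'a"  (infixr \<open>*\<^sub>C\<close> 75)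
  assumes cscale_add_right: "c *\<^sub>C (x + y) = c *\<^sub>C x + c *\<^sub>C y"
    and cscale_add_left: "(c + d) *\<^sub>C x = c *\<^sub>C x + d *\<^sub>C x"
    and cscale_cscale: "c *\<^sub>C d *\<^sub>C x = (c * d) *\<^sub>C x"
    and cscale_of_real: "complex_of_real r *\<^sub>C x = r *\<^sub>R x"
    and norm_cscale: "norm (c *\<^sub>C x) = cmod c * norm x"

instantiation complex :: complex_normed_space
begin

definition cscale_complex_def: "c *\<^sub>C x = c * (x :: complex)"

instance
  by standard (simp_all add: cscale_complex_def algebra_simps norm_mult scaleR_conv_of_real)

end

instantiation prod :: (complex_normed_space, complex_normed_space) complex_normed_space
begin

definition cscale_prod_def: "c *\<^sub>C p = (c *\<^sub>C fst p, c *\<^sub>C snd p)"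

instance
proof
  fix c :: complex and p :: "'a \<times> 'b"
  have "(norm (c *\<^sub>C p))\<^sup>2 = (cmod c * norm p)\<^sup>2"
    by (simp add: cscale_prod_def norm_prod_def norm_cscale power_mult_distrib algebra_simps)
  then show "norm (c *\<^sub>C p) = cmod c * norm p"
    by (rule power2_eq_imp_eq) simp_all
qed (auto simp: cscale_prod_def cscale_add_right cscale_add_left cscale_cscale cscale_of_real
      prod_eq_iff)

end

definition holo_on ::
    "('a::complex_normed_space \<Rightarrow> 'b::complex_normed_space) \<Rightarrow> 'a set \<Rightarrow> bool" where
  "holo_on F U \<longleftrightarrow>
    (\<forall>x\<in>U. \<exists>D. (F has_derivative D) (at x) \<and> (\<forall>c v. D (c *\<^sub>C v) = c *\<^sub>C D v))"

definition holo_near_0 :: "('a::complex_normed_space \<Rightarrow> 'b::complex_normed_space) \<Rightarrow> bool" where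
  "holo_near_0 F \<longleftrightarrow> (\<exists>U. open U \<and> 0 \<in> U \<and> holo_on F U)"

definition biholo_near_0 :: "('a::complex_normed_space \<Rightarrow> 'a) \<Rightarrow> bool" where
  "biholo_near_0 F \<longleftrightarrow>
    (\<exists>U V G. open U \<and> 0 \<in> U \<and> open V \<and> 0 \<in> V \<and>
      homeomorphism U V F G \<and> holo_on F U \<and> holo_on G V)"

section \<open>Hypersurfaces in normal coordinates\<close>

text \<open>
  Germs at the origin are represented by total functions and sets, and every identity between
  germs is required eventually in \<^term>\<open>nhds 0\<close>. The coordinates on \<open>\<complex>\<^sup>2 \<times> \<complex>\<^sup>2\<close> are written
  \<open>((z, w), (\<zeta>, \<tau>))\<close>; the letter chi is reserved syntax for vectors in the library.
\<close>

definition conj_fun :: "(complex \<times> complex \<times> complex \<Rightarrow> complex)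
    \<Rightarrow> complex \<times> complex \<times> complex \<Rightarrow> complex" where
  "conj_fun \<phi> = (\<lambda>(x, y, t). cnj (\<phi> (cnj x, cnj y, cnj t)))"

text \<open>
  The last conjunct is the reality condition; together with the other ones it makes the set
  \<open>w = Q(z, cnj z, cnj w)\<close> a real analytic hypersurface near \<open>0\<close>.
\<close>

definition normal_coords ::
    "(complex \<times> complex) set \<Rightarrow> (complex \<times> complex \<times> complex \<Rightarrow> complex) \<Rightarrow> bool" where
  "normal_coords M Q \<longleftrightarrow>
    holo_near_0 Q \<and>
    (\<forall>\<^sub>F (z, w) in nhds 0. (z, w) \<in> M \<longleftrightarrow> w = Q (z, cnj z, cnj w)) \<and>
    (\<forall>\<^sub>F (\<zeta>, \<tau>) in nhds 0. Q (0, \<zeta>, \<tau>) = \<tau>) \<and>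
    (\<forall>\<^sub>F (z, \<tau>) in nhds 0. Q (z, 0, \<tau>) = \<tau>) \<and>
    (\<forall>\<^sub>F (z, \<zeta>, w) in nhds 0. Q (z, \<zeta>, conj_fun Q (\<zeta>, z, w)) = w)"

definition complexification ::
    "(complex \<times> complex \<times> complex \<Rightarrow> complex) \<Rightarrow> ((complex \<times> complex) \<times> complex \<times> complex) set" where
  "complexification Q = {((z, w), (\<zeta>, \<tau>)). w = Q (z, \<zeta>, \<tau>)}"

definition finite_type_at_0 :: "(complex \<times> complex \<times> complex \<Rightarrow> complex) \<Rightarrow> bool" where
  "finite_type_at_0 Q \<longleftrightarrow> \<not> (\<forall>\<^sub>F (z, \<zeta>) in nhds 0. Q (z, \<zeta>, 0) = 0)"

section \<open>Holomorphic Segre preserving maps\<close>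

definition segre_map :: "(complex \<times> complex \<Rightarrow> complex) \<Rightarrow> (complex \<times> complex \<Rightarrow> complex)
    \<Rightarrow> (complex \<times> complex \<Rightarrow> complex) \<Rightarrow> (complex \<times> complex \<Rightarrow> complex)
    \<Rightarrow> (complex \<times> complex) \<times> complex \<times> complex \<Rightarrow> (complex \<times> complex) \<times> complex \<times> complex" where
  "segre_map f g f' g' =
    (\<lambda>((z, w), (\<zeta>, \<tau>)). ((f (z, w), g (z, w)), (f' (\<zeta>, \<tau>), g' (\<zeta>, \<tau>))))"

definition is_HSPM :: "(complex \<times> complex \<times> complex \<Rightarrow> complex)
    \<Rightarrow> (complex \<times> complex \<times> complex \<Rightarrow> complex)
    \<Rightarrow> (complex \<times> complex \<Rightarrow> complex) \<Rightarrow> (complex \<times> complex \<Rightarrow> complex)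
    \<Rightarrow> (complex \<times> complex \<Rightarrow> complex) \<Rightarrow> (complex \<times> complex \<Rightarrow> complex) \<Rightarrow> bool" where
  "is_HSPM Q Q' f g f' g' \<longleftrightarrow>
    holo_near_0 f \<and> holo_near_0 g \<and> holo_near_0 f' \<and> holo_near_0 g' \<and>
    segre_map f g f' g' 0 = 0 \<and>
    (\<forall>\<^sub>F p in nhds 0. p \<in> complexification Q \<longrightarrow> segre_map f g f' g' p \<in> complexification Q')"

definition transversally_null ::
    "(complex \<times> complex \<Rightarrow> complex) \<Rightarrow> (complex \<times> complex \<Rightarrow> complex) \<Rightarrow> bool" where
  "transversally_null g g' \<longleftrightarrow> (\<forall>\<^sub>F p in nhds 0. g p = 0) \<and> (\<forall>\<^sub>F p in nhds 0. g' p = 0)"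

definition segre_transversal_at_0 ::
    "(complex \<times> complex \<Rightarrow> complex) \<Rightarrow> (complex \<times> complex \<Rightarrow> complex) \<Rightarrow> bool" where
  "segre_transversal_at_0 g g' \<longleftrightarrow>
    deriv (\<lambda>w. g (0, w)) 0 = deriv (\<lambda>\<tau>. g' (0, \<tau>)) 0 \<and> deriv (\<lambda>\<tau>. g' (0, \<tau>)) 0 \<noteq> 0"

definition totally_segre_nondegenerate_at_0 ::
    "(complex \<times> complex \<Rightarrow> complex) \<Rightarrow> (complex \<times> complex \<Rightarrow> complex) \<Rightarrow> bool" where
  "totally_segre_nondegenerate_at_0 f f' \<longleftrightarrow>
    \<not> (\<forall>\<^sub>F z in nhds 0. deriv (\<lambda>x. f (x, 0)) z = 0) \<and>
    \<not> (\<forall>\<^sub>F \<zeta> in nhds 0. deriv (\<lambda>x. f' (x, 0)) \<zeta> = 0)"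

definition lowest_taylor_term :: "(complex \<Rightarrow> complex) \<Rightarrow> complex \<Rightarrow> nat \<Rightarrow> bool" where
  "lowest_taylor_term h c r \<longleftrightarrow>
    c \<noteq> 0 \<and> (\<exists>F. h has_fps_expansion F \<and> fps_nth F r = c \<and> (\<forall>k<r. fps_nth F k = 0))"

end

theory Submission
  imports Defs
begin

text \<open>
Write \<open>q(z, \<zeta>) = Q(z, \<zeta>, 0)\<close> and \<open>q'(z', \<zeta>') = Q'(z', \<zeta>', 0)\<close>. Since the complexification is
parametrized by \<open>(z, \<zeta>, \<tau>)\<close>, the mapping condition is the single identity
\<open>g(z, Q) = Q'(f(z, Q), ft(\<zeta>, \<tau>), gt(\<zeta>, \<tau>))\<close> with \<open>Q = Q(z, \<zeta>, \<tau>)\<close>. By the reality condition the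
complexification is also \<open>\<tau> = conj_fun Q (\<zeta>, z, w)\<close>, so everything is symmetric under exchanging
\<open>(Q, f, g)\<close> with \<open>(conj_fun Q, ft, gt)\<close>; this is the lemma \<open>swap\<close>, and it halves the work.

Nondegeneracy implies transversality (\<open>segre_nondegenerate_imp_transversal\<close>). Compare leading terms
in \<open>\<zeta>\<close>, for fixed \<open>z\<close>: let \<open>q = \<zeta>\<^sup>k (a(z) + \<dots>)\<close>, \<open>q' = \<zeta>'\<^sup>m (b(z') + \<dots>)\<close>,
\<open>g = w\<^sup>j (G(z) + \<dots>)\<close> and \<open>ft(\<zeta>, 0) = \<zeta>\<^sup>s (c + \<dots>)\<close>. At \<open>\<tau> = 0\<close> the identity reads
\<open>g(z, q) = q'(f(z, q), ft)\<close>, which gives \<open>k j = m s\<close> and \<open>a\<^sup>j G = c\<^sup>m \<beta>\<close>, where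
\<open>\<beta>(z) = b(f(z, 0))\<close>. Its \<open>\<tau>\<close>-derivative at \<open>\<tau> = 0\<close>, divided by \<open>\<zeta>\<close> to the power \<open>k (j - 1)\<close>, has the
form \<open>D(\<zeta>) \<beta>(z) + E(\<zeta>) = j a\<^sup>j\<^sup>-\<^sup>1 G + o(1)\<close>, where \<open>E\<close> is the quotient of \<open>gt\<^sub>\<tau>(\<zeta>, 0)\<close>. Only \<open>\<beta>\<close>
and the right-hand side depend on \<open>z\<close>, so two values of \<open>z\<close> show that \<open>D\<close> and \<open>E\<close> converge, to \<open>d\<close>
and \<open>\<epsilon>\<close> say, and \<open>j a\<^sup>j\<^sup>-\<^sup>1 G = d \<beta> + \<epsilon>\<close>. If \<open>\<epsilon> = 0\<close>, multiplying by \<open>c\<^sup>m\<close> leaves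
\<open>j c\<^sup>m = d a(z)\<close>, which is absurd because \<open>a\<close> vanishes at \<open>0\<close>. If \<open>j \<ge> 2\<close>, letting \<open>z\<close> tend to \<open>0\<close>
gives \<open>\<epsilon> = 0\<close>. Hence \<open>j = 1\<close> and \<open>gt\<^sub>\<tau>(0) = g\<^sub>w(0) = \<epsilon> \<noteq> 0\<close>. Moreover \<open>k = m s\<close>. Conjugation does
not change the orders \<open>k\<close> and \<open>m\<close>, so the exchanged map gives \<open>k = m r\<close>, with \<open>r\<close> the order of
\<open>f(z, 0)\<close>; therefore \<open>r = s\<close>.

For the converse (\<open>not_null_imp_f_nondegenerate\<close>) let \<open>f(z, 0) = 0\<close>. Then \<open>gt\<close> vanishes on the image of
\<open>(\<zeta>, z) \<mapsto> (\<zeta>, conj_fun Q (\<zeta>, z, 0))\<close>, where no nonzero germ vanishes because \<open>M\<close> is of finite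
type; so \<open>gt = 0\<close>. Now \<open>g(z, w) = q'(f(z, w), ft(\<zeta>, \<tau>))\<close> on the complexification, for every \<open>\<zeta>\<close>. If \<open>ft(\<zeta>, 0)\<close> is not
identically zero then \<open>ft\<close> takes infinitely many values at the points \<open>(\<zeta>, \<tau>)\<close> belonging to one \<open>(z, w)\<close>, while
\<open>q'(u, \<cdot>)\<close> is not constant for small \<open>u \<noteq> 0\<close>; hence \<open>f = 0\<close> and \<open>g = 0\<close>. If \<open>ft(\<zeta>, 0) = 0\<close>, then \<open>g = 0\<close> by symmetry.

Finally, if \<open>M = M'\<close> then \<open>q = q'\<close> (\<open>hypersurface_determines_Q\<close>), so \<open>k = m\<close> and \<open>r = s = 1\<close>. The map
is then a product of two maps of \<open>\<complex>\<^sup>2\<close> with invertible triangular differentials, and the inverse function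
theorem applies.
\<close>

section \<open>Complex differentiability at a point\<close>

text \<open>
Holomorphy of a germ becomes a property that holds eventually in \<^term>\<open>nhds 0\<close>, so it can be combined
with the identities between germs, and closure under composition becomes a statement at one point.
\<close>

definition holo_at :: "('a::complex_normed_space \<Rightarrow> 'b::complex_normed_space) \<Rightarrow> 'a \<Rightarrow> bool" where
  "holo_at F x \<longleftrightarrow> (\<exists>D. (F has_derivative D) (at x) \<and> (\<forall>c v. D (c *\<^sub>C v) = c *\<^sub>C D v))"

lemma holo_on_iff_holo_at: "holo_on F U \<longleftrightarrow> (\<forall>x\<in>U. holo_at F x)"
  by (simp add: holo_on_def holo_at_def)

lemma holo_near_0_iff_eventually: "holo_near_0 F \<longleftrightarrow> (\<forall>\<^sub>F x in nhds 0. holo_at F x)"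
  unfolding holo_near_0_def holo_on_iff_holo_at eventually_nhds by blast

lemma holo_at_const: "holo_at (\<lambda>x. c) x"
proof -
  have "c' *\<^sub>C (0::'b) = 0" for c'
    using norm_cscale[of c' "0::'b"] by simp
  then show ?thesis
    unfolding holo_at_def by (intro exI[of _ "\<lambda>_. 0"]) auto
qed

lemma holo_at_ident: "holo_at (\<lambda>x. x) x"
  unfolding holo_at_def by (intro exI[of _ "\<lambda>v. v"]) auto

lemma holo_at_fst: "holo_at F x \<Longrightarrow> holo_at (\<lambda>x. fst (F x)) x"
  unfolding holo_at_def
proof (elim exE conjE)
  fix D assume "(F has_derivative D) (at x)" "\<forall>c v. D (c *\<^sub>C v) = c *\<^sub>C D v"
  then show "\<exists>E. ((\<lambda>x. fst (F x)) has_derivative E) (at x) \<and> (\<forall>c v. E (c *\<^sub>C v) = c *\<^sub>C E v)"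
    by (intro exI[of _ "\<lambda>v. fst (D v)"]) (auto intro: has_derivative_fst simp: cscale_prod_def)
qed

lemma holo_at_snd: "holo_at F x \<Longrightarrow> holo_at (\<lambda>x. snd (F x)) x"
  unfolding holo_at_def
proof (elim exE conjE)
  fix D assume "(F has_derivative D) (at x)" "\<forall>c v. D (c *\<^sub>C v) = c *\<^sub>C D v"
  then show "\<exists>E. ((\<lambda>x. snd (F x)) has_derivative E) (at x) \<and> (\<forall>c v. E (c *\<^sub>C v) = c *\<^sub>C E v)"
    by (intro exI[of _ "\<lambda>v. snd (D v)"]) (auto intro: has_derivative_snd simp: cscale_prod_def)
qed

lemma holo_at_Pair:
  assumes "holo_at F x" "holo_at G x"
  shows "holo_at (\<lambda>x. (F x, G x)) x"
proof -
  obtain D E where "(F has_derivative D) (at x)" "\<And>c v. D (c *\<^sub>C v) = c *\<^sub>C D v"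
    "(G has_derivative E) (at x)" "\<And>c v. E (c *\<^sub>C v) = c *\<^sub>C E v"
    using assms unfolding holo_at_def by blast
  then show ?thesis
    unfolding holo_at_def
    by (intro exI[of _ "\<lambda>v. (D v, E v)"]) (auto intro!: has_derivative_Pair simp: cscale_prod_def)
qed

lemma holo_at_compose:
  assumes "holo_at F x" "holo_at G (F x)"
  shows "holo_at (\<lambda>x. G (F x)) x"
proof -
  obtain D E where "(F has_derivative D) (at x)" "\<And>c v. D (c *\<^sub>C v) = c *\<^sub>C D v"
    "(G has_derivative E) (at (F x))" "\<And>c v. E (c *\<^sub>C v) = c *\<^sub>C E v"
    using assms unfolding holo_at_def by blast
  then show ?thesis
    unfolding holo_at_def
    by (intro exI[of _ "\<lambda>v. E (D v)"]) (auto intro: has_derivative_compose)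
qed

lemma holo_at_imp_isCont: "holo_at F x \<Longrightarrow> isCont F x"
  unfolding holo_at_def using has_derivative_continuous by blast

lemma holo_at_complex_iff:
  fixes F :: "complex \<Rightarrow> complex"
  shows "holo_at F x \<longleftrightarrow> F field_differentiable (at x)"
proof
  assume "holo_at F x"
  then obtain D where D: "(F has_derivative D) (at x)" "\<And>c v. D (c * v) = c * D v"
    unfolding holo_at_def cscale_complex_def by blast
  have "D = (*) (D 1)"
  proof
    show "D c = D 1 * c" for c
      using D(2)[of c 1] by (metis mult.commute mult_1_right)
  qed
  then show "F field_differentiable (at x)"
    unfolding field_differentiable_def has_field_derivative_def using D(1) by metis
next
  assume "F field_differentiable (at x)"
  then obtain d where "(F has_derivative (*) d) (at x)"
    unfolding field_differentiable_def has_field_derivative_def by blast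
  then show "holo_at F x"
    unfolding holo_at_def cscale_complex_def by (intro exI[of _ "(*) d"]) auto
qed

lemma holo_at_add:
  fixes F G :: "'a::complex_normed_space \<Rightarrow> 'b::complex_normed_space"
  assumes "holo_at F x" "holo_at G x"
  shows "holo_at (\<lambda>x. F x + G x) x"
proof -
  obtain D E where "(F has_derivative D) (at x)" "\<And>c v. D (c *\<^sub>C v) = c *\<^sub>C D v"
    "(G has_derivative E) (at x)" "\<And>c v. E (c *\<^sub>C v) = c *\<^sub>C E v"
    using assms unfolding holo_at_def by blast
  then show ?thesis
    unfolding holo_at_def
    by (intro exI[of _ "\<lambda>v. D v + E v"]) (auto intro!: has_derivative_add simp: cscale_add_right)
qed

lemma bounded_linear_cscale_left: "bounded_linear (\<lambda>c. c *\<^sub>C (v::'a::complex_normed_space))"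
proof (rule bounded_linear_intro[where K = "norm v"])
  fix r c
  have "(r *\<^sub>R c) *\<^sub>C v = complex_of_real r *\<^sub>C c *\<^sub>C v"
    by (simp add: cscale_cscale scaleR_conv_of_real)
  then show "(r *\<^sub>R c) *\<^sub>C v = r *\<^sub>R (c *\<^sub>C v)"
    by (simp add: cscale_of_real)
qed (simp_all add: cscale_add_left norm_cscale)

lemma holo_at_cscale_left: "holo_at (\<lambda>c. c *\<^sub>C (v::'a::complex_normed_space)) c"
  unfolding holo_at_def
  by (intro exI[of _ "\<lambda>c. c *\<^sub>C v"])
     (auto intro!: bounded_linear_imp_has_derivative bounded_linear_cscale_left
       simp: cscale_complex_def cscale_cscale)

lemmas holo_at_intros = holo_at_const holo_at_ident holo_at_fst holo_at_snd holo_at_Pair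

text \<open>
Conjugation is antilinear, and the outer conjugation repairs complex linearity: the derivative is
\<open>v \<mapsto> cnj (D (cnj v))\<close>.
\<close>

lemma holo_at_conj_fun:
  assumes "holo_at F (cnj x, cnj y, cnj t)"
  shows "holo_at (conj_fun F) (x, y, t)"
proof -
  let ?C = "\<lambda>p::complex \<times> complex \<times> complex. (cnj (fst p), cnj (fst (snd p)), cnj (snd (snd p)))"
  obtain D where D: "(F has_derivative D) (at (cnj x, cnj y, cnj t))"
      "\<And>c v. D (c *\<^sub>C v) = c *\<^sub>C D v"
    using assms unfolding holo_at_def by blast
  have C: "bounded_linear ?C"
    by (intro bounded_linear_Pair bounded_linear_compose[OF bounded_linear_cnj]
      bounded_linear_fst bounded_linear_snd bounded_linear_compose[OF bounded_linear_fst]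
      bounded_linear_compose[OF bounded_linear_snd])
  have "((\<lambda>p. F (?C p)) has_derivative (\<lambda>v. D (?C v))) (at (x, y, t))"
    by (rule has_derivative_compose[OF bounded_linear_imp_has_derivative[OF C]]) (simp add: D)
  then have "((\<lambda>p. cnj (F (?C p))) has_derivative (\<lambda>v. cnj (D (?C v)))) (at (x, y, t))"
    by (rule bounded_linear.has_derivative[OF bounded_linear_cnj])
  moreover have "conj_fun F = (\<lambda>p. cnj (F (?C p)))"
    by (auto simp: conj_fun_def)
  moreover have "cnj (D (?C (c *\<^sub>C v))) = c *\<^sub>C cnj (D (?C v))" for c v
  proof -
    have "?C (c *\<^sub>C v) = cnj c *\<^sub>C ?C v"
      by (simp add: cscale_prod_def cscale_complex_def)
    then show ?thesis
      using D(2)[of "cnj c" "?C v"] by (simp add: cscale_complex_def)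
  qed
  ultimately show ?thesis
    unfolding holo_at_def by auto
qed

section \<open>Directional derivatives\<close>

text \<open>
The derivative along the complex line through \<open>x\<close> in direction \<open>v\<close>. It agrees with the Frechet derivative
(\<open>dderiv_eqI\<close>) but is a derivative in one variable, to which Cauchy's inequality applies.
\<close>

definition dderiv :: "('a::complex_normed_space \<Rightarrow> complex) \<Rightarrow> 'a \<Rightarrow> 'a \<Rightarrow> complex" where
  "dderiv F x v = deriv (\<lambda>t. F (x + t *\<^sub>C v)) 0"

lemma holo_at_line:
  fixes x :: "'a::complex_normed_space"
  assumes "holo_at F (x + t *\<^sub>C v)"
  shows "holo_at (\<lambda>t. F (x + t *\<^sub>C v)) t"
  by (rule holo_at_compose[OF holo_at_add[OF holo_at_const holo_at_cscale_left]]) (rule assms)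

lemma dderiv_eqI:
  fixes x :: "'a::complex_normed_space"
  assumes "(F has_derivative D) (at x)" "\<And>c v. D (c *\<^sub>C v) = c *\<^sub>C D v"
  shows "dderiv F x = D"
proof
  fix v :: 'a
  have *: "(0::complex) *\<^sub>C v = 0"
    using norm_cscale[of 0 v] by simp
  have "((\<lambda>t. x + t *\<^sub>C v) has_derivative (\<lambda>h. h *\<^sub>C v)) (at 0)"
    by (auto intro!: derivative_eq_intros bounded_linear_imp_has_derivative
        bounded_linear_cscale_left)
  then have "((\<lambda>t. F (x + t *\<^sub>C v)) has_derivative (\<lambda>h. D (h *\<^sub>C v))) (at 0)"
    by (rule has_derivative_compose) (simp add: assms *)
  moreover have "(\<lambda>h. D (h *\<^sub>C v)) = (*) (D v)"
    by (auto simp: assms(2) cscale_complex_def mult.commute)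
  ultimately have "((\<lambda>t. F (x + t *\<^sub>C v)) has_field_derivative D v) (at 0)"
    by (simp add: has_field_derivative_def)
  then show "dderiv F x v = D v"
    unfolding dderiv_def by (rule DERIV_imp_deriv)
qed

lemma has_derivative_dderiv:
  assumes "holo_at F x"
  shows "(F has_derivative dderiv F x) (at x)"
  using assms dderiv_eqI unfolding holo_at_def by metis

lemma dderiv_cscale:
  assumes "holo_at F x"
  shows "dderiv F x (c *\<^sub>C v) = c * dderiv F x v"
  using assms dderiv_eqI unfolding holo_at_def cscale_complex_def by metis

lemma dderiv_add:
  assumes "holo_at F x"
  shows "dderiv F x (u + v) = dderiv F x u + dderiv F x v"
  using has_derivative_dderiv[OF assms] has_derivative_bounded_linear linear_add
    bounded_linear.linear by blast

lemma dderiv_prod2: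
  fixes F :: "complex \<times> complex \<Rightarrow> complex"
  assumes "holo_at F x"
  shows "dderiv F x (a, b) = a * dderiv F x (1, 0) + b * dderiv F x (0, 1)"
proof -
  have "(a, b) = a *\<^sub>C (1, 0) + b *\<^sub>C ((0, 1)::complex \<times> complex)"
    by (simp add: cscale_prod_def cscale_complex_def)
  then show ?thesis
    by (simp only: dderiv_add[OF assms] dderiv_cscale[OF assms])
qed

lemma dderiv_prod3:
  fixes F :: "complex \<times> complex \<times> complex \<Rightarrow> complex"
  assumes "holo_at F x"
  shows "dderiv F x (a, b, c) =
    a * dderiv F x (1, 0, 0) + b * dderiv F x (0, 1, 0) + c * dderiv F x (0, 0, 1)"
proof -
  have "(a, b, c) = a *\<^sub>C (1, 0, 0) + b *\<^sub>C (0, 1, 0) + c *\<^sub>C ((0, 0, 1)::complex \<times> complex \<times> complex)"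
    by (simp add: cscale_prod_def cscale_complex_def)
  then show ?thesis
    by (simp only: dderiv_add[OF assms] dderiv_cscale[OF assms])
qed

lemma has_field_derivative_holo_at_2:
  assumes F: "holo_at F (a t, b t)"
    and "(a has_field_derivative a') (at t)" "(b has_field_derivative b') (at t)"
  shows "((\<lambda>t. F (a t, b t)) has_field_derivative
    a' * dderiv F (a t, b t) (1, 0) + b' * dderiv F (a t, b t) (0, 1)) (at t)"
proof -
  have "((\<lambda>t. (a t, b t)) has_derivative (\<lambda>h. (a' * h, b' * h))) (at t)"
    using assms(2,3) unfolding has_field_derivative_def by (rule has_derivative_Pair)
  from has_derivative_compose[OF this has_derivative_dderiv[OF F]]
  have "((\<lambda>t. F (a t, b t)) has_derivative (\<lambda>h. dderiv F (a t, b t) (a' * h, b' * h))) (at t)" .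
  moreover have "(\<lambda>h. dderiv F (a t, b t) (a' * h, b' * h)) =
      (*) (a' * dderiv F (a t, b t) (1, 0) + b' * dderiv F (a t, b t) (0, 1))"
    by (rule ext) (subst dderiv_prod2[OF F], simp add: algebra_simps)
  ultimately show ?thesis
    unfolding has_field_derivative_def by simp
qed

lemma has_field_derivative_holo_at_3:
  assumes F: "holo_at F (a t, b t, c t)"
    and "(a has_field_derivative a') (at t)" "(b has_field_derivative b') (at t)"
      "(c has_field_derivative c') (at t)"
  shows "((\<lambda>t. F (a t, b t, c t)) has_field_derivative
    a' * dderiv F (a t, b t, c t) (1, 0, 0) + b' * dderiv F (a t, b t, c t) (0, 1, 0) +
    c' * dderiv F (a t, b t, c t) (0, 0, 1)) (at t)"
proof -
  have "((\<lambda>t. (a t, b t, c t)) has_derivative (\<lambda>h. (a' * h, b' * h, c' * h))) (at t)"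
    using assms(2,3,4) unfolding has_field_derivative_def by (intro has_derivative_Pair)
  from has_derivative_compose[OF this has_derivative_dderiv[OF F]]
  have "((\<lambda>t. F (a t, b t, c t)) has_derivative
      (\<lambda>h. dderiv F (a t, b t, c t) (a' * h, b' * h, c' * h))) (at t)" .
  moreover have "(\<lambda>h. dderiv F (a t, b t, c t) (a' * h, b' * h, c' * h)) =
      (*) (a' * dderiv F (a t, b t, c t) (1, 0, 0) + b' * dderiv F (a t, b t, c t) (0, 1, 0) +
    c' * dderiv F (a t, b t, c t) (0, 0, 1))"
    by (rule ext) (subst dderiv_prod3[OF F], simp add: algebra_simps)
  ultimately show ?thesis
    unfolding has_field_derivative_def by simp
qed

lemma uniformly_near_compact:
  fixes f :: "'a::topological_space \<Rightarrow> 'b::topological_space \<Rightarrow> 'c::metric_space"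
  assumes "continuous_on (U \<times> C) (\<lambda>(x, t). f x t)" "compact C" "x0 \<in> U" "0 < e"
  obtains X where "x0 \<in> X" "open X"
    "\<And>x t. x \<in> X \<Longrightarrow> x \<in> U \<Longrightarrow> t \<in> C \<Longrightarrow> dist (f x t) (f x0 t) \<le> e"
  using continuous_on_prod_compactE[OF assms] by (metis IntI case_prod_conv)

text \<open>
Cauchy's inequality bounds the derivative of \<open>F p - F p0\<close> at the centre by the size of this function on the
disc, which is small for \<open>p\<close> near \<open>p0\<close> because the disc is compact.
\<close>

lemma continuous_deriv_parametric:
  fixes F :: "'a::metric_space \<Rightarrow> complex \<Rightarrow> complex"
  assumes "0 < r" "p0 \<in> U"
    and cont: "continuous_on (U \<times> cball 0 r) (\<lambda>(p, t). F p t)"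
    and holo: "\<And>p. p \<in> U \<Longrightarrow> F p holomorphic_on ball 0 r"
  shows "continuous (at p0 within U) (\<lambda>p. deriv (F p) 0)"
  unfolding continuous_within
proof (rule tendstoI)
  fix e :: real assume "0 < e"
  then have "0 < e / 2 * r" using assms(1) by simp
  from uniformly_near_compact[OF cont compact_cball \<open>p0 \<in> U\<close> this]
  obtain X where X: "p0 \<in> X" "open X"
    "\<And>p t. p \<in> X \<Longrightarrow> p \<in> U \<Longrightarrow> t \<in> cball 0 r \<Longrightarrow> dist (F p t) (F p0 t) \<le> e / 2 * r"
    by blast
  have contF: "continuous_on (cball 0 r) (F p)" if "p \<in> U" for p
  proof -
    have "continuous_on (cball 0 r) (\<lambda>t. (p, t))"
      by (intro continuous_on_Pair continuous_on_const continuous_on_id)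
    from continuous_on_compose2[OF cont this] show ?thesis
      using that by auto
  qed
  have "dist (deriv (F p) 0) (deriv (F p0) 0) < e" if "p \<in> X \<inter> U" for p
  proof -
    have "norm ((deriv ^^ 1) (\<lambda>t. F p t - F p0 t) 0) \<le> fact 1 * (e / 2 * r) / r ^ 1"
    proof (rule Cauchy_inequality)
      show "(\<lambda>t. F p t - F p0 t) holomorphic_on ball 0 r"
        using that holo assms by (intro holomorphic_intros) auto
      show "continuous_on (cball 0 r) (\<lambda>t. F p t - F p0 t)"
        using that contF assms by (intro continuous_intros) auto
      show "norm (F p x - F p0 x) \<le> e / 2 * r" if "norm (0 - x) = r" for x
        using X(3)[of p x] \<open>p \<in> X \<inter> U\<close> that by (simp add: dist_norm)
    qed fact
    moreover have "deriv (\<lambda>t. F p t - F p0 t) 0 = deriv (F p) 0 - deriv (F p0) 0"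
      using that holo assms
      by (intro deriv_diff holomorphic_on_imp_differentiable_at[of _ "ball 0 r"]) auto
    ultimately show ?thesis
      using \<open>0 < r\<close> \<open>0 < e\<close> by (simp add: dist_norm)
  qed
  then show "\<forall>\<^sub>F p in at p0 within U. dist (deriv (F p) 0) (deriv (F p0) 0) < e"
    using X(1,2) unfolding eventually_at_topological by blast
qed

text \<open>
Complex differentiable functions are continuously differentiable. This is what the inverse function theorem
requires, and it gives the limits of the partial derivatives that enter the leading terms.
\<close>

lemma isCont_dderiv:
  fixes F :: "'a::complex_normed_space \<Rightarrow> complex"
  assumes "\<forall>\<^sub>F y in nhds x. holo_at F y"
  shows "isCont (\<lambda>y. dderiv F y v) x"
proof -
  obtain e where e: "0 < e" "\<And>y. dist y x < e \<Longrightarrow> holo_at F y"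
    using assms unfolding eventually_nhds_metric by auto
  define r where "r = e / 2 / (norm v + 1)"
  have r: "0 < r" unfolding r_def using e(1) by (simp add: add_nonneg_pos)
  have rv: "r * norm v < e / 2"
  proof -
    have "r * (norm v + 1) = e / 2"
      by (rule nonzero_eq_divide_eq[THEN iffD1, OF _ r_def])
        (use add_nonneg_pos[of "norm v" 1] in simp)
    then show ?thesis using r by (simp add: algebra_simps)
  qed
  have inb: "holo_at F (y + t *\<^sub>C v)" if "y \<in> ball x (e/2)" "t \<in> cball 0 r" for y t
  proof (rule e(2))
    have "dist (y + t *\<^sub>C v) x \<le> dist y x + norm (t *\<^sub>C v)"
      unfolding dist_norm using norm_triangle_ineq[of "y - x" "t *\<^sub>C v"] by (simp add: algebra_simps)
    also have "norm (t *\<^sub>C v) \<le> r * norm v"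
      unfolding norm_cscale using that(2) by (intro mult_right_mono) auto
    finally show "dist (y + t *\<^sub>C v) x < e"
      using that(1) rv by (simp add: dist_commute)
  qed
  have "continuous (at x within ball x (e/2)) (\<lambda>y. deriv (\<lambda>t. F (y + t *\<^sub>C v)) 0)"
  proof (rule continuous_deriv_parametric[OF r])
    show "x \<in> ball x (e/2)" using e by simp
    have "continuous (at p) (\<lambda>p. F (fst p + snd p *\<^sub>C v))" if "p \<in> ball x (e/2) \<times> cball 0 r" for p
    proof (rule isCont_o2[where g=F])
      show "isCont (\<lambda>p. fst p + snd p *\<^sub>C v) p"
        by (intro continuous_intros bounded_linear.isCont[OF bounded_linear_cscale_left])
      show "isCont F (fst p + snd p *\<^sub>C v)"
        using that inb[of "fst p" "snd p"] by (intro holo_at_imp_isCont) auto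
    qed
    then show "continuous_on (ball x (e/2) \<times> cball 0 r) (\<lambda>(p, t). F (p + t *\<^sub>C v))"
      by (auto simp: case_prod_unfold intro!: continuous_at_imp_continuous_on)
    show "(\<lambda>t. F (y + t *\<^sub>C v)) holomorphic_on ball 0 r" if "y \<in> ball x (e/2)" for y
      using inb[OF that] holo_at_line[of F y _ v]
      by (auto simp: holomorphic_on_open holo_at_complex_iff field_differentiable_def)
  qed
  then show ?thesis
    unfolding dderiv_def using at_within_open[of x "ball x (e/2)"] e(1) by simp
qed

section \<open>Division by a coordinate\<close>

text \<open>
The class of functions in which leading coefficients are formed. It is stable under division by \<open>y\<close> of functions
that vanish for \<open>y = 0\<close>, its members have limits by joint continuity, and their restrictions to the axis \<open>y = 0\<close> are holomorphic.
\<close>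

definition sep_holo :: "real \<Rightarrow> (complex \<Rightarrow> complex \<Rightarrow> complex) \<Rightarrow> bool" where
  "sep_holo e F \<longleftrightarrow> continuous_on (ball 0 e \<times> ball 0 e) (\<lambda>(x, y). F x y) \<and>
     (\<forall>y\<in>ball 0 e. (\<lambda>x. F x y) holomorphic_on ball 0 e) \<and>
     (\<forall>x\<in>ball 0 e. F x holomorphic_on ball 0 e)"

lemma sep_holoI:
  assumes "\<And>x y. norm x < e \<Longrightarrow> norm y < e \<Longrightarrow> holo_at F (x, y)"
  shows "sep_holo e (\<lambda>x y. F (x, y))"
  unfolding sep_holo_def
proof (intro conjI ballI)
  show "continuous_on (ball 0 e \<times> ball 0 e) (\<lambda>(x, y). F (x, y))"
    using assms by (auto intro!: continuous_at_imp_continuous_on holo_at_imp_isCont)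
  show "(\<lambda>x. F (x, y)) holomorphic_on ball 0 e" if "y \<in> ball 0 e" for y
    using assms that holo_at_compose[OF holo_at_Pair[OF holo_at_ident holo_at_const[of y]], of F]
    by (auto simp: holomorphic_on_open holo_at_complex_iff field_differentiable_def)
  show "(\<lambda>y. F (x, y)) holomorphic_on ball 0 e" if "x \<in> ball 0 e" for x
    using assms that holo_at_compose[OF holo_at_Pair[OF holo_at_const[of x] holo_at_ident], of F]
    by (auto simp: holomorphic_on_open holo_at_complex_iff field_differentiable_def)
qed

lemma sep_holo_subset:
  assumes "sep_holo e F" "d \<le> e"
  shows "sep_holo d F"
  using assms unfolding sep_holo_def
  by (meson Sigma_mono continuous_on_subset holomorphic_on_subset subset_ball subsetD)

lemma sep_holo_isCont:
  assumes "sep_holo e F" "norm x < e" "norm y < e"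
  shows "isCont (\<lambda>(x, y). F x y) (x, y)"
  using assms unfolding sep_holo_def
  by (simp add: continuous_on_eq_continuous_at open_Times)

lemma sep_holo_tendsto:
  assumes "sep_holo e F" "(X \<longlongrightarrow> x) net" "(Y \<longlongrightarrow> y) net" "norm x < e" "norm y < e"
  shows "((\<lambda>n. F (X n) (Y n)) \<longlongrightarrow> F x y) net"
  using isCont_tendsto_compose[OF sep_holo_isCont[OF assms(1,4,5)] tendsto_Pair[OF assms(2,3)]]
  by simp

lemma sep_holo_at_0:
  assumes "sep_holo e A" "norm x < e" "0 < e"
  shows "((\<lambda>y. A x y) \<longlongrightarrow> A x 0) (at 0)"
  by (rule sep_holo_tendsto[OF assms(1) tendsto_const tendsto_ident_at]) (use assms in auto)

lemma sep_holo_tendsto_axis: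
  assumes "sep_holo e A" "0 < e" "(p \<longlongrightarrow> p0) (at 0)" "norm p0 < e"
  shows "((\<lambda>z::complex. A (p z) 0) \<longlongrightarrow> A p0 0) (at 0)"
  by (rule sep_holo_tendsto[OF assms(1,3) tendsto_const]) (use assms in auto)

lemma sep_holo_bounded_partials:
  assumes F: "sep_holo e F" and "0 < e"
  obtains K where "\<And>x y. norm x < e/4 \<Longrightarrow> norm y < e/4 \<Longrightarrow>
      norm (deriv (\<lambda>x. F x y) x) \<le> K \<and> norm (deriv (F x) y) \<le> K"
proof -
  have "compact ((\<lambda>(x, y). F x y) ` (cball 0 (e/2) \<times> cball 0 (e/2)))"
    using F \<open>0 < e\<close> unfolding sep_holo_def
    by (intro compact_continuous_image compact_Times compact_cball)
      (auto elim!: continuous_on_subset)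
  then obtain M where "\<forall>z\<in>(\<lambda>(x, y). F x y) ` (cball 0 (e/2) \<times> cball 0 (e/2)). norm z \<le> M"
    using compact_imp_bounded bounded_iff by metis
  then have M: "norm (F x y) \<le> M" if "norm x \<le> e/2" "norm y \<le> e/2" for x y
    using that by force
  have bd: "norm (deriv h x) \<le> M / (e/4)"
    if "h holomorphic_on ball 0 e" "norm x < e/4" "\<And>x. norm x \<le> e/2 \<Longrightarrow> norm (h x) \<le> M" for h x
  proof -
    have sub: "cball x (e/4) \<subseteq> cball 0 (e/2)"
    proof
      fix y assume "y \<in> cball x (e/4)"
      then show "y \<in> cball 0 (e/2)"
        using norm_triangle_ineq2[of y x] that(2) by (auto simp: dist_norm norm_minus_commute)
    qed
    have "norm ((deriv ^^ 1) h x) \<le> fact 1 * M / (e/4) ^ 1"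
    proof (rule Cauchy_inequality)
      have "cball x (e/4) \<subseteq> ball 0 e" using sub \<open>0 < e\<close> by force
      then show "h holomorphic_on ball x (e/4)" "continuous_on (cball x (e/4)) h"
        using that(1) holomorphic_on_imp_continuous_on
        by (meson ball_subset_cball holomorphic_on_subset order_trans)+
      show "norm (h y) \<le> M" if "norm (x - y) = e/4" for y
      proof -
        have "y \<in> cball x (e/4)" using that by (simp add: dist_norm)
        then show ?thesis using sub \<open>\<And>x. norm x \<le> e/2 \<Longrightarrow> norm (h x) \<le> M\<close> by force
      qed
    qed (use \<open>0 < e\<close> in auto)
    then show ?thesis by simp
  qed
  show thesis
  proof
    fix x y :: complex assume xy: "norm x < e/4" "norm y < e/4"
    have "norm (deriv (\<lambda>x. F x y) x) \<le> M / (e/4)"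
      using F xy M \<open>0 < e\<close> unfolding sep_holo_def by (intro bd) auto
    moreover have "norm (deriv (F x) y) \<le> M / (e/4)"
      using F xy M \<open>0 < e\<close> unfolding sep_holo_def by (intro bd) auto
    ultimately show "norm (deriv (\<lambda>x. F x y) x) \<le> M / (e/4) \<and> norm (deriv (F x) y) \<le> M / (e/4)"
      by blast
  qed
qed

text \<open>
In \<open>y\<close> this is removal of a singularity. For joint continuity, note that the quotients for two values of \<open>x\<close> differ,
by the maximum principle, no more than they do on a circle \<open>norm y = r\<close>, where division by \<open>y\<close> is harmless.
On the axis, holomorphy in \<open>x\<close> passes to the limit: by the continuity already shown, the quotients for
\<open>y \<noteq> 0\<close> converge locally uniformly as \<open>y\<close> tends to \<open>0\<close>.
\<close>

lemma sep_holo_divide: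
  assumes F: "sep_holo e F" and "0 < e" and F0: "\<And>x. norm x < e \<Longrightarrow> F x 0 = 0"
  shows "sep_holo e (\<lambda>x y. if y = 0 then deriv (F x) 0 else F x y / y)" (is "sep_holo e ?G")
proof -
  have Gy: "?G x holomorphic_on ball 0 e" if "norm x < e" for x
  proof -
    have "(\<lambda>y. if y = 0 then deriv (F x) 0 else (F x y - F x 0) / (y - 0)) holomorphic_on ball 0 e"
      using F that unfolding sep_holo_def by (intro pole_lemma_open) auto
    then show ?thesis
      using F0[OF that] by (simp cong: if_cong)
  qed
  have cont: "continuous_on (ball 0 e \<times> ball 0 e) (\<lambda>(x, y). ?G x y)"
  proof (rule continuous_at_imp_continuous_on, rule ballI)
    fix p :: "complex \<times> complex" assume "p \<in> ball 0 e \<times> ball 0 e"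
    then obtain x0 y0 where p: "p = (x0, y0)" "norm x0 < e" "norm y0 < e" by auto
    obtain r where r: "norm y0 < r" "r < e" "0 < r"
      using p(3) dense[of "norm y0" e] norm_ge_zero[of y0] by (metis order_le_less_trans)
    show "isCont (\<lambda>(x, y). ?G x y) p"
      unfolding p(1) isCont_def
    proof (rule tendstoI)
      fix d :: real assume "0 < d"
      have contF: "continuous_on (ball 0 e \<times> cball 0 r) (\<lambda>(x, y). F x y)"
        using F r unfolding sep_holo_def by (auto elim!: continuous_on_subset)
      have "x0 \<in> ball 0 e" "0 < d / 2 * r" using p \<open>0 < d\<close> r by auto
      from uniformly_near_compact[OF contF compact_cball this]
      obtain X where X: "x0 \<in> X" "open X" and
        "\<And>x y. x \<in> X \<Longrightarrow> x \<in> ball 0 e \<Longrightarrow> y \<in> cball 0 r \<Longrightarrow> dist (F x y) (F x0 y) \<le> d / 2 * r"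
        by blast
      then have X3: "dist (F x y) (F x0 y) \<le> d / 2 * r" if "x \<in> X" "norm x < e" "norm y \<le> r" for x y
        using that by simp
      have close: "norm (?G x y - ?G x0 y) \<le> d / 2" if "x \<in> X" "norm x < e" "norm y < r" for x y
      proof (rule maximum_modulus_frontier[where S = "cball 0 r" and f = "\<lambda>y. ?G x y - ?G x0 y"])
        have h: "(\<lambda>y. ?G x y - ?G x0 y) holomorphic_on ball 0 e"
          using Gy that p by (intro holomorphic_on_diff) auto
        then show "(\<lambda>y. ?G x y - ?G x0 y) holomorphic_on interior (cball 0 r)"
          using r by (auto elim!: holomorphic_on_subset)
        show "continuous_on (closure (cball 0 r)) (\<lambda>y. ?G x y - ?G x0 y)"
          using holomorphic_on_imp_continuous_on[OF h] r by (auto elim!: continuous_on_subset)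
        show "norm (?G x z - ?G x0 z) \<le> d / 2" if "z \<in> frontier (cball 0 r)" for z
        proof -
          have "norm z = r" using that r by simp
          then have "?G x z - ?G x0 z = (F x z - F x0 z) / z" using r by (auto simp: diff_divide_distrib)
          moreover have "norm (F x z - F x0 z) \<le> d / 2 * r"
            using X3[of x z] \<open>x \<in> X\<close> \<open>norm x < e\<close> \<open>norm z = r\<close> by (simp add: dist_norm)
          ultimately show ?thesis
            using r \<open>norm z = r\<close> by (simp add: norm_divide field_simps)
        qed
      qed (use that in auto)
      have "isCont (?G x0) y0"
        using holomorphic_on_imp_continuous_on[OF Gy[OF p(2)]] p(3)
        by (simp add: continuous_on_eq_continuous_at)
      then have "(?G x0 \<longlongrightarrow> ?G x0 y0) (nhds y0)"
        by (simp only: isCont_def tendsto_at_iff_tendsto_nhds[of "?G x0" y0])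
      then have "\<forall>\<^sub>F y in nhds y0. dist (?G x0 y) (?G x0 y0) < d / 2"
        by (rule tendstoD) (use \<open>0 < d\<close> in simp)
      moreover have "\<forall>\<^sub>F y in nhds y0. norm y < r"
        using r(1) open_ball[of 0 r] unfolding eventually_nhds by (intro exI[of _ "ball 0 r"]) auto
      ultimately have "\<forall>\<^sub>F y in nhds y0. dist (?G x0 y) (?G x0 y0) < d / 2 \<and> norm y < r"
        by (rule eventually_conj)
      moreover have "\<forall>\<^sub>F x in nhds x0. x \<in> X \<and> norm x < e"
        using X(1,2) p(2) unfolding eventually_nhds by (intro exI[of _ "X \<inter> ball 0 e"]) auto
      ultimately have "\<forall>\<^sub>F q in nhds x0 \<times>\<^sub>F nhds y0. (fst q \<in> X \<and> norm (fst q) < e) \<and>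
          dist (?G x0 (snd q)) (?G x0 y0) < d / 2 \<and> norm (snd q) < r"
        unfolding eventually_prod_filter by force
      then have "\<forall>\<^sub>F q in nhds (x0, y0). dist (case q of (x, y) \<Rightarrow> ?G x y) (?G x0 y0) < d"
        unfolding nhds_prod
      proof eventually_elim
        case (elim q)
        then have "norm (?G (fst q) (snd q) - ?G x0 (snd q)) \<le> d / 2"
          by (intro close) auto
        then show ?case
          using elim norm_triangle_lt[of "?G (fst q) (snd q) - ?G x0 (snd q)" "?G x0 (snd q) - ?G x0 y0" d]
          by (auto simp: case_prod_unfold dist_norm)
      qed
      then show "\<forall>\<^sub>F q in at (x0, y0).
          dist (case q of (x, y) \<Rightarrow> ?G x y) (case (x0, y0) of (x, y) \<Rightarrow> ?G x y) < d"
        by (auto simp: eventually_at_filter elim: eventually_mono)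
    qed
  qed
  have Gx: "(\<lambda>x. ?G x y) holomorphic_on ball 0 e" if "norm y < e" "y \<noteq> 0" for y
    using F that unfolding sep_holo_def by (auto intro!: holomorphic_intros)
  have Gx0: "(\<lambda>x. ?G x 0) holomorphic_on ball 0 e"
  proof (rule holomorphic_uniform_sequence)
    define Y where "Y = (\<lambda>n. complex_of_real (e / 2 * inverse (real (Suc n))))"
    have Y: "norm (Y n) < e" "Y n \<noteq> 0" for n
    proof -
      have pos: "0 < e / 2 * inverse (real (Suc n))"
        using \<open>0 < e\<close> by (intro mult_pos_pos) auto
      moreover have "e / 2 * inverse (real (Suc n)) \<le> e / 2 * 1"
        using \<open>0 < e\<close> by (intro mult_left_mono) (auto simp: inverse_le_1_iff)
      ultimately show "norm (Y n) < e" "Y n \<noteq> 0"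
        using \<open>0 < e\<close> unfolding Y_def norm_of_real of_real_eq_0_iff by linarith+
    qed
    have Ylim: "Y \<longlonglongrightarrow> 0"
    proof -
      have "(\<lambda>n. e / 2 * inverse (real (Suc n))) \<longlonglongrightarrow> e / 2 * 0"
        by (intro tendsto_intros LIMSEQ_inverse_real_of_nat)
      then have "(\<lambda>n. complex_of_real (e / 2 * inverse (real (Suc n)))) \<longlonglongrightarrow> of_real 0"
        by (intro tendsto_of_real) simp
      then show ?thesis by (simp only: Y_def of_real_0)
    qed
    show "(\<lambda>x. ?G x (Y n)) holomorphic_on ball 0 e" for n
      by (rule Gx[OF Y])
    show "\<exists>d>0. cball x d \<subseteq> ball 0 e \<and> uniform_limit (cball x d) (\<lambda>n x. ?G x (Y n)) (\<lambda>x. ?G x 0) sequentially"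
      if x: "x \<in> ball 0 e" for x
    proof -
      obtain d where d: "0 < d" "cball x d \<subseteq> ball 0 e"
        using x open_contains_cball[of "ball (0::complex) e"] by (metis open_ball)
      have sw: "continuous_on (ball 0 e \<times> cball x d) (\<lambda>(y, x). ?G x y)"
      proof -
        have "continuous_on (ball 0 e \<times> cball x d) (\<lambda>p. (snd p, fst p))"
          by (intro continuous_intros)
        moreover have "(\<lambda>p. (snd p, fst p)) ` (ball 0 e \<times> cball x d) \<subseteq> ball 0 e \<times> ball 0 e"
          using d(2) by auto
        ultimately have "continuous_on (ball 0 e \<times> cball x d) (\<lambda>p. (\<lambda>(x, y). ?G x y) (snd p, fst p))"
          by (rule continuous_on_compose2[OF cont])
        then show ?thesis
          by (simp only: case_prod_unfold fst_conv snd_conv)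
      qed
      have "uniform_limit (cball x d) (\<lambda>n x. ?G x (Y n)) (\<lambda>x. ?G x 0) sequentially"
      proof (rule uniform_limitI)
        fix c :: real assume "0 < c"
        have "(0::complex) \<in> ball 0 e" "0 < c/2" using \<open>0 < e\<close> \<open>0 < c\<close> by auto
        from uniformly_near_compact[OF sw compact_cball this]
        obtain X where X: "0 \<in> X" "open X"
          "\<And>y x'. y \<in> X \<Longrightarrow> y \<in> ball 0 e \<Longrightarrow> x' \<in> cball x d \<Longrightarrow> dist (?G x' y) (?G x' 0) \<le> c/2"
          by blast
        have "\<forall>\<^sub>F n in sequentially. Y n \<in> X"
          using Ylim X(2,1) by (rule topological_tendstoD)
        then show "\<forall>\<^sub>F n in sequentially. \<forall>x'\<in>cball x d. dist (?G x' (Y n)) (?G x' 0) < c"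
        proof eventually_elim
          case (elim n)
          show ?case
          proof
            fix x' assume "x' \<in> cball x d"
            then have "dist (?G x' (Y n)) (?G x' 0) \<le> c/2"
              using X(3)[OF elim] Y(1)[of n] unfolding mem_ball_0 by blast
            then show "dist (?G x' (Y n)) (?G x' 0) < c"
              using \<open>0 < c\<close> by linarith
          qed
        qed
      qed
      then show ?thesis using d by blast
    qed
  qed simp
  show ?thesis
    unfolding sep_holo_def
  proof (intro conjI ballI)
    show "(\<lambda>x. ?G x y) holomorphic_on ball 0 e" if "y \<in> ball 0 e" for y
      using Gx0 Gx[of y] that by (cases "y = 0") auto
  qed (use cont Gy in auto)
qed

text \<open>
Divide by \<open>y\<close> as long as the quotient vanishes on the axis. This stops: the slice through \<open>(x1, y1)\<close> has a
nonzero derivative of some order \<open>N\<close> at \<open>0\<close>, so at most \<open>N\<close> divisions are possible.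
\<close>

lemma sep_holo_factor:
  assumes F: "sep_holo e F" and "0 < e" and nz: "norm x1 < e" "norm y1 < e" "F x1 y1 \<noteq> 0"
  obtains k A x2 where "sep_holo e A" "\<And>x y. norm x < e \<Longrightarrow> norm y < e \<Longrightarrow> F x y = y ^ k * A x y"
    "norm x2 < e" "A x2 0 \<noteq> 0"
proof -
  define P where "P = (\<lambda>k. \<exists>A. sep_holo e A \<and>
    (\<forall>x y. norm x < e \<longrightarrow> norm y < e \<longrightarrow> F x y = y ^ k * A x y))"
  have "P 0" unfolding P_def using F by auto
  have "\<exists>N. \<forall>k. P k \<longrightarrow> k \<le> N"
  proof -
    have Fh: "F x1 holomorphic_on ball 0 e" using F nz unfolding sep_holo_def by auto
    obtain N where N: "(deriv ^^ N) (F x1) 0 \<noteq> 0"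
      using holomorphic_fun_eq_0_on_connected[OF Fh open_ball connected_ball, of 0 y1] nz \<open>0 < e\<close>
      by auto
    have "k \<le> N" if "P k" for k
    proof (rule ccontr)
      assume "\<not> k \<le> N"
      from that obtain A where A: "sep_holo e A"
        "\<And>x y. norm x < e \<Longrightarrow> norm y < e \<Longrightarrow> F x y = y ^ k * A x y"
        unfolding P_def by blast
      have Ah: "A x1 holomorphic_on ball 0 e" using A(1) nz unfolding sep_holo_def by auto
      have "(deriv ^^ N) (F x1) 0 = (deriv ^^ N) (\<lambda>y. y ^ k * A x1 y) 0"
        using Fh Ah A(2) nz \<open>0 < e\<close>
        by (intro higher_deriv_transform_within_open[where S = "ball 0 e"] holomorphic_intros) auto
      also have "\<dots> = (\<Sum>i=0..N. of_nat (N choose i) * (deriv ^^ i) (\<lambda>y. y ^ k) 0 * (deriv ^^ (N - i)) (A x1) 0)"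
        using Ah \<open>0 < e\<close> by (intro higher_deriv_mult[where S = "ball 0 e"] holomorphic_intros) auto
      also have "\<dots> = 0"
      proof (rule sum.neutral, rule ballI)
        fix i assume "i \<in> {0..N}"
        then have "i < k" using \<open>\<not> k \<le> N\<close> by auto
        then have "(deriv ^^ i) (\<lambda>y::complex. y ^ k) 0 = 0"
          using higher_deriv_power[of i 0 k 0] by (simp add: power_0_left)
        then show "of_nat (N choose i) * (deriv ^^ i) (\<lambda>y. y ^ k) 0 * (deriv ^^ (N - i)) (A x1) 0 = 0"
          by simp
      qed
      finally show False using N by simp
    qed
    then show ?thesis by blast
  qed
  then obtain k where k: "P k" "\<And>k'. P k' \<Longrightarrow> k' \<le> k"
    using \<open>P 0\<close> GreatestI_nat[of P 0] Greatest_le_nat[of P] by metis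
  from k(1) obtain A where A: "sep_holo e A"
      "\<And>x y. norm x < e \<Longrightarrow> norm y < e \<Longrightarrow> F x y = y ^ k * A x y"
    unfolding P_def by blast
  have "\<exists>x2. norm x2 < e \<and> A x2 0 \<noteq> 0"
  proof (rule ccontr)
    assume "\<not> ?thesis"
    then have A0: "\<And>x. norm x < e \<Longrightarrow> A x 0 = 0" by blast
    let ?G = "\<lambda>x y. if y = 0 then deriv (A x) 0 else A x y / y"
    have "F x y = y ^ Suc k * ?G x y" if "norm x < e" "norm y < e" for x y
      using A(2)[OF that] A0[OF that(1)] by auto
    then have "P (Suc k)" unfolding P_def using sep_holo_divide[OF A(1) \<open>0 < e\<close> A0] by blast
    then show False using k(2)[of "Suc k"] by simp
  qed
  then show thesis using that A by blast
qed

lemma partial_derivatives_of_factorization: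
  assumes A: "sep_holo e A"
    and F: "\<And>x y. norm x < e \<Longrightarrow> norm y < e \<Longrightarrow> F x y = y ^ k * A x y"
    and xy: "norm x < e" "norm y < e"
  shows "((\<lambda>x. F x y) has_field_derivative y ^ k * deriv (\<lambda>x. A x y) x) (at x)"
    and "(F x has_field_derivative of_nat k * y ^ (k - 1) * A x y + y ^ k * deriv (A x) y) (at y)"
proof -
  have "((\<lambda>x. A x y) has_field_derivative deriv (\<lambda>x. A x y) x) (at x)"
    using A xy unfolding sep_holo_def by (intro holomorphic_derivI[of _ "ball 0 e"]) auto
  then have "((\<lambda>x. y ^ k * A x y) has_field_derivative y ^ k * deriv (\<lambda>x. A x y) x) (at x)"
    by (rule DERIV_cmult)
  then show "((\<lambda>x. F x y) has_field_derivative y ^ k * deriv (\<lambda>x. A x y) x) (at x)"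
    by (rule has_field_derivative_transform_within_open[of _ _ _ "ball 0 e"]) (use F xy in auto)
  have "(A x has_field_derivative deriv (A x) y) (at y)"
    using A xy unfolding sep_holo_def by (intro holomorphic_derivI[of _ "ball 0 e"]) auto
  then have "((\<lambda>y. y ^ k * A x y) has_field_derivative
      of_nat k * y ^ (k - 1) * A x y + y ^ k * deriv (A x) y) (at y)"
    by (auto intro!: derivative_eq_intros)
  then show "(F x has_field_derivative of_nat k * y ^ (k - 1) * A x y + y ^ k * deriv (A x) y) (at y)"
    by (rule has_field_derivative_transform_within_open[of _ _ _ "ball 0 e"]) (use F xy in auto)
qed

section \<open>Germs at the origin\<close>

lemma eventually_nhds_0_compose:
  assumes "isCont h 0" "h 0 = 0" "eventually P (nhds 0)"
  shows "\<forall>\<^sub>F x in nhds 0. P (h x)"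
proof -
  have "filterlim h (nhds 0) (nhds 0)"
    using assms(1,2) tendsto_at_iff_tendsto_nhds[of h 0] unfolding isCont_def by simp
  then show ?thesis
    using assms(3) by (auto simp: filterlim_iff)
qed

lemma eventually_nhds_0_polydisc_2:
  fixes P :: "'a::real_normed_vector \<times> 'b::real_normed_vector \<Rightarrow> bool"
  assumes "\<forall>\<^sub>F p in nhds 0. P p"
  obtains e where "0 < e" "\<And>x y. norm x < e \<Longrightarrow> norm y < e \<Longrightarrow> P (x, y)"
proof -
  obtain d where d: "0 < d" "\<And>p. dist p 0 < d \<Longrightarrow> P p"
    using assms unfolding eventually_nhds_metric by auto
  show thesis
  proof (rule that[of "d/2"])
    fix x :: 'a and y :: 'b assume "norm x < d/2" "norm y < d/2"
    then show "P (x, y)"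
      using norm_Pair_le[of x y] by (intro d(2)) simp
  qed (use d in simp)
qed

lemma eventually_nhds_0_polydisc_3:
  fixes P :: "'a::real_normed_vector \<times> 'b::real_normed_vector \<times> 'c::real_normed_vector \<Rightarrow> bool"
  assumes "\<forall>\<^sub>F p in nhds 0. P p"
  obtains e where "0 < e" "\<And>x y t. norm x < e \<Longrightarrow> norm y < e \<Longrightarrow> norm t < e \<Longrightarrow> P (x, y, t)"
proof -
  obtain d where d: "0 < d" "\<And>p. dist p 0 < d \<Longrightarrow> P p"
    using assms unfolding eventually_nhds_metric by auto
  show thesis
  proof (rule that[of "d/3"])
    fix x :: 'a and y :: 'b and t :: 'c assume "norm x < d/3" "norm y < d/3" "norm t < d/3"
    then show "P (x, y, t)"
      using norm_Pair_le[of x "(y, t)"] norm_Pair_le[of y t] by (intro d(2)) simp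
  qed (use d in simp)
qed

lemma eventually_nhds_0_ball:
  fixes P :: "'a::real_normed_vector \<Rightarrow> bool"
  shows "(\<forall>\<^sub>F x in nhds 0. P x) \<longleftrightarrow> (\<exists>e>0. \<forall>x. norm x < e \<longrightarrow> P x)"
  unfolding eventually_nhds_metric by simp

lemma eventually_nhds_0_prod_iff:
  fixes P :: "'a::real_normed_vector \<times> 'b::real_normed_vector \<Rightarrow> bool"
  shows "(\<forall>\<^sub>F p in nhds 0. P p) \<longleftrightarrow> (\<exists>e>0. \<forall>x y. norm x < e \<longrightarrow> norm y < e \<longrightarrow> P (x, y))"
proof
  assume "\<forall>\<^sub>F p in nhds 0. P p"
  then show "\<exists>e>0. \<forall>x y. norm x < e \<longrightarrow> norm y < e \<longrightarrow> P (x, y)"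
    by (rule eventually_nhds_0_polydisc_2) blast
next
  assume "\<exists>e>0. \<forall>x y. norm x < e \<longrightarrow> norm y < e \<longrightarrow> P (x, y)"
  then obtain e where e: "e > 0" "\<And>x y. norm x < e \<Longrightarrow> norm y < e \<Longrightarrow> P (x, y)" by blast
  have "P p" if "norm p < e" for p
    using e(2)[of "fst p" "snd p"] that norm_fst_le[of "fst p" "snd p"] norm_snd_le[of "snd p" "fst p"]
    by simp
  then show "\<forall>\<^sub>F p in nhds 0. P p"
    using e(1) eventually_nhds_0_ball by blast
qed

lemma eventually_nhds_0_prod3_iff:
  fixes P :: "'a::real_normed_vector \<times> 'b::real_normed_vector \<times> 'c::real_normed_vector \<Rightarrow> bool"
  shows "(\<forall>\<^sub>F p in nhds 0. P p) \<longleftrightarrow>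
    (\<exists>e>0. \<forall>x y t. norm x < e \<longrightarrow> norm y < e \<longrightarrow> norm t < e \<longrightarrow> P (x, y, t))"
proof
  assume "\<forall>\<^sub>F p in nhds 0. P p"
  then show "\<exists>e>0. \<forall>x y t. norm x < e \<longrightarrow> norm y < e \<longrightarrow> norm t < e \<longrightarrow> P (x, y, t)"
    by (rule eventually_nhds_0_polydisc_3) blast
next
  assume "\<exists>e>0. \<forall>x y t. norm x < e \<longrightarrow> norm y < e \<longrightarrow> norm t < e \<longrightarrow> P (x, y, t)"
  then obtain e where e: "e > 0"
    "\<And>x y t. norm x < e \<Longrightarrow> norm y < e \<Longrightarrow> norm t < e \<Longrightarrow> P (x, y, t)" by blast
  have "P (x, q)" if "norm x < e" "norm q < e" for x q
    using e(2)[of x "fst q" "snd q"] that norm_fst_le[of "fst q" "snd q"] norm_snd_le[of "snd q" "fst q"]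
    by simp
  then show "\<forall>\<^sub>F p in nhds 0. P p"
    using e(1) eventually_nhds_0_prod_iff by blast
qed

lemma eventually_at_0_norm_less: "0 < e \<Longrightarrow> \<forall>\<^sub>F x in at (0::complex). norm x < e"
  unfolding eventually_at by auto

lemma eventually_norm_less:
  assumes "(h \<longlongrightarrow> l) (at (0::complex))" "norm (l::complex) < e"
  shows "\<forall>\<^sub>F x in at 0. norm (h x) < e"
  using order_tendstoD(2)[OF tendsto_norm[OF assms(1)] assms(2)] .

lemma holo_near_0_isCont: "holo_near_0 F \<Longrightarrow> isCont F 0"
  unfolding holo_near_0_iff_eventually using eventually_nhds_x_imp_x holo_at_imp_isCont by blast

lemma holo_at_slice:
  assumes "\<forall>\<^sub>F p in nhds 0. holo_at F p"
  shows "\<forall>\<^sub>F p in nhds (0::complex \<times> complex). holo_at (\<lambda>p. F (fst p, snd p, (0::complex))) p"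
proof -
  have "\<forall>\<^sub>F p in nhds (0::complex \<times> complex). holo_at F (fst p, snd p, 0::complex)"
    by (rule eventually_nhds_0_compose[OF _ _ assms])
      (auto simp: zero_prod_def intro!: isCont_Pair isCont_fst isCont_snd)
  then show ?thesis
    by eventually_elim (rule holo_at_compose[where F = "\<lambda>p. (fst p, snd p, 0)"], auto intro!: holo_at_intros)
qed

lemma holo_at_axis:
  assumes "holo_near_0 F"
  shows "\<forall>\<^sub>F x in nhds (0::complex). holo_at (\<lambda>x. F (x, (0::complex))) x"
proof -
  have "\<forall>\<^sub>F x in nhds (0::complex). holo_at F (x, 0::complex)"
    using assms unfolding holo_near_0_iff_eventually
    by (rule eventually_nhds_0_compose[rotated 2])
      (auto simp: zero_prod_def intro!: isCont_Pair)
  then show ?thesis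
    by eventually_elim (rule holo_at_compose[where F = "\<lambda>x. (x, 0)"], auto intro!: holo_at_intros)
qed

lemma has_field_derivative_0_mult:
  fixes A :: "complex \<Rightarrow> complex"
  assumes "\<forall>\<^sub>F x in nhds 0. h x = x * A x" "(A \<longlongrightarrow> a) (at 0)"
  shows "(h has_field_derivative a) (at 0)"
proof -
  have "h 0 = 0" using eventually_nhds_x_imp_x[OF assms(1)] by simp
  have "\<forall>\<^sub>F x in at 0. A x = (h (0 + x) - h 0) / x"
    using assms(1) unfolding eventually_at_filter by eventually_elim (simp add: \<open>h 0 = 0\<close>)
  with assms(2) show ?thesis
    unfolding DERIV_def by (rule Lim_transform_eventually)
qed

section \<open>Orders of vanishing and leading coefficients\<close>

text \<open>
The order of \<open>F\<close> along the axis \<open>y = 0\<close>: the leading coefficient \<open>A x 0\<close> may vanish at the origin, and the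
radius \<open>e\<close> is small enough to exclude its other zeros. That it may vanish is essential, since the leading
coefficients of \<^term>\<open>\<lambda>x y. Q (x, y, 0 :: complex) :: complex\<close> do so in normal coordinates.
\<close>

definition y_order :: "(complex \<Rightarrow> complex \<Rightarrow> complex) \<Rightarrow> nat \<Rightarrow> bool" where
  "y_order F k \<longleftrightarrow> (\<exists>e>0. \<exists>A. sep_holo e A \<and>
     (\<forall>x y. norm x < e \<longrightarrow> norm y < e \<longrightarrow> F x y = y ^ k * A x y) \<and>
     (\<forall>x. x \<noteq> 0 \<longrightarrow> norm x < e \<longrightarrow> A x 0 \<noteq> 0))"

lemma y_orderE:
  assumes "y_order F k"
  obtains e A where "0 < e" "\<And>d. d \<le> e \<Longrightarrow> sep_holo d A"
    "\<And>x y. norm x < e \<Longrightarrow> norm y < e \<Longrightarrow> F x y = y ^ k * A x y"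
    "\<And>x. x \<noteq> 0 \<Longrightarrow> norm x < e \<Longrightarrow> A x 0 \<noteq> 0"
  using assms sep_holo_subset unfolding y_order_def by blast

lemma y_order_exists:
  assumes "\<forall>\<^sub>F p in nhds 0. holo_at F p" "\<not> (\<forall>\<^sub>F p in nhds 0. F p = 0)"
  shows "\<exists>k. y_order (\<lambda>x y. F (x, y)) k"
proof -
  obtain e where e: "0 < e" "\<And>x y. norm x < e \<Longrightarrow> norm y < e \<Longrightarrow> holo_at F (x, y)"
    using assms(1) eventually_nhds_0_polydisc_2 by blast
  have sep: "sep_holo e (\<lambda>x y. F (x, y))"
    by (intro sep_holoI e)
  obtain x1 y1 where "norm x1 < e" "norm y1 < e" "F (x1, y1) \<noteq> 0"
    using assms(2) e(1) unfolding eventually_nhds_0_prod_iff by blast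
  from sep_holo_factor[OF sep e(1) this] obtain A k x2 where A: "sep_holo e A"
    "\<And>x y. norm x < e \<Longrightarrow> norm y < e \<Longrightarrow> F (x, y) = y ^ k * A x y" "norm x2 < e" "A x2 0 \<noteq> 0"
    by metis
  have "(\<lambda>x. A x 0) holomorphic_on ball 0 e"
    using A(1) e(1) unfolding sep_holo_def by simp
  then have "\<forall>\<^sub>F x in at 0. A x 0 \<noteq> 0 \<and> x \<in> ball 0 e"
    by (rule non_zero_neighbour_alt[where \<beta> = x2]) (use A e in auto)
  then obtain d where d: "0 < d" "\<And>x. x \<noteq> 0 \<Longrightarrow> dist x 0 < d \<Longrightarrow> A x 0 \<noteq> 0"
    unfolding eventually_at by auto
  have "y_order (\<lambda>x y. F (x, y)) k"
    unfolding y_order_def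
    using A(2) d e(1) sep_holo_subset[OF A(1), of "min d e"]
    by (intro exI[of _ "min d e"] conjI exI[of _ A]) auto
  then show ?thesis by blast
qed

text \<open>
Two expansions \<open>x\<^sup>a (l + o(1))\<close> and \<open>x\<^sup>b (r + o(1))\<close> of the same function have equal exponents and
coefficients.
\<close>

lemma power_mult_limits_eq:
  fixes L R :: "complex \<Rightarrow> complex"
  assumes eq: "\<forall>\<^sub>F x in at 0. x ^ a * L x = x ^ b * R x"
    and L: "(L \<longlongrightarrow> l) (at 0)" and R: "(R \<longlongrightarrow> r) (at 0)" and nz: "l \<noteq> 0" "r \<noteq> 0"
  shows "a = b" "l = r"
proof -
  have *: "False" if "a < b" "\<forall>\<^sub>F x in at 0. x ^ a * L x = x ^ b * R x"
      "(L \<longlongrightarrow> l) (at 0)" "(R \<longlongrightarrow> r) (at 0)" "l \<noteq> 0" for a b l r and L R :: "complex \<Rightarrow> complex"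
  proof -
    have "\<forall>\<^sub>F x in at 0. x ^ (b - a) * R x = L x"
      using that(2) eventually_neq_at_within[of 0 0]
    proof eventually_elim
      case (elim x)
      have "x ^ b = x ^ a * x ^ (b - a)" using \<open>a < b\<close> by (simp flip: power_add)
      then show ?case using elim by simp
    qed
    moreover have "((\<lambda>x. x ^ (b - a) * R x) \<longlongrightarrow> 0 ^ (b - a) * r) (at 0)"
      by (intro tendsto_intros that)
    ultimately have "(L \<longlongrightarrow> 0 ^ (b - a) * r) (at 0)"
      by (rule Lim_transform_eventually[rotated])
    then have "l = 0 ^ (b - a) * r"
      using that(3) tendsto_unique at_neq_bot by blast
    then show False using that by simp
  qed
  show "a = b"
  proof (rule ccontr)
    assume "a \<noteq> b"
    then consider "a < b" | "b < a" by linarith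
    then show False
    proof cases
      case 1 then show False using *[OF 1 eq L R nz(1)] by blast
    next
      case 2
      have "\<forall>\<^sub>F x in at 0. x ^ b * R x = x ^ a * L x"
        using eq by eventually_elim simp
      then show False using *[OF 2 _ R L nz(2)] by blast
    qed
  qed
  have "\<forall>\<^sub>F x in at 0. L x = R x"
    using eq eventually_neq_at_within[of 0 0] by eventually_elim (simp add: \<open>a = b\<close>)
  then have "(R \<longlongrightarrow> l) (at 0)"
    using L by (rule Lim_transform_eventually[rotated])
  then show "l = r" using R tendsto_unique at_neq_bot by blast
qed

lemma y_order_cong_unique:
  assumes F: "y_order F k" and G: "y_order G l"
    and eq: "\<forall>\<^sub>F (x, y) in nhds 0. F x y = G x y"
  shows "k = l"
proof -
  obtain e1 A where A: "0 < e1" "\<And>d. d \<le> e1 \<Longrightarrow> sep_holo d A"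
    "\<And>x y. norm x < e1 \<Longrightarrow> norm y < e1 \<Longrightarrow> F x y = y ^ k * A x y"
    "\<And>x. x \<noteq> 0 \<Longrightarrow> norm x < e1 \<Longrightarrow> A x 0 \<noteq> 0"
    using y_orderE[OF F] by metis
  obtain e2 B where B: "0 < e2" "\<And>d. d \<le> e2 \<Longrightarrow> sep_holo d B"
    "\<And>x y. norm x < e2 \<Longrightarrow> norm y < e2 \<Longrightarrow> G x y = y ^ l * B x y"
    "\<And>x. x \<noteq> 0 \<Longrightarrow> norm x < e2 \<Longrightarrow> B x 0 \<noteq> 0"
    using y_orderE[OF G] by metis
  obtain e3 where e3: "0 < e3" "\<And>x y. norm x < e3 \<Longrightarrow> norm y < e3 \<Longrightarrow> F x y = G x y"
    using eventually_nhds_0_polydisc_2[OF eq] by auto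
  define e where "e = min e1 (min e2 e3)"
  have e: "0 < e" "e \<le> e1" "e \<le> e2" "e \<le> e3" using A(1) B(1) e3(1) by (auto simp: e_def)
  define x where "x = complex_of_real (e / 2)"
  have x: "x \<noteq> 0" "norm x < e" using e(1) by (auto simp: x_def)
  show ?thesis
  proof (rule power_mult_limits_eq(1))
    show "\<forall>\<^sub>F y in at 0. y ^ k * A x y = y ^ l * B x y"
      using eventually_at_0_norm_less[OF e(1)]
    proof eventually_elim
      case (elim y)
      then show ?case using A(3)[of x y] B(3)[of x y] e3(2)[of x y] x e by simp
    qed
    show "((\<lambda>y. A x y) \<longlongrightarrow> A x 0) (at 0)" "((\<lambda>y. B x y) \<longlongrightarrow> B x 0) (at 0)"
      using sep_holo_at_0[OF A(2)[OF e(2)] x(2) e(1)] sep_holo_at_0[OF B(2)[OF e(3)] x(2) e(1)] .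
    show "A x 0 \<noteq> 0" "B x 0 \<noteq> 0" using A(4) B(4) x e by auto
  qed
qed

lemma factor_zero_at_0:
  fixes h :: "complex \<Rightarrow> complex"
  assumes "\<forall>\<^sub>F x in nhds 0. holo_at h x" "h 0 = 0" "\<not> (\<forall>\<^sub>F x in nhds 0. h x = 0)"
  obtains s e C where "0 < (s::nat)" "zorder h 0 = int s" "0 < e" "isCont C 0"
    "\<And>x. norm x < e \<Longrightarrow> h x = x ^ s * C x \<and> C x \<noteq> 0"
proof -
  obtain d where d: "0 < d" "\<And>x. norm x < d \<Longrightarrow> holo_at h x"
    using assms(1) unfolding eventually_nhds_0_ball by blast
  have holo: "h holomorphic_on ball 0 d"
    using d(2) by (auto simp: holomorphic_on_open holo_at_complex_iff field_differentiable_def)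
  have ex: "\<exists>w\<in>ball 0 d. h w \<noteq> 0"
    using assms(3) d(1) unfolding eventually_nhds_0_ball by (metis mem_ball_0)
  have "0 \<in> ball (0::complex) d" using d(1) by simp
  note zero = zorder_exist_zero[OF holo open_ball connected_ball this ex]
  have "0 < zorder h 0"
    using conjunct1[OF zero] assms(2) by simp
  obtain r where r: "r > 0" "zor_poly h 0 holomorphic_on cball 0 r"
    "\<And>w. norm w \<le> r \<Longrightarrow> h w = zor_poly h 0 w * (w - 0) ^ nat (zorder h 0) \<and> zor_poly h 0 w \<noteq> 0"
    using conjunct2[OF zero] by (auto simp: dist_norm)
  show thesis
  proof (rule that[of "nat (zorder h 0)" r "zor_poly h 0"])
    have "continuous_on (ball 0 r) (zor_poly h 0)"
      using r(2) holomorphic_on_imp_continuous_on continuous_on_subset ball_subset_cball by blast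
    then show "isCont (zor_poly h 0) 0"
      using r(1) by (simp add: continuous_on_eq_continuous_at)
    show "h x = x ^ nat (zorder h 0) * zor_poly h 0 x \<and> zor_poly h 0 x \<noteq> 0" if "norm x < r" for x
      using r(3)[of x] that by (simp add: mult.commute)
  qed (use \<open>0 < zorder h 0\<close> r in auto)
qed

text \<open>
Cramer's rule. In the application \<open>D\<close> and \<open>E\<close> depend on \<open>\<zeta>\<close> alone, while the other functions belong to two
values of \<open>z\<close>.
\<close>

lemma limits_of_coefficients:
  fixes D E :: "complex \<Rightarrow> complex"
  assumes 1: "((\<lambda>x. D x * b1 x + E x * v1 x) \<longlongrightarrow> l1) (at 0)" "(b1 \<longlongrightarrow> \<beta>1) (at 0)" "(v1 \<longlongrightarrow> 1) (at 0)"
    and 2: "((\<lambda>x. D x * b2 x + E x * v2 x) \<longlongrightarrow> l2) (at 0)" "(b2 \<longlongrightarrow> \<beta>2) (at 0)" "(v2 \<longlongrightarrow> 1) (at 0)"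
    and ne: "\<beta>1 \<noteq> \<beta>2"
  obtains d e where "(D \<longlongrightarrow> d) (at 0)" "(E \<longlongrightarrow> e) (at 0)"
proof -
  let ?det = "\<lambda>x. b1 x * v2 x - b2 x * v1 x"
  have det: "(?det \<longlongrightarrow> \<beta>1 * 1 - \<beta>2 * 1) (at 0)"
    by (intro tendsto_intros assms)
  moreover have "\<beta>1 * 1 - \<beta>2 * 1 \<noteq> 0" using ne by simp
  ultimately have nz: "\<forall>\<^sub>F x in at 0. ?det x \<noteq> 0"
    by (rule tendsto_imp_eventually_ne)
  let ?L1 = "\<lambda>x. D x * b1 x + E x * v1 x" and ?L2 = "\<lambda>x. D x * b2 x + E x * v2 x"
  have "((\<lambda>x. (?L1 x * v2 x - ?L2 x * v1 x) / ?det x) \<longlongrightarrow> (l1 * 1 - l2 * 1) / (\<beta>1 * 1 - \<beta>2 * 1)) (at 0)"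
    by (intro tendsto_intros assms) (use ne in simp)
  moreover have "\<forall>\<^sub>F x in at 0. (?L1 x * v2 x - ?L2 x * v1 x) / ?det x = D x"
    using nz by eventually_elim (simp add: field_simps)
  ultimately have D: "(D \<longlongrightarrow> (l1 * 1 - l2 * 1) / (\<beta>1 * 1 - \<beta>2 * 1)) (at 0)"
    by (rule Lim_transform_eventually)
  have "((\<lambda>x. (?L2 x * b1 x - ?L1 x * b2 x) / ?det x) \<longlongrightarrow> (l2 * \<beta>1 - l1 * \<beta>2) / (\<beta>1 * 1 - \<beta>2 * 1)) (at 0)"
    by (intro tendsto_intros assms) (use ne in simp)
  moreover have "\<forall>\<^sub>F x in at 0. (?L2 x * b1 x - ?L1 x * b2 x) / ?det x = E x"
    using nz by eventually_elim (simp add: field_simps)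
  ultimately have "(E \<longlongrightarrow> (l2 * \<beta>1 - l1 * \<beta>2) / (\<beta>1 * 1 - \<beta>2 * 1)) (at 0)"
    by (rule Lim_transform_eventually)
  with D that show thesis by blast
qed

section \<open>Normal coordinates and Segre preserving germs\<close>

lemma conj_fun_apply: "conj_fun Q (x, y, t) = cnj (Q (cnj x, cnj y, cnj t))"
  by (simp add: conj_fun_def)

lemma conj_fun_conj_fun [simp]: "conj_fun (conj_fun Q) = Q"
  by (auto simp: conj_fun_def fun_eq_iff)

text \<open>
The conditions on \<open>Q\<close> in \<^const>\<open>normal_coords\<close>. They are preserved by \<^const>\<open>conj_fun\<close>
(\<open>normal_eq_conj_fun\<close>), which is needed to exchange the two factors of the complexification.
\<close>

definition normal_eq :: "(complex \<times> complex \<times> complex \<Rightarrow> complex) \<Rightarrow> bool" where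
  "normal_eq Q \<longleftrightarrow>
    holo_near_0 Q \<and>
    (\<forall>\<^sub>F (\<zeta>, \<tau>) in nhds 0. Q (0, \<zeta>, \<tau>) = \<tau>) \<and>
    (\<forall>\<^sub>F (z, \<tau>) in nhds 0. Q (z, 0, \<tau>) = \<tau>) \<and>
    (\<forall>\<^sub>F (z, \<zeta>, w) in nhds 0. Q (z, \<zeta>, conj_fun Q (\<zeta>, z, w)) = w)"

lemma normal_coords_imp_normal_eq: "normal_coords M Q \<Longrightarrow> normal_eq Q"
  by (simp add: normal_coords_def normal_eq_def)

lemma normal_eq_at_0: "normal_eq Q \<Longrightarrow> Q 0 = 0"
  unfolding normal_eq_def using eventually_nhds_x_imp_x by (fastforce simp: zero_prod_def)

lemma holo_near_0_conj_fun:
  assumes "holo_near_0 Q"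
  shows "holo_near_0 (conj_fun Q)"
proof -
  obtain e where e: "e > 0"
    "\<And>x y t. norm x < e \<Longrightarrow> norm y < e \<Longrightarrow> norm t < e \<Longrightarrow> holo_at Q (x, y, t)"
    using assms unfolding holo_near_0_iff_eventually eventually_nhds_0_prod3_iff by blast
  then show ?thesis
    unfolding holo_near_0_iff_eventually eventually_nhds_0_prod3_iff
    by (intro exI[of _ e]) (auto intro!: holo_at_conj_fun)
qed

lemma normal_eq_conj_fun:
  assumes "normal_eq Q"
  shows "normal_eq (conj_fun Q)"
  unfolding normal_eq_def
proof (intro conjI)
  show "holo_near_0 (conj_fun Q)"
    using assms holo_near_0_conj_fun unfolding normal_eq_def by blast
  obtain e where e: "e > 0" "\<And>x t. norm x < e \<Longrightarrow> norm t < e \<Longrightarrow> Q (0, x, t) = t"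
    using assms unfolding normal_eq_def eventually_nhds_0_prod_iff by auto
  then have "conj_fun Q (0, x, t) = t" if "norm x < e" "norm t < e" for x t
    using that e(2)[of "cnj x" "cnj t"] by (simp add: conj_fun_apply)
  then show "\<forall>\<^sub>F (\<zeta>, \<tau>) in nhds 0. conj_fun Q (0, \<zeta>, \<tau>) = \<tau>"
    unfolding eventually_nhds_0_prod_iff using e(1) by (intro exI[of _ e]) simp
  obtain e where e: "e > 0" "\<And>x t. norm x < e \<Longrightarrow> norm t < e \<Longrightarrow> Q (x, 0, t) = t"
    using assms unfolding normal_eq_def eventually_nhds_0_prod_iff by auto
  then have "conj_fun Q (x, 0, t) = t" if "norm x < e" "norm t < e" for x t
    using that e(2)[of "cnj x" "cnj t"] by (simp add: conj_fun_apply)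
  then show "\<forall>\<^sub>F (\<zeta>, \<tau>) in nhds 0. conj_fun Q (\<zeta>, 0, \<tau>) = \<tau>"
    unfolding eventually_nhds_0_prod_iff using e(1) by (intro exI[of _ e]) simp
  have "\<forall>\<^sub>F (z, \<zeta>, w) in nhds 0. Q (z, \<zeta>, conj_fun Q (\<zeta>, z, w)) = w"
    using assms unfolding normal_eq_def by blast
  then obtain e where e: "e > 0" "\<And>x y t. norm x < e \<Longrightarrow> norm y < e \<Longrightarrow> norm t < e
      \<Longrightarrow> Q (x, y, conj_fun Q (y, x, t)) = t"
    unfolding eventually_nhds_0_prod3_iff by auto
  have "conj_fun Q (x, y, Q (y, x, t)) = t" if "norm x < e" "norm y < e" "norm t < e" for x y t
    using that e(2)[of "cnj x" "cnj y" "cnj t"] by (simp add: conj_fun_apply)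
  then show "\<forall>\<^sub>F (z, \<zeta>, w) in nhds 0. conj_fun Q (z, \<zeta>, conj_fun (conj_fun Q) (\<zeta>, z, w)) = w"
    unfolding eventually_nhds_0_prod3_iff using e(1) by (intro exI[of _ e]) simp
qed

lemma normal_eq_inverse:
  assumes "normal_eq Q"
  shows "\<forall>\<^sub>F (z, \<zeta>, w) in nhds 0. conj_fun Q (z, \<zeta>, Q (\<zeta>, z, w)) = w"
  using normal_eq_conj_fun[OF assms] unfolding normal_eq_def by simp

lemma is_HSPM_iff:
  "is_HSPM Q Q' f g ft gt \<longleftrightarrow> holo_near_0 f \<and> holo_near_0 g \<and> holo_near_0 ft \<and> holo_near_0 gt \<and>
    f 0 = 0 \<and> g 0 = 0 \<and> ft 0 = 0 \<and> gt 0 = 0 \<and>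
    (\<forall>\<^sub>F p in nhds 0. snd (fst p) = Q (fst (fst p), snd p) \<longrightarrow>
       g (fst p) = Q' (f (fst p), ft (snd p), gt (snd p)))"
  unfolding is_HSPM_def complexification_def segre_map_def
  by (simp add: case_prod_unfold zero_prod_def)

text \<open>
In the lemmas about this locale, \<open>(z, w)\<close> and \<open>(x, t)\<close> are the coordinates of the two factors \<open>\<complex>\<^sup>2\<close>; thus
\<open>x\<close> and \<open>t\<close> stand for \<open>\<zeta>\<close> and \<open>\<tau>\<close>.
\<close>

locale segre_germ =
  fixes Q Q' :: "complex \<times> complex \<times> complex \<Rightarrow> complex"
    and f g ft gt :: "complex \<times> complex \<Rightarrow> complex"
  assumes nQ: "normal_eq Q" and nQ': "normal_eq Q'" and hspm: "is_HSPM Q Q' f g ft gt"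

begin

lemma holo: "holo_near_0 Q" "holo_near_0 Q'" "holo_near_0 f" "holo_near_0 g" "holo_near_0 ft"
    "holo_near_0 gt"
  using nQ nQ' hspm unfolding normal_eq_def is_HSPM_iff by blast+

lemma at_0: "Q 0 = 0" "Q' 0 = 0" "f 0 = 0" "g 0 = 0" "ft 0 = 0" "gt 0 = 0"
  using nQ nQ' hspm normal_eq_at_0 unfolding is_HSPM_iff by blast+

text \<open>
The equations \<open>w = Q(z, x, t)\<close> and \<open>t = conj_fun Q (x, z, w)\<close> define the same germ, by the reality condition,
and likewise in the target. So the map with its two factors exchanged is again Segre preserving, for the
conjugate equations; every result on \<open>(f, g)\<close> yields one on \<open>(ft, gt)\<close>.
\<close>

lemma swap: "segre_germ (conj_fun Q) (conj_fun Q') ft gt f g"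
proof
  show "normal_eq (conj_fun Q)" "normal_eq (conj_fun Q')"
    using nQ nQ' normal_eq_conj_fun by blast+
  let ?P = "conj_fun Q" and ?P' = "conj_fun Q'"
  have "\<forall>\<^sub>F p in nhds 0. snd (fst (snd p, fst p)) = Q (fst (fst (snd p, fst p)), snd (snd p, fst p)) \<longrightarrow>
       g (fst (snd p, fst p)) = Q' (f (fst (snd p, fst p)), ft (snd (snd p, fst p)), gt (snd (snd p, fst p)))"
    by (rule eventually_nhds_0_compose[of "\<lambda>p. (snd p, fst p)"])
       (use hspm in \<open>auto simp: is_HSPM_iff zero_prod_def intro!: continuous_intros\<close>)
  then have 1: "\<forall>\<^sub>F p::(complex \<times> complex) \<times> complex \<times> complex in nhds 0.
      snd (snd p) = Q (fst (snd p), fst p) \<longrightarrow>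
       g (snd p) = Q' (f (snd p), ft (fst p), gt (fst p))"
    by simp
  have "\<forall>\<^sub>F (z, \<zeta>, w) in nhds 0. Q (z, \<zeta>, conj_fun Q (\<zeta>, z, w)) = w"
    using nQ unfolding normal_eq_def by blast
  then have 2: "\<forall>\<^sub>F p::(complex \<times> complex) \<times> complex \<times> complex in nhds 0. case (fst (snd p), fst (fst p), snd (snd p)) of
      (z, \<zeta>, w) \<Rightarrow> Q (z, \<zeta>, conj_fun Q (\<zeta>, z, w)) = w"
    by (rule eventually_nhds_0_compose[where
      h = "\<lambda>p::(complex \<times> complex) \<times> complex \<times> complex. (fst (snd p), fst (fst p), snd (snd p))", rotated 2])
      (auto simp: zero_prod_def intro!: continuous_intros)
  have 3: "\<forall>\<^sub>F p::(complex \<times> complex) \<times> complex \<times> complex in nhds 0. case (ft (fst p), f (snd p), gt (fst p)) of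
      (z, \<zeta>, w) \<Rightarrow> conj_fun Q' (z, \<zeta>, Q' (\<zeta>, z, w)) = w"
  proof (rule eventually_nhds_0_compose[where
        h = "\<lambda>p::(complex \<times> complex) \<times> complex \<times> complex. (ft (fst p), f (snd p), gt (fst p))",
        OF _ _ normal_eq_inverse[OF nQ']])
    show "isCont (\<lambda>p. (ft (fst p), f (snd p), gt (fst p))) 0"
      using holo[THEN holo_near_0_isCont]
      by (intro isCont_Pair isCont_o2[of 0 fst ft] isCont_o2[of 0 snd f] isCont_o2[of 0 fst gt]
          isCont_fst isCont_snd continuous_ident) simp_all
    show "(ft (fst 0), f (snd 0), gt (fst 0)) = 0"
      using at_0 by (simp add: zero_prod_def)
  qed
  have "\<forall>\<^sub>F p in nhds 0. snd (fst p) = ?P (fst (fst p), snd p) \<longrightarrow>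
       gt (fst p) = ?P' (ft (fst p), f (snd p), g (snd p))"
    using 1 2 3
  proof eventually_elim
    case (elim p)
    obtain x t z w where p: "p = ((x, t), (z, w))" by (metis prod.collapse)
    show ?case using elim by (auto simp: p)
  qed
  then show "is_HSPM ?P ?P' ft gt f g"
    using hspm unfolding is_HSPM_iff by blast
qed

text \<open>
The mapping condition in the parameters \<open>p = (z, x, t)\<close> of the complexification.
\<close>

lemma basic_equation:
  "\<forall>\<^sub>F p in nhds 0. g (fst p, Q p) = Q' (f (fst p, Q p), ft (snd p), gt (snd p))"
proof -
  let ?h = "\<lambda>p. ((fst p, Q p), snd p)"
  have "\<forall>\<^sub>F p in nhds 0. snd (fst (?h p)) = Q (fst (fst (?h p)), snd (?h p)) \<longrightarrow>
       g (fst (?h p)) = Q' (f (fst (?h p)), ft (snd (?h p)), gt (snd (?h p)))"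
  proof (rule eventually_nhds_0_compose[of ?h])
    show "isCont ?h 0"
      using holo(1)[THEN holo_near_0_isCont] by (intro continuous_intros) auto
    show "?h 0 = 0" using at_0 by (simp add: zero_prod_def)
  qed (use hspm in \<open>auto simp: is_HSPM_iff\<close>)
  then show ?thesis by simp
qed

text \<open>
Put \<open>x = t = 0\<close> in the basic equation; then \<open>ft\<close> and \<open>gt\<close> vanish, and so does \<open>Q'\<close> on the first axis.
\<close>

lemma g_axis: "\<forall>\<^sub>F z in nhds 0. g (z, 0) = 0"
proof -
  have "isCont (\<lambda>z::complex. (z, 0::complex, 0::complex)) 0" "(0::complex, 0::complex, 0::complex) = 0"
    by (auto simp: zero_prod_def intro!: continuous_intros)
  from eventually_nhds_0_compose[OF this basic_equation]
  have "\<forall>\<^sub>F z in nhds 0. g (z, Q (z, 0, 0)) = Q' (f (z, Q (z, 0, 0)), ft (0, 0), gt (0, 0))"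
    by simp
  moreover have "\<forall>\<^sub>F z in nhds 0. Q (z, 0, 0) = 0"
  proof -
    have "\<forall>\<^sub>F (z, \<tau>) in nhds 0. Q (z, 0, \<tau>) = \<tau>"
      using nQ unfolding normal_eq_def by blast
    moreover have "isCont (\<lambda>z::complex. (z, 0::complex)) 0" "(0::complex, 0::complex) = 0"
      by (auto simp: zero_prod_def intro!: continuous_intros)
    ultimately show ?thesis
      using eventually_nhds_0_compose[of "\<lambda>z::complex. (z, 0::complex)" "\<lambda>(z, \<tau>). Q (z, 0, \<tau>) = \<tau>"]
      by simp
  qed
  moreover have "\<forall>\<^sub>F z in nhds 0. Q' (f (z, 0), 0, 0) = 0"
  proof -
    have "\<forall>\<^sub>F (z, \<tau>) in nhds 0. Q' (z, 0, \<tau>) = \<tau>"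
      using nQ' unfolding normal_eq_def by blast
    moreover have "isCont f (0, 0)"
      using holo(3)[THEN holo_near_0_isCont] by (simp add: zero_prod_def)
    then have "isCont (\<lambda>z. f (z, 0)) 0"
      by (intro isCont_o2[of 0 "\<lambda>z. (z, 0)" f] isCont_Pair continuous_ident continuous_const)
    then have "isCont (\<lambda>z. (f (z, 0), 0::complex)) 0" by (intro continuous_intros)
    moreover have "(f (0, 0), 0) = 0" using at_0 by (simp add: zero_prod_def)
    ultimately show ?thesis
      using eventually_nhds_0_compose[of "\<lambda>z. (f (z, 0), 0::complex)" "\<lambda>(z, \<tau>). Q' (z, 0, \<tau>) = \<tau>"]
      by simp
  qed
  ultimately show ?thesis
  proof eventually_elim
    case (elim z)
    then show ?case using at_0 by (simp add: zero_prod_def)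
  qed
qed

lemma gt_axis: "\<forall>\<^sub>F x in nhds 0. gt (x, 0) = 0"
  by (rule segre_germ.g_axis[OF swap])

text \<open>
With all identities valid in one fixed polydisc, limits in \<open>x\<close> can be taken for each \<open>z\<close> in a disc that does not
depend on \<open>x\<close>.
\<close>

definition adapted :: "real \<Rightarrow> bool" where
  "adapted e \<longleftrightarrow> 0 < e \<and>
    (\<forall>z x t. norm z < e \<longrightarrow> norm x < e \<longrightarrow> norm t < e \<longrightarrow>
       holo_at Q (z, x, t) \<and> holo_at Q' (z, x, t) \<and>
       g (z, Q (z, x, t)) = Q' (f (z, Q (z, x, t)), ft (x, t), gt (x, t))) \<and>
    (\<forall>x t. norm x < e \<longrightarrow> norm t < e \<longrightarrow>
       holo_at f (x, t) \<and> holo_at g (x, t) \<and> holo_at ft (x, t) \<and> holo_at gt (x, t) \<and>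
       Q (0, x, t) = t \<and> Q (x, 0, t) = t \<and> Q' (0, x, t) = t \<and> Q' (x, 0, t) = t) \<and>
    (\<forall>z. norm z < e \<longrightarrow> g (z, 0) = 0 \<and> gt (z, 0) = 0)"

lemma adapted_exists: "\<exists>e. adapted e"
proof -
  have "\<forall>\<^sub>F p in nhds 0. (holo_at Q p \<and> holo_at Q' p) \<and>
      g (fst p, Q p) = Q' (f (fst p, Q p), ft (snd p), gt (snd p))"
    using holo basic_equation unfolding holo_near_0_iff_eventually by (intro eventually_conj)
  then obtain e1 where e1: "e1 > 0" "\<And>z x t. norm z < e1 \<Longrightarrow> norm x < e1 \<Longrightarrow> norm t < e1 \<Longrightarrow>
     (holo_at Q (z, x, t) \<and> holo_at Q' (z, x, t)) \<and>
      g (z, Q (z, x, t)) = Q' (f (z, Q (z, x, t)), ft (x, t), gt (x, t))"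
    unfolding eventually_nhds_0_prod3_iff by auto
  have "\<forall>\<^sub>F p in nhds 0. (holo_at f p \<and> holo_at g p \<and> holo_at ft p \<and> holo_at gt p) \<and>
     ((case p of (x, t) \<Rightarrow> Q (0, x, t) = t) \<and> (case p of (x, t) \<Rightarrow> Q (x, 0, t) = t) \<and>
      (case p of (x, t) \<Rightarrow> Q' (0, x, t) = t) \<and> (case p of (x, t) \<Rightarrow> Q' (x, 0, t) = t))"
    using holo nQ nQ' unfolding holo_near_0_iff_eventually normal_eq_def
    by (intro eventually_conj) blast+
  then obtain e2 where e2: "e2 > 0" "\<And>x t. norm x < e2 \<Longrightarrow> norm t < e2 \<Longrightarrow>
     (holo_at f (x, t) \<and> holo_at g (x, t) \<and> holo_at ft (x, t) \<and> holo_at gt (x, t)) \<and>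
     Q (0, x, t) = t \<and> Q (x, 0, t) = t \<and> Q' (0, x, t) = t \<and> Q' (x, 0, t) = t"
    unfolding eventually_nhds_0_prod_iff by auto
  have "\<forall>\<^sub>F z in nhds 0. g (z, 0) = 0 \<and> gt (z, 0) = 0"
    by (intro eventually_conj g_axis gt_axis)
  then obtain e3 where e3: "e3 > 0" "\<And>z. norm z < e3 \<Longrightarrow> g (z, 0) = 0 \<and> gt (z, 0) = 0"
    unfolding eventually_nhds_0_ball by blast
  have "adapted (min e1 (min e2 e3))"
    unfolding adapted_def using e1 e2 e3 by auto
  then show ?thesis ..
qed

lemma adapted_smaller: "adapted e \<Longrightarrow> 0 < d \<Longrightarrow> d \<le> e \<Longrightarrow> adapted d"
  unfolding adapted_def by (meson order_less_le_trans)

lemma adaptedD: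
  assumes "adapted e"
  shows "0 < e"
    "norm z < e \<Longrightarrow> norm x < e \<Longrightarrow> norm t < e \<Longrightarrow> holo_at Q (z, x, t)"
    "norm z < e \<Longrightarrow> norm x < e \<Longrightarrow> norm t < e \<Longrightarrow> holo_at Q' (z, x, t)"
    "norm z < e \<Longrightarrow> norm x < e \<Longrightarrow> norm t < e \<Longrightarrow>
       g (z, Q (z, x, t)) = Q' (f (z, Q (z, x, t)), ft (x, t), gt (x, t))"
    "norm x < e \<Longrightarrow> norm t < e \<Longrightarrow> holo_at f (x, t)"
    "norm x < e \<Longrightarrow> norm t < e \<Longrightarrow> holo_at g (x, t)"
    "norm x < e \<Longrightarrow> norm t < e \<Longrightarrow> holo_at ft (x, t)"
    "norm x < e \<Longrightarrow> norm t < e \<Longrightarrow> holo_at gt (x, t)"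
    "norm x < e \<Longrightarrow> norm t < e \<Longrightarrow> Q (0, x, t) = t"
    "norm x < e \<Longrightarrow> norm t < e \<Longrightarrow> Q (x, 0, t) = t"
    "norm x < e \<Longrightarrow> norm t < e \<Longrightarrow> Q' (0, x, t) = t"
    "norm x < e \<Longrightarrow> norm t < e \<Longrightarrow> Q' (x, 0, t) = t"
    "norm z < e \<Longrightarrow> g (z, 0) = 0"
    "norm z < e \<Longrightarrow> gt (z, 0) = 0"
  using assms unfolding adapted_def by blast+

lemma axis_equation:
  assumes "adapted e" "norm z < e" "norm x < e"
  shows "g (z, Q (z, x, 0)) = Q' (f (z, Q (z, x, 0)), ft (x, 0), 0)"
  using adaptedD(4)[OF assms, of 0] adaptedD(1,14)[OF assms(1)] assms(3) by simp

text \<open>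
The chain rule for the basic equation, differentiated in \<open>t\<close> at \<open>t = 0\<close>. The last term carries the transversal
derivative of \<open>gt\<close>; its coefficient tends to \<open>1\<close> as \<open>x\<close> tends to \<open>0\<close>.
\<close>

lemma differentiated_equation:
  assumes e: "adapted e" and z: "norm z < e" and x: "norm x < e" and w: "norm (Q (z, x, 0)) < e"
    and u: "norm (f (z, Q (z, x, 0))) < e" and v: "norm (ft (x, 0)) < e"
  defines "U \<equiv> dderiv Q (z, x, 0) (0, 0, 1)"
    and "p \<equiv> (f (z, Q (z, x, 0)), ft (x, 0), 0::complex)"
  shows "dderiv g (z, Q (z, x, 0)) (0, 1) * U =
    dderiv Q' p (1, 0, 0) * (dderiv f (z, Q (z, x, 0)) (0, 1) * U) +
    dderiv Q' p (0, 1, 0) * dderiv ft (x, 0) (0, 1) +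
    dderiv Q' p (0, 0, 1) * dderiv gt (x, 0) (0, 1)"
proof -
  note G = adaptedD[OF e]
  have e0: "0 < e" by (rule G)
  have gt0: "gt (x, 0) = 0" using G(14) x .
  have dQ: "((\<lambda>t. Q (z, x, t)) has_field_derivative U) (at 0)"
    using has_field_derivative_holo_at_3[of Q "\<lambda>_. z" 0 "\<lambda>_. x" "\<lambda>t. t" 0 0 1]
      G(2)[OF z x, of 0] e0 by (simp add: U_def)
  have df: "((\<lambda>t. f (z, Q (z, x, t))) has_field_derivative U * dderiv f (z, Q (z, x, 0)) (0, 1)) (at 0)"
    using has_field_derivative_holo_at_2[of f "\<lambda>_. z" 0 "\<lambda>t. Q (z, x, t)" 0 U] dQ G(5)[OF z w] by simp
  have dg: "((\<lambda>t. g (z, Q (z, x, t))) has_field_derivative U * dderiv g (z, Q (z, x, 0)) (0, 1)) (at 0)"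
    using has_field_derivative_holo_at_2[of g "\<lambda>_. z" 0 "\<lambda>t. Q (z, x, t)" 0 U] dQ G(6)[OF z w] by simp
  have dft: "((\<lambda>t. ft (x, t)) has_field_derivative dderiv ft (x, 0) (0, 1)) (at 0)"
    using has_field_derivative_holo_at_2[of ft "\<lambda>_. x" 0 "\<lambda>t. t" 0 1] G(7)[OF x, of 0] e0 by simp
  have dgt: "((\<lambda>t. gt (x, t)) has_field_derivative dderiv gt (x, 0) (0, 1)) (at 0)"
    using has_field_derivative_holo_at_2[of gt "\<lambda>_. x" 0 "\<lambda>t. t" 0 1] G(8)[OF x, of 0] e0 by simp
  have "holo_at Q' (f (z, Q (z, x, 0)), ft (x, 0), gt (x, 0))"
    using G(3)[OF u v, of 0] e0 gt0 by simp
  from has_field_derivative_holo_at_3[of Q' "\<lambda>t. f (z, Q (z, x, t))" 0 "\<lambda>t. ft (x, t)" "\<lambda>t. gt (x, t)",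
      OF this df dft dgt]
  have "((\<lambda>t. Q' (f (z, Q (z, x, t)), ft (x, t), gt (x, t))) has_field_derivative
      U * dderiv f (z, Q (z, x, 0)) (0, 1) * dderiv Q' p (1, 0, 0) +
      dderiv ft (x, 0) (0, 1) * dderiv Q' p (0, 1, 0) +
      dderiv gt (x, 0) (0, 1) * dderiv Q' p (0, 0, 1)) (at 0)"
    by (simp add: p_def gt0)
  then have "((\<lambda>t. g (z, Q (z, x, t))) has_field_derivative
      U * dderiv f (z, Q (z, x, 0)) (0, 1) * dderiv Q' p (1, 0, 0) +
      dderiv ft (x, 0) (0, 1) * dderiv Q' p (0, 1, 0) +
      dderiv gt (x, 0) (0, 1) * dderiv Q' p (0, 0, 1)) (at 0)"
    by (rule has_field_derivative_transform_within_open[of _ _ _ "ball 0 e"])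
      (use G(4)[OF z x] e0 in auto)
  from DERIV_unique[OF dg this] show ?thesis
    by (simp add: algebra_simps)
qed

lemma axis_limits:
  assumes e: "adapted e" and z: "norm z < e"
  shows "((\<lambda>x. Q (z, x, 0)) \<longlongrightarrow> 0) (at 0)"
    and "((\<lambda>x. f (z, Q (z, x, 0))) \<longlongrightarrow> f (z, 0)) (at 0)"
    and "((\<lambda>x. ft (x, 0)) \<longlongrightarrow> 0) (at 0)"
    and "((\<lambda>x. f (x, 0)) \<longlongrightarrow> 0) (at 0)"
proof -
  note G = adaptedD[OF e]
  have "isCont Q (z, 0, 0)"
    using G(1) G(2)[OF z, of 0 0] holo_at_imp_isCont by simp
  moreover have "((\<lambda>x. (z, x, 0)) \<longlongrightarrow> (z, 0, 0)) (at 0)"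
    by (intro tendsto_Pair tendsto_const tendsto_ident_at)
  ultimately have "((\<lambda>x. Q (z, x, 0)) \<longlongrightarrow> Q (z, 0, 0)) (at 0)"
    by (rule isCont_tendsto_compose)
  then show Q: "((\<lambda>x. Q (z, x, 0)) \<longlongrightarrow> 0) (at 0)"
    using G(10)[OF z, of 0] G(1) by simp
  have "isCont f (z, 0)"
    using G(1) G(5)[OF z, of 0] holo_at_imp_isCont by simp
  then show "((\<lambda>x. f (z, Q (z, x, 0))) \<longlongrightarrow> f (z, 0)) (at 0)"
    by (rule isCont_tendsto_compose) (intro tendsto_Pair tendsto_const Q)
  have "isCont ft (0, 0)" "isCont f (0, 0)"
    using G(1) G(5,7)[of 0 0] holo_at_imp_isCont by auto
  moreover have "((\<lambda>x. (x, 0)) \<longlongrightarrow> (0, 0)) (at (0::complex))"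
    by (intro tendsto_Pair tendsto_const tendsto_ident_at)
  ultimately have "((\<lambda>x. ft (x, 0)) \<longlongrightarrow> ft (0, 0)) (at 0)" "((\<lambda>x. f (x, 0)) \<longlongrightarrow> f (0, 0)) (at 0)"
    by (auto intro: isCont_tendsto_compose)
  then show "((\<lambda>x. ft (x, 0)) \<longlongrightarrow> 0) (at 0)" "((\<lambda>x. f (x, 0)) \<longlongrightarrow> 0) (at 0)"
    using at_0 by (simp_all add: zero_prod_def)
qed

lemma y_order_Q: "finite_type_at_0 Q \<Longrightarrow> \<exists>k. y_order (\<lambda>x y. Q (x, y, 0)) k"
  using y_order_exists[OF holo_at_slice] holo(1)
  unfolding holo_near_0_iff_eventually finite_type_at_0_def by (simp add: case_prod_unfold)

lemma y_order_Q': "finite_type_at_0 Q' \<Longrightarrow> \<exists>k. y_order (\<lambda>x y. Q' (x, y, 0)) k"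
  using y_order_exists[OF holo_at_slice] holo(2)
  unfolding holo_near_0_iff_eventually finite_type_at_0_def by (simp add: case_prod_unfold)

end

section \<open>Segre nondegeneracy implies transversality\<close>

context segre_germ
begin

text \<open>
Otherwise \<open>Q'(f(z, q), ft(x, 0), 0)\<close> would vanish, where \<open>q = Q(z, x, 0)\<close>. Dividing by the power of \<open>ft(x, 0)\<close>
that it contains and letting \<open>x\<close> tend to \<open>0\<close>, one finds that the leading coefficient of \<open>Q'(\<cdot>, \<cdot>, 0)\<close> is
zero at \<open>f(z, 0)\<close>. But its zeros are isolated, and \<open>f(z, 0)\<close> takes arbitrarily small nonzero values.
\<close>

lemma g_not_null_on_segre_variety:
  assumes fin': "finite_type_at_0 Q'"
    and f: "\<not> (\<forall>\<^sub>F z in nhds 0. f (z, 0) = 0)" and ft: "\<not> (\<forall>\<^sub>F x in nhds 0. ft (x, 0) = 0)"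
  shows "\<not> (\<forall>\<^sub>F p in nhds 0. g (fst p, Q (fst p, snd p, 0)) = 0)"
proof
  assume "\<forall>\<^sub>F p in nhds 0. g (fst p, Q (fst p, snd p, 0)) = 0"
  then obtain e1 where e1: "0 < e1"
    "\<And>z x. norm z < e1 \<Longrightarrow> norm x < e1 \<Longrightarrow> g (z, Q (z, x, 0)) = 0"
    unfolding eventually_nhds_0_prod_iff by auto
  obtain e2 where e2: "adapted e2" using adapted_exists by blast
  define e where "e = min e1 e2"
  have e: "adapted e" "0 < e" "e \<le> e1"
    using e1 e2 adaptedD(1)[OF e2] adapted_smaller[OF e2, of e] by (auto simp: e_def)
  obtain m where m: "y_order (\<lambda>x y. Q' (x, y, 0)) m"
    using y_order_Q'[OF fin'] by blast
  obtain eB B where B: "0 < eB" "\<And>d. d \<le> eB \<Longrightarrow> sep_holo d B"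
    "\<And>x y. norm x < eB \<Longrightarrow> norm y < eB \<Longrightarrow> Q' (x, y, 0) = y ^ m * B x y"
    "\<And>x. x \<noteq> 0 \<Longrightarrow> norm x < eB \<Longrightarrow> B x 0 \<noteq> 0"
    using y_orderE[OF m] by metis
  have 0: "f (0, 0) = 0" "ft (0, 0) = 0" using at_0 by (simp_all add: zero_prod_def)
  obtain r er R where "0 < r" "zorder (\<lambda>z. f (z, 0)) 0 = int r" and er: "0 < er" and "isCont R 0"
    and R: "\<And>x. norm x < er \<Longrightarrow> f (x, 0) = x ^ r * R x \<and> R x \<noteq> 0"
    by (rule factor_zero_at_0[OF holo_at_axis[OF holo(3)] 0(1) f]) (rule that)
  obtain s es C where "0 < s" "zorder (\<lambda>x. ft (x, 0)) 0 = int s" and es: "0 < es" and "isCont C 0"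
    and C: "\<And>x. norm x < es \<Longrightarrow> ft (x, 0) = x ^ s * C x \<and> C x \<noteq> 0"
    by (rule factor_zero_at_0[OF holo_at_axis[OF holo(5)] 0(2) ft]) (rule that)
  have "\<forall>\<^sub>F z in at 0. norm (f (z, 0)) < eB"
    using eventually_norm_less[OF axis_limits(4)[OF e(1), of 0]] B(1) e(2) by simp
  then have "\<forall>\<^sub>F z in at 0. (norm (f (z, 0)) < eB \<and> f (z, 0) \<noteq> 0) \<and> norm z < e"
    using eventually_at_0_norm_less[OF er] eventually_at_0_norm_less[OF e(2)]
      eventually_neq_at_within[of 0 0]
    by eventually_elim (simp add: R)
  then obtain z where z: "norm (f (z, 0)) < eB" "f (z, 0) \<noteq> 0" "norm z < e"
    using eventually_happens'[OF at_neq_bot[of "0::complex"]] by blast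
  have lims: "((\<lambda>x. f (z, Q (z, x, 0))) \<longlongrightarrow> f (z, 0)) (at 0)" "((\<lambda>x. ft (x, 0)) \<longlongrightarrow> 0) (at 0)"
    using axis_limits[OF e(1) z(3)] by blast+
  have "\<forall>\<^sub>F x in at 0. B (f (z, Q (z, x, 0))) (ft (x, 0)) = 0"
    using eventually_at_0_norm_less[OF e(2)] eventually_at_0_norm_less[OF es]
      eventually_neq_at_within[of 0 0] eventually_norm_less[OF lims(1) z(1)]
      eventually_norm_less[OF lims(2), of eB, simplified, OF B(1)]
  proof eventually_elim
    case (elim x)
    have "Q' (f (z, Q (z, x, 0)), ft (x, 0), 0) = 0"
      using axis_equation[OF e(1) z(3) elim(1)] e1(2)[of z x] z(3) elim(1) e(3) by simp
    moreover have "ft (x, 0) \<noteq> 0" using C[OF elim(2)] elim(3) by simp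
    ultimately show ?case using B(3)[OF elim(4,5)] by simp
  qed
  then have "((\<lambda>x. B (f (z, Q (z, x, 0))) (ft (x, 0))) \<longlongrightarrow> 0) (at 0)"
    by (rule tendsto_eventually)
  moreover have "((\<lambda>x. B (f (z, Q (z, x, 0))) (ft (x, 0))) \<longlongrightarrow> B (f (z, 0)) 0) (at 0)"
    by (rule sep_holo_tendsto[OF B(2)[OF order_refl] lims]) (use z B in auto)
  ultimately have "B (f (z, 0)) 0 = 0"
    using tendsto_unique at_neq_bot by blast
  then show False using B(4) z by simp
qed

text \<open>
If \<open>Q(z, x, 0)\<close> were identically zero, then \<open>g\<close> would vanish at \<open>(z, Q(z, x, 0))\<close> by \<open>g_axis\<close>,
contrary to \<open>g_not_null_on_segre_variety\<close>.
\<close>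

lemma finite_type_source:
  assumes "finite_type_at_0 Q'"
    and "\<not> (\<forall>\<^sub>F z in nhds 0. f (z, 0) = 0)" and "\<not> (\<forall>\<^sub>F x in nhds 0. ft (x, 0) = 0)"
  shows "finite_type_at_0 Q"
  unfolding finite_type_at_0_def
proof
  assume "\<forall>\<^sub>F (z, x) in nhds 0. Q (z, x, 0) = 0"
  moreover have "\<forall>\<^sub>F p in nhds (0::complex \<times> complex). g (fst p, 0) = 0"
    by (rule eventually_nhds_0_compose[OF _ _ g_axis]) (auto intro: isCont_fst)
  ultimately have "\<forall>\<^sub>F p in nhds 0. g (fst p, Q (fst p, snd p, 0)) = 0"
    by eventually_elim auto
  then show False using g_not_null_on_segre_variety[OF assms] by blast
qed

lemma g_not_null:
  assumes "finite_type_at_0 Q'"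
    and "\<not> (\<forall>\<^sub>F z in nhds 0. f (z, 0) = 0)" and "\<not> (\<forall>\<^sub>F x in nhds 0. ft (x, 0) = 0)"
  shows "\<not> (\<forall>\<^sub>F p in nhds 0. g p = 0)"
proof
  assume a: "\<forall>\<^sub>F p in nhds 0. g p = 0"
  have "isCont Q 0" using holo(1) by (rule holo_near_0_isCont)
  then have Q: "isCont (\<lambda>p. Q (fst p, snd p, 0)) (0::complex \<times> complex)"
    by (intro isCont_o2[of 0 "\<lambda>p. (fst p, snd p, 0)" Q] isCont_Pair isCont_fst isCont_snd
      continuous_const continuous_ident) (simp add: zero_prod_def)
  have "\<forall>\<^sub>F p in nhds (0::complex \<times> complex). g (fst p, Q (fst p, snd p, 0)) = 0"
    by (rule eventually_nhds_0_compose[OF _ _ a])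
      (use Q at_0 in \<open>auto simp: zero_prod_def intro!: isCont_Pair isCont_fst\<close>)
  then show False using g_not_null_on_segre_variety[OF assms] by blast
qed

text \<open>
The comparison of leading terms in the basic equation and in its derivative, as described at the
beginning. The relation \<open>k = m * s\<close> between the orders is recorded because it determines the
order of \<open>ft\<close> on the axis from the two hypersurfaces alone.
\<close>

theorem segre_nondegenerate_imp_transversal:
  assumes fin': "finite_type_at_0 Q'"
    and f: "\<not> (\<forall>\<^sub>F z in nhds 0. f (z, 0) = 0)" and ft: "\<not> (\<forall>\<^sub>F x in nhds 0. ft (x, 0) = 0)"
  obtains k m s d where "y_order (\<lambda>x y. Q (x, y, 0)) k" "y_order (\<lambda>x y. Q' (x, y, 0)) m"
    "zorder (\<lambda>x. ft (x, 0)) 0 = int s" "k = m * s" "0 < k"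
    "d \<noteq> 0" "((\<lambda>w. g (0, w)) has_field_derivative d) (at 0)"
    "((\<lambda>t. gt (0, t)) has_field_derivative d) (at 0)"
proof -
  obtain e0 where e0: "adapted e0" using adapted_exists by blast
  obtain m where m: "y_order (\<lambda>x y. Q' (x, y, 0)) m"
    using y_order_Q'[OF fin'] by blast
  obtain eB B where B: "0 < eB" "\<And>d. d \<le> eB \<Longrightarrow> sep_holo d B"
    "\<And>x y. norm x < eB \<Longrightarrow> norm y < eB \<Longrightarrow> Q' (x, y, 0) = y ^ m * B x y"
    "\<And>x. x \<noteq> 0 \<Longrightarrow> norm x < eB \<Longrightarrow> B x 0 \<noteq> 0"
    using y_orderE[OF m] by metis
  obtain k where k: "y_order (\<lambda>x y. Q (x, y, 0)) k"
    using y_order_Q[OF finite_type_source[OF assms]] by blast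
  obtain eA A where A: "0 < eA" "\<And>d. d \<le> eA \<Longrightarrow> sep_holo d A"
    "\<And>x y. norm x < eA \<Longrightarrow> norm y < eA \<Longrightarrow> Q (x, y, 0) = y ^ k * A x y"
    "\<And>x. x \<noteq> 0 \<Longrightarrow> norm x < eA \<Longrightarrow> A x 0 \<noteq> 0"
    using y_orderE[OF k] by metis
  obtain j where j: "y_order (\<lambda>x y. g (x, y)) j"
    using y_order_exists[of g] holo(4) g_not_null[OF assms] unfolding holo_near_0_iff_eventually by blast
  obtain eG G where G: "0 < eG" "\<And>d. d \<le> eG \<Longrightarrow> sep_holo d G"
    "\<And>x y. norm x < eG \<Longrightarrow> norm y < eG \<Longrightarrow> g (x, y) = y ^ j * G x y"
    "\<And>x. x \<noteq> 0 \<Longrightarrow> norm x < eG \<Longrightarrow> G x 0 \<noteq> 0"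
    using y_orderE[OF j] by metis
  have 0: "f (0, 0) = 0" "ft (0, 0) = 0" using at_0 by (simp_all add: zero_prod_def)
  obtain r er R where "0 < r" "zorder (\<lambda>z. f (z, 0)) 0 = int r" and er: "0 < er" and "isCont R 0"
    and R: "\<And>x. norm x < er \<Longrightarrow> f (x, 0) = x ^ r * R x \<and> R x \<noteq> 0"
    by (rule factor_zero_at_0[OF holo_at_axis[OF holo(3)] 0(1) f]) (rule that)
  obtain s es C where C: "0 < s" "zorder (\<lambda>x. ft (x, 0)) 0 = int s" "0 < es" "isCont C 0"
    "\<And>x. norm x < es \<Longrightarrow> ft (x, 0) = x ^ s * C x \<and> C x \<noteq> 0"
    by (rule factor_zero_at_0[OF holo_at_axis[OF holo(5)] 0(2) ft]) (rule that)
  define e where "e = Min {e0, eB, eA, eG, er, es}"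
  have "0 < e" using adaptedD(1)[OF e0] B(1) A(1) G(1) er C(3) by (simp add: e_def)
  have le: "e \<le> e0" "e \<le> eB" "e \<le> eA" "e \<le> eG" "e \<le> er" "e \<le> es"
    unfolding e_def by (rule Min_le, simp, simp)+
  have e: "adapted e" using adapted_smaller[OF e0 \<open>0 < e\<close> le(1)] .
  note sB = B(2)[OF le(2)] and sA = A(2)[OF le(3)] and sG = G(2)[OF le(4)]
  have eqB: "Q' (x, y, 0) = y ^ m * B x y" if "norm x < e" "norm y < e" for x y
    using that B(3) le by simp
  have eqA: "Q (x, y, 0) = y ^ k * A x y" if "norm x < e" "norm y < e" for x y
    using that A(3) le by simp
  have eqG: "g (x, y) = y ^ j * G x y" if "norm x < e" "norm y < e" for x y
    using that G(3) le by simp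
  have nzB: "B x 0 \<noteq> 0" and nzA: "A x 0 \<noteq> 0" and nzG: "G x 0 \<noteq> 0" if "x \<noteq> 0" "norm x < e" for x
    using that B(4) A(4) G(4) le by simp_all
  have nzf: "f (x, 0) \<noteq> 0" if "x \<noteq> 0" "norm x < e" for x
    using that R[of x] le by simp
  have eqft: "ft (x, 0) = x ^ s * C x" if "norm x < e" for x
    using that C(5)[of x] le by simp
  define c where "c = C 0"
  have c: "c \<noteq> 0" "(C \<longlongrightarrow> c) (at 0)"
    using C(3,4) C(5)[of 0] by (auto simp: c_def isCont_def)
  \<comment> \<open>The leading coefficients of \<open>Q\<close> and \<open>Q'\<close> vanish at the origin since \<open>Q(0, x, 0) = 0 = Q'(0, x, 0)\<close>.\<close>
  have A00: "A 0 0 = 0"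
  proof -
    have "\<forall>\<^sub>F x in at 0. A 0 x = 0"
      using eventually_at_0_norm_less[OF \<open>0 < e\<close>] eventually_neq_at_within[of 0 0]
    proof eventually_elim
      case (elim x)
      then show ?case using eqA[of 0 x] adaptedD(9)[OF e, of x 0] \<open>0 < e\<close> by simp
    qed
    then have "((\<lambda>x. A 0 x) \<longlongrightarrow> 0) (at 0)" by (rule tendsto_eventually)
    then show ?thesis
      using sep_holo_at_0[OF sA, of 0] \<open>0 < e\<close> tendsto_unique at_neq_bot norm_zero by metis
  qed
  have B00: "B 0 0 = 0"
  proof -
    have "\<forall>\<^sub>F x in at 0. B 0 x = 0"
      using eventually_at_0_norm_less[OF \<open>0 < e\<close>] eventually_neq_at_within[of 0 0]
    proof eventually_elim
      case (elim x)
      then show ?case using eqB[of 0 x] adaptedD(11)[OF e, of x 0] \<open>0 < e\<close> by simp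
    qed
    then have "((\<lambda>x. B 0 x) \<longlongrightarrow> 0) (at 0)" by (rule tendsto_eventually)
    then show ?thesis
      using sep_holo_at_0[OF sB, of 0] \<open>0 < e\<close> tendsto_unique at_neq_bot norm_zero by metis
  qed
  define z0 where "z0 = complex_of_real (e / 2)"
  have z0: "z0 \<noteq> 0" "norm z0 < e" using \<open>0 < e\<close> by (auto simp: z0_def)
  have "k \<noteq> 0"
    using eqA[OF z0(2), of 0] adaptedD(10)[OF e z0(2), of 0] nzA[OF z0] \<open>0 < e\<close> by auto
  have "j \<noteq> 0"
    using eqG[OF z0(2), of 0] adaptedD(13)[OF e z0(2)] nzG[OF z0] \<open>0 < e\<close> by auto
  \<comment> \<open>A punctured disc of values \<open>z\<close> where no leading coefficient vanishes. The quarter of the radius is the polydisc where the partial derivatives are bounded.\<close>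
  have "\<forall>\<^sub>F z in at 0. norm (f (z, 0)) < e / 4"
    by (rule eventually_norm_less[OF axis_limits(4)[OF e, of 0]]) (use \<open>0 < e\<close> in simp_all)
  then obtain e' where e': "0 < e'" "\<And>z. z \<noteq> 0 \<Longrightarrow> norm z < e' \<Longrightarrow> norm (f (z, 0)) < e / 4"
    unfolding eventually_at by auto
  define \<rho> where "\<rho> = min e' (e / 4)"
  have \<rho>: "0 < \<rho>" "\<rho> < e" "\<rho> \<le> e / 4" using e' \<open>0 < e\<close> by (auto simp: \<rho>_def)
  have fz: "norm (f (z, 0)) < e / 4" "f (z, 0) \<noteq> 0" if "z \<noteq> 0" "norm z < \<rho>" for z
    using that e'(2)[of z] nzf[of z] \<rho> by (auto simp: \<rho>_def)
  define a where "a = (\<lambda>z. A z 0)"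
  define G0 where "G0 = (\<lambda>z. G z 0)"
  define \<beta> where "\<beta> = (\<lambda>z. B (f (z, 0)) 0)"
  have a_lim: "(a \<longlongrightarrow> 0) (at 0)"
    unfolding a_def using sep_holo_tendsto_axis[OF sA \<open>0 < e\<close> tendsto_ident_at] A00 \<open>0 < e\<close> by simp
  have G0_lim: "(G0 \<longlongrightarrow> G 0 0) (at 0)"
    unfolding G0_def using sep_holo_tendsto_axis[OF sG \<open>0 < e\<close> tendsto_ident_at] \<open>0 < e\<close> by simp
  have \<beta>_lim: "(\<beta> \<longlongrightarrow> 0) (at 0)"
    unfolding \<beta>_def
    using sep_holo_tendsto_axis[OF sB \<open>0 < e\<close> axis_limits(4)[OF e, of 0]] B00 \<open>0 < e\<close> by simp
  have nz: "a z \<noteq> 0" "G0 z \<noteq> 0" "\<beta> z \<noteq> 0" if "z \<noteq> 0" "norm z < \<rho>" for z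
    using that nzA[of z] nzG[of z] nzB[of "f (z, 0)"] fz[OF that] \<rho> \<open>0 < e\<close>
    by (auto simp: a_def G0_def \<beta>_def)
  have punct: "\<forall>\<^sub>F z::complex in at 0. z \<noteq> 0 \<and> norm z < \<rho>"
    using eventually_at_0_norm_less[OF \<rho>(1)] eventually_neq_at_within[of 0 0]
    by eventually_elim simp
  define q where "q = (\<lambda>z x. Q (z, x, 0))"
  define F where "F = (\<lambda>z x. f (z, q z x))"
  define y where "y = (\<lambda>x. ft (x, 0))"
  have lims: "(q z \<longlongrightarrow> 0) (at 0)" "(F z \<longlongrightarrow> f (z, 0)) (at 0)" "(y \<longlongrightarrow> 0) (at 0)" if "norm z < \<rho>" for z
    using axis_limits[OF e, of z] that \<rho> unfolding q_def F_def y_def by simp_all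
  have Alim: "(A z \<longlongrightarrow> a z) (at 0)" if "norm z < \<rho>" for z
    unfolding a_def using sep_holo_at_0[OF sA, of z] that \<rho> \<open>0 < e\<close> by simp
  have Glim: "((\<lambda>x. G z (q z x)) \<longlongrightarrow> G0 z) (at 0)" if "norm z < \<rho>" for z
    unfolding G0_def
    by (rule sep_holo_tendsto[OF sG tendsto_const lims(1)[OF that]]) (use that \<rho> \<open>0 < e\<close> in auto)
  have Blim: "((\<lambda>x. B (F z x) (y x)) \<longlongrightarrow> \<beta> z) (at 0)" if "z \<noteq> 0" "norm z < \<rho>" for z
    unfolding \<beta>_def
    by (rule sep_holo_tendsto[OF sB lims(2)[OF that(2)] lims(3)[OF that(2)]])
       (use that fz[OF that] \<rho> \<open>0 < e\<close> in auto)
  have small: "\<forall>\<^sub>F x in at 0. ((x \<noteq> 0 \<and> norm x < e / 4) \<and> norm (q z x) < e / 4) \<and>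
      norm (F z x) < e / 4 \<and> norm (y x) < e / 4" if "z \<noteq> 0" "norm z < \<rho>" for z
  proof -
    have "0 < e / 4" using \<open>0 < e\<close> by simp
    then show ?thesis
      using eventually_neq_at_within[of 0 0] eventually_at_0_norm_less[of "e/4"]
        eventually_norm_less[OF lims(1)[OF that(2)], of "e/4"] eventually_norm_less[OF lims(2)[OF that(2)] fz(1)[OF that]]
        eventually_norm_less[OF lims(3)[OF that(2)], of "e/4"]
      by (intro eventually_conj) simp_all
  qed
  \<comment> \<open>The identity at \<open>t = 0\<close> in the form \<open>x\<^sup>k\<^sup>j L(x) = x\<^sup>m\<^sup>s R(x)\<close>, where \<open>L\<close> and \<open>R\<close> have nonzero limits.\<close>
  have lead: "k * j = m * s" "a z ^ j * G0 z = c ^ m * \<beta> z" if z: "z \<noteq> 0" "norm z < \<rho>" for z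
  proof -
    have "\<forall>\<^sub>F x in at 0. x ^ (k * j) * (A z x ^ j * G z (q z x)) = x ^ (m * s) * (C x ^ m * B (F z x) (y x))"
      using small[OF z]
    proof eventually_elim
      case (elim x)
      then have x: "norm x < e" "norm (q z x) < e" "norm (F z x) < e" "norm (y x) < e" "norm z < e"
        using z \<rho> \<open>0 < e\<close> by auto
      have "g (z, q z x) = Q' (F z x, y x, 0)"
        using axis_equation[OF e x(5,1)] by (simp add: q_def F_def y_def)
      then have "q z x ^ j * G z (q z x) = y x ^ m * B (F z x) (y x)"
        using eqG[OF x(5,2)] eqB[OF x(3,4)] by simp
      moreover have "q z x ^ j = x ^ (k * j) * A z x ^ j"
        using eqA[OF x(5,1)] by (simp add: q_def power_mult_distrib power_mult)
      moreover have "y x ^ m = x ^ (m * s) * C x ^ m"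
        using eqft[OF x(1)] by (simp add: y_def power_mult_distrib mult.commute flip: power_mult)
      ultimately show ?case by (simp add: mult.assoc)
    qed
    moreover have "((\<lambda>x. A z x ^ j * G z (q z x)) \<longlongrightarrow> a z ^ j * G0 z) (at 0)"
      by (intro tendsto_intros Alim Glim z)
    moreover have "((\<lambda>x. C x ^ m * B (F z x) (y x)) \<longlongrightarrow> c ^ m * \<beta> z) (at 0)"
      by (intro tendsto_intros Blim z c)
    moreover have "a z ^ j * G0 z \<noteq> 0" "c ^ m * \<beta> z \<noteq> 0"
      using nz[OF z] c(1) by simp_all
    ultimately show "k * j = m * s" "a z ^ j * G0 z = c ^ m * \<beta> z"
      by (rule power_mult_limits_eq)+
  qed
  have kj: "k * j = m * s" using lead(1)[of "of_real (\<rho> / 2)"] \<rho>(1) by simp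
  \<comment> \<open>The order that remains on the left after one derivative in \<open>w\<close>: \<open>w\<^sup>j\<^sup>-\<^sup>1\<close> becomes \<open>x\<^sup>N\<close> when \<open>w = Q(z, x, 0)\<close>.\<close>
  define N where "N = k * (j - 1)"
  have Nk: "k * j = N + k" using \<open>j \<noteq> 0\<close> by (cases j) (auto simp: N_def)
  define D where "D = (\<lambda>x. of_nat m * y x ^ (m - 1) * dderiv ft (x, 0) (0, 1) / x ^ N)"
  define E where "E = (\<lambda>x. dderiv gt (x, 0) (0, 1) / x ^ N)"
  define U where "U = (\<lambda>z x. dderiv Q (z, x, 0) (0, 0, 1))"
  define V where "V = (\<lambda>z x. dderiv Q' (F z x, y x, 0) (0, 0, 1))"
  obtain KG where KG: "\<And>x y. norm x < e/4 \<Longrightarrow> norm y < e/4 \<Longrightarrow>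
      norm (deriv (\<lambda>x. G x y) x) \<le> KG \<and> norm (deriv (G x) y) \<le> KG"
    using sep_holo_bounded_partials[OF sG \<open>0 < e\<close>] by blast
  obtain KB where KB: "\<And>x y. norm x < e/4 \<Longrightarrow> norm y < e/4 \<Longrightarrow>
      norm (deriv (\<lambda>x. B x y) x) \<le> KB \<and> norm (deriv (B x) y) \<le> KB"
    using sep_holo_bounded_partials[OF sB \<open>0 < e\<close>] by blast
  have near: "\<forall>\<^sub>F p in nhds (x, y). holo_at F p"
    if "\<And>x y. norm x < e \<Longrightarrow> norm y < e \<Longrightarrow> holo_at F (x, y)" "norm x < e" "norm y < e"
    for F :: "complex \<times> complex \<Rightarrow> complex" and x y
    unfolding eventually_nhds
    by (rule exI[of _ "ball 0 e \<times> ball 0 e"]) (use that in \<open>auto intro: open_Times\<close>)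
  have near3: "\<forall>\<^sub>F p in nhds (x, y, t). holo_at F p"
    if "\<And>x y t. norm x < e \<Longrightarrow> norm y < e \<Longrightarrow> norm t < e \<Longrightarrow> holo_at F (x, y, t)"
      "norm x < e" "norm y < e" "norm t < e"
    for F :: "complex \<times> complex \<times> complex \<Rightarrow> complex" and x y t
    unfolding eventually_nhds
    by (rule exI[of _ "ball 0 e \<times> ball 0 e \<times> ball 0 e"]) (use that in \<open>auto intro: open_Times\<close>)
  have dft_lim: "((\<lambda>x. dderiv ft (x, 0) (0, 1)) \<longlongrightarrow> dderiv ft (0, 0) (0, 1)) (at 0)"
    by (rule isCont_tendsto_compose[OF isCont_dderiv[OF near[OF adaptedD(7)[OF e]]]])
       (use \<open>0 < e\<close> in \<open>auto intro!: tendsto_Pair tendsto_ident_at\<close>)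
  have dgt_lim: "((\<lambda>x. dderiv gt (x, 0) (0, 1)) \<longlongrightarrow> dderiv gt (0, 0) (0, 1)) (at 0)"
    by (rule isCont_tendsto_compose[OF isCont_dderiv[OF near[OF adaptedD(8)[OF e]]]])
       (use \<open>0 < e\<close> in \<open>auto intro!: tendsto_Pair tendsto_ident_at\<close>)
  have df_lim: "((\<lambda>x. dderiv f (z, q z x) (0, 1)) \<longlongrightarrow> dderiv f (z, 0) (0, 1)) (at 0)" if "norm z < \<rho>" for z
    by (rule isCont_tendsto_compose[OF isCont_dderiv[OF near[OF adaptedD(5)[OF e]]]])
       (use \<open>0 < e\<close> that \<rho> lims(1)[OF that] in \<open>auto intro!: tendsto_Pair\<close>)
  have one: "dderiv P (z, 0, 0) (0, 0, 1) = 1"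
    if "holo_at P (z, 0, 0)" "\<And>t. norm t < e \<Longrightarrow> P (z, 0, t) = t"
    for P :: "complex \<times> complex \<times> complex \<Rightarrow> complex" and z
  proof -
    have "((\<lambda>t. P (z, 0, t)) has_field_derivative dderiv P (z, 0, 0) (0, 0, 1)) (at 0)"
      using has_field_derivative_holo_at_3[of P "\<lambda>_. z" 0 "\<lambda>_. 0" "\<lambda>t. t" 0 0 1] that by simp
    moreover have "((\<lambda>t. P (z, 0, t)) has_field_derivative 1) (at 0)"
      by (rule has_field_derivative_transform_within_open[OF DERIV_ident, of "ball 0 e"])
         (use that \<open>0 < e\<close> in auto)
    ultimately show ?thesis by (rule DERIV_unique)
  qed
  have U_lim: "(U z \<longlongrightarrow> 1) (at 0)" if "norm z < \<rho>" for z
  proof -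
    have z: "norm z < e" using that \<rho> by simp
    have "(U z \<longlongrightarrow> dderiv Q (z, 0, 0) (0, 0, 1)) (at 0)"
      unfolding U_def
      by (rule isCont_tendsto_compose[OF isCont_dderiv[OF near3[OF adaptedD(2)[OF e]]]])
         (use \<open>0 < e\<close> z in \<open>auto intro!: tendsto_Pair tendsto_ident_at\<close>)
    then show ?thesis
      using one[of Q z] adaptedD(2,10)[OF e z] \<open>0 < e\<close> by simp
  qed
  have V_lim: "(V z \<longlongrightarrow> 1) (at 0)" if z: "z \<noteq> 0" "norm z < \<rho>" for z
  proof -
    have fze: "norm (f (z, 0)) < e" using fz[OF z] \<open>0 < e\<close> by simp
    have "(V z \<longlongrightarrow> dderiv Q' (f (z, 0), 0, 0) (0, 0, 1)) (at 0)"
      unfolding V_def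
      by (rule isCont_tendsto_compose[OF isCont_dderiv[OF near3[OF adaptedD(3)[OF e]]]])
         (use \<open>0 < e\<close> fze lims[OF z(2)] in \<open>auto intro!: tendsto_Pair\<close>)
    then show ?thesis
      using one[of Q' "f (z, 0)"] adaptedD(3,12)[OF e fze] \<open>0 < e\<close> by simp
  qed
  have key: "((\<lambda>x. D x * B (F z x) (y x) + E x * V z x) \<longlongrightarrow> of_nat j * a z ^ (j - 1) * G0 z) (at 0)"
    if z: "z \<noteq> 0" "norm z < \<rho>" for z
  proof -
    \<comment> \<open>The differentiated equation divided by \<open>x\<^sup>N\<close>: the terms that keep a factor \<open>x\<^sup>k\<close> tend to \<open>0\<close>, since their other factors are bounded.\<close>
    define T where "T = (\<lambda>x. (of_nat j * A z x ^ (j - 1) * G z (q z x) + x ^ k * A z x ^ j * deriv (G z) (q z x)) * U z x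
        - x ^ k * C x ^ m * deriv (\<lambda>u. B u (y x)) (F z x) * dderiv f (z, q z x) (0, 1) * U z x
        - x ^ k * C x ^ m * deriv (B (F z x)) (y x) * dderiv ft (x, 0) (0, 1))"
    have TDE: "\<forall>\<^sub>F x in at 0. T x = D x * B (F z x) (y x) + E x * V z x"
      using small[OF z]
    proof eventually_elim
      case (elim x)
      then have x: "norm x < e" "norm (q z x) < e" "norm (F z x) < e" "norm (y x) < e" "norm z < e" "x \<noteq> 0"
        using z \<rho> \<open>0 < e\<close> by auto
      let ?p = "(F z x, y x, 0::complex)"
      have diff: "dderiv g (z, q z x) (0, 1) * U z x =
          dderiv Q' ?p (1, 0, 0) * (dderiv f (z, q z x) (0, 1) * U z x) +
          dderiv Q' ?p (0, 1, 0) * dderiv ft (x, 0) (0, 1) + V z x * dderiv gt (x, 0) (0, 1)"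
        using differentiated_equation[OF e x(5,1)] x by (simp add: q_def F_def y_def U_def V_def)
      have hQ': "holo_at Q' ?p" using adaptedD(3)[OF e x(3,4), of 0] \<open>0 < e\<close> by simp
      have "((\<lambda>w. g (z, w)) has_field_derivative dderiv g (z, q z x) (0, 1)) (at (q z x))"
        using has_field_derivative_holo_at_2[of g "\<lambda>_. z" "q z x" "\<lambda>t. t" 0 1] adaptedD(6)[OF e x(5,2)] by simp
      then have g': "dderiv g (z, q z x) (0, 1) =
          of_nat j * q z x ^ (j - 1) * G z (q z x) + q z x ^ j * deriv (G z) (q z x)"
        using partial_derivatives_of_factorization(2)[OF sG eqG x(5,2)] DERIV_unique by blast
      have "((\<lambda>u. Q' (u, y x, 0)) has_field_derivative dderiv Q' ?p (1, 0, 0)) (at (F z x))"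
        using has_field_derivative_holo_at_3[of Q' "\<lambda>t. t" "F z x" "\<lambda>_. y x" "\<lambda>_. 0" 1 0 0] hQ' by simp
      then have Q1: "dderiv Q' ?p (1, 0, 0) = y x ^ m * deriv (\<lambda>u. B u (y x)) (F z x)"
        using partial_derivatives_of_factorization(1)[of e B "\<lambda>x y. Q' (x, y, 0)", OF sB eqB x(3,4)]
          DERIV_unique by blast
      have "((\<lambda>v. Q' (F z x, v, 0)) has_field_derivative dderiv Q' ?p (0, 1, 0)) (at (y x))"
        using has_field_derivative_holo_at_3[of Q' "\<lambda>_. F z x" "y x" "\<lambda>t. t" "\<lambda>_. 0" 0 1 0] hQ' by simp
      then have Q2: "dderiv Q' ?p (0, 1, 0) =
          of_nat m * y x ^ (m - 1) * B (F z x) (y x) + y x ^ m * deriv (B (F z x)) (y x)"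
        using partial_derivatives_of_factorization(2)[of e B "\<lambda>x y. Q' (x, y, 0)", OF sB eqB x(3,4)]
          DERIV_unique by blast
      have qx: "q z x = x ^ k * A z x" using eqA[OF x(5,1)] by (simp add: q_def)
      have q1: "q z x ^ (j - 1) = x ^ N * A z x ^ (j - 1)"
        by (simp add: qx N_def power_mult_distrib power_mult)
      have q2: "q z x ^ j = x ^ N * (x ^ k * A z x ^ j)"
        by (simp add: qx power_mult_distrib Nk flip: power_mult power_add mult.assoc)
      have "y x ^ m = x ^ (s * m) * C x ^ m"
        using eqft[OF x(1)] by (simp add: y_def power_mult_distrib power_mult)
      then have ym: "y x ^ m = x ^ N * (x ^ k * C x ^ m)"
        using kj Nk by (simp add: power_add mult.commute mult.left_commute)
      have "x ^ N * T x = of_nat m * y x ^ (m - 1) * dderiv ft (x, 0) (0, 1) * B (F z x) (y x)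
          + dderiv gt (x, 0) (0, 1) * V z x"
        using diff unfolding g' Q1 Q2 q1 q2 ym T_def by (simp add: algebra_simps)
      then show ?case
        using \<open>x \<noteq> 0\<close> by (simp add: D_def E_def field_simps)
    qed
    have xk: "((\<lambda>x::complex. x ^ k) \<longlongrightarrow> 0) (at 0)"
      using tendsto_power[OF tendsto_ident_at[of 0 UNIV], of k] \<open>k \<noteq> 0\<close> power_0_left[of k] by metis
    have bG: "\<forall>\<^sub>F x in at 0. norm (deriv (G z) (q z x)) \<le> KG"
      using small[OF z]
    proof eventually_elim
      case (elim x)
      then show ?case using KG[of z "q z x"] z \<rho> by simp
    qed
    have bB: "\<forall>\<^sub>F x in at 0. norm (deriv (\<lambda>u. B u (y x)) (F z x)) \<le> KB"
      "\<forall>\<^sub>F x in at 0. norm (deriv (B (F z x)) (y x)) \<le> KB"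
      using small[OF z] by (eventually_elim, use KB in blast)+
    have 1: "((\<lambda>x. x ^ k * A z x ^ j * deriv (G z) (q z x)) \<longlongrightarrow> 0) (at 0)"
      by (rule lim_null_mult_right_bounded[OF _ bG])
         (use tendsto_mult[OF xk tendsto_power[OF Alim[OF z(2)]]] in simp)
    have xC: "((\<lambda>x. x ^ k * C x ^ m) \<longlongrightarrow> 0) (at 0)"
      using tendsto_mult[OF xk tendsto_power[OF c(2)]] by simp
    have 2: "((\<lambda>x. x ^ k * C x ^ m * deriv (\<lambda>u. B u (y x)) (F z x)) \<longlongrightarrow> 0) (at 0)"
      by (rule lim_null_mult_right_bounded[OF xC bB(1)])
    have 3: "((\<lambda>x. x ^ k * C x ^ m * deriv (B (F z x)) (y x)) \<longlongrightarrow> 0) (at 0)"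
      by (rule lim_null_mult_right_bounded[OF xC bB(2)])
    have "(T \<longlongrightarrow> (of_nat j * a z ^ (j - 1) * G0 z + 0) * 1 - 0 * dderiv f (z, 0) (0, 1) * 1
        - 0 * dderiv ft (0, 0) (0, 1)) (at 0)"
      unfolding T_def
      by (intro tendsto_diff tendsto_mult tendsto_add tendsto_const tendsto_power 1 2 3
          Alim Glim U_lim df_lim dft_lim z)
    then show ?thesis
      using Lim_transform_eventually[OF _ TDE] by simp
  qed
  \<comment> \<open>Since \<open>\<beta>\<close> is nonzero at \<open>z1\<close> and tends to \<open>0\<close>, it takes a different value at some \<open>z2\<close>.\<close>
  obtain z1 :: complex where z1: "z1 \<noteq> 0" "norm z1 < \<rho>"
    by (rule that[of "of_real (\<rho> / 2)"]) (use \<rho>(1) in simp_all)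
  have "\<forall>\<^sub>F z in at 0. norm (\<beta> z) < norm (\<beta> z1)"
    using eventually_norm_less[OF \<beta>_lim, of "norm (\<beta> z1)"] nz(3)[OF z1] by simp
  with punct have "\<exists>z. (z \<noteq> 0 \<and> norm z < \<rho>) \<and> norm (\<beta> z) < norm (\<beta> z1)"
    by (rule eventually_happens'[OF at_neq_bot[of "0::complex"] eventually_conj])
  then obtain z2 where z2: "z2 \<noteq> 0" "norm z2 < \<rho>" "norm (\<beta> z2) < norm (\<beta> z1)"
    by blast
  then have ne: "\<beta> z1 \<noteq> \<beta> z2" by auto
  obtain d \<epsilon> where d: "(D \<longlongrightarrow> d) (at 0)" and \<epsilon>: "(E \<longlongrightarrow> \<epsilon>) (at 0)"
    by (rule limits_of_coefficients[OF key[OF z1] Blim[OF z1] V_lim[OF z1]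
        key[OF z2(1,2)] Blim[OF z2(1,2)] V_lim[OF z2(1,2)] ne])
  have rel: "of_nat j * a z ^ (j - 1) * G0 z = d * \<beta> z + \<epsilon>" if z: "z \<noteq> 0" "norm z < \<rho>" for z
  proof -
    have "((\<lambda>x. D x * B (F z x) (y x) + E x * V z x) \<longlongrightarrow> d * \<beta> z + \<epsilon> * 1) (at 0)"
      by (intro tendsto_intros d \<epsilon> Blim V_lim z)
    then show ?thesis using tendsto_unique[OF at_neq_bot key[OF z]] by simp
  qed
  \<comment> \<open>For \<open>\<epsilon> = 0\<close> the two relations between the coefficients combine to \<open>j c\<^sup>m = d a(z)\<close>, but \<open>a\<close> tends to \<open>0\<close>.\<close>
  have "\<epsilon> \<noteq> 0"
  proof
    assume "\<epsilon> = 0"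
    have "of_nat j * c ^ m = d * a z" if z: "z \<noteq> 0" "norm z < \<rho>" for z
    proof -
      have aj: "a z ^ j = a z ^ (j - 1) * a z"
        using \<open>j \<noteq> 0\<close> by (cases j) auto
      have "a z ^ (j - 1) * G0 z * (of_nat j * c ^ m) = of_nat j * a z ^ (j - 1) * G0 z * c ^ m"
        by simp
      also have "\<dots> = d * (c ^ m * \<beta> z)" using rel[OF z] \<open>\<epsilon> = 0\<close> by simp
      also have "\<dots> = a z ^ (j - 1) * G0 z * (d * a z)" unfolding lead(2)[OF z, symmetric] aj by simp
      finally show ?thesis using nz[OF z] by simp
    qed
    then have "\<forall>\<^sub>F z in at 0. d * a z = of_nat j * c ^ m"
      using punct by (auto elim: eventually_mono)
    then have "((\<lambda>z. d * a z) \<longlongrightarrow> of_nat j * c ^ m) (at 0)" by (rule tendsto_eventually)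
    moreover have "((\<lambda>z. d * a z) \<longlongrightarrow> d * 0) (at 0)" by (intro tendsto_intros a_lim)
    ultimately have "of_nat j * c ^ m = d * 0" using tendsto_unique at_neq_bot by blast
    then show False using c(1) \<open>j \<noteq> 0\<close> by simp
  qed
  have rel_lim: "\<epsilon> = of_nat j * 0 ^ (j - 1) * G 0 0"
  proof -
    have "\<forall>\<^sub>F z in at 0. of_nat j * a z ^ (j - 1) * G0 z - d * \<beta> z = \<epsilon>"
      using punct by eventually_elim (use rel in \<open>simp add: algebra_simps\<close>)
    then have "((\<lambda>z. of_nat j * a z ^ (j - 1) * G0 z - d * \<beta> z) \<longlongrightarrow> \<epsilon>) (at 0)"
      by (rule tendsto_eventually)
    moreover have "((\<lambda>z. of_nat j * a z ^ (j - 1) * G0 z - d * \<beta> z) \<longlongrightarrow>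
        of_nat j * 0 ^ (j - 1) * G 0 0 - d * 0) (at 0)"
      by (intro tendsto_intros a_lim G0_lim \<beta>_lim)
    ultimately show ?thesis using tendsto_unique at_neq_bot by fastforce
  qed
  have "j = 1"
  proof (rule ccontr)
    assume "j \<noteq> 1"
    then have "\<epsilon> = 0" using rel_lim \<open>j \<noteq> 0\<close> by simp
    then show False using \<open>\<epsilon> \<noteq> 0\<close> by blast
  qed
  have "G 0 0 = \<epsilon>" using rel_lim \<open>j = 1\<close> by simp
  have "E = (\<lambda>x. dderiv gt (x, 0) (0, 1))" using \<open>j = 1\<close> by (simp add: E_def N_def)
  then have \<epsilon>_eq: "dderiv gt (0, 0) (0, 1) = \<epsilon>"
    using dgt_lim \<epsilon> tendsto_unique at_neq_bot by blast
  have "((\<lambda>t. gt (0, t)) has_field_derivative \<epsilon>) (at 0)"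
    using has_field_derivative_holo_at_2[of gt "\<lambda>_. 0" 0 "\<lambda>t. t" 0 1] adaptedD(8)[OF e, of 0 0] \<open>0 < e\<close>
    by (simp add: \<epsilon>_eq)
  moreover have "((\<lambda>w. g (0, w)) has_field_derivative \<epsilon>) (at 0)"
  proof (rule has_field_derivative_0_mult)
    show "\<forall>\<^sub>F w in nhds 0. g (0, w) = w * G 0 w"
      unfolding eventually_nhds_0_ball
      using eqG[of 0] \<open>j = 1\<close> \<open>0 < e\<close> by (intro exI[of _ e]) simp
    show "(G 0 \<longlongrightarrow> \<epsilon>) (at 0)"
      using sep_holo_at_0[OF sG, of 0] \<open>0 < e\<close> \<open>G 0 0 = \<epsilon>\<close> by simp
  qed
  moreover have "k = m * s" using kj \<open>j = 1\<close> by simp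
  ultimately show thesis
    using that[OF k m C(2)] \<open>k \<noteq> 0\<close> \<open>\<epsilon> \<noteq> 0\<close> by blast
qed

end

section \<open>Maps that are not transversally null\<close>

lemma finite_type_conj_fun:
  assumes "finite_type_at_0 Q"
  shows "finite_type_at_0 (conj_fun Q)"
  unfolding finite_type_at_0_def
proof
  assume "\<forall>\<^sub>F (z, x) in nhds 0. conj_fun Q (z, x, 0) = 0"
  then obtain e where e: "0 < e" "\<And>z x. norm z < e \<Longrightarrow> norm x < e \<Longrightarrow> conj_fun Q (z, x, 0) = 0"
    unfolding eventually_nhds_0_prod_iff by auto
  have "Q (z, x, 0) = 0" if "norm z < e" "norm x < e" for z x
    using that e(2)[of "cnj z" "cnj x"] by (simp add: conj_fun_apply)
  then have "\<forall>\<^sub>F (z, x) in nhds 0. Q (z, x, 0) = 0"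
    unfolding eventually_nhds_0_prod_iff using e(1) by (intro exI[of _ e]) simp
  then show False using assms unfolding finite_type_at_0_def by blast
qed

lemma sep_holo_cnj:
  assumes "sep_holo e A"
  shows "sep_holo e (\<lambda>x y. cnj (A (cnj x) (cnj y)))"
  unfolding sep_holo_def
proof (intro conjI ballI)
  have c: "continuous_on (ball 0 e \<times> ball 0 e) (\<lambda>(x, y). A x y)"
    using assms unfolding sep_holo_def by blast
  have "continuous_on (ball 0 e \<times> ball 0 e) (\<lambda>p::complex \<times> complex. (cnj (fst p), cnj (snd p)))"
    by (intro continuous_on_Pair continuous_on_cnj continuous_on_fst continuous_on_snd continuous_on_id)
  moreover have "(\<lambda>p. (cnj (fst p), cnj (snd p))) ` (ball 0 e \<times> ball 0 e) \<subseteq> ball 0 e \<times> ball 0 e"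
    by auto
  ultimately have "continuous_on (ball 0 e \<times> ball 0 e) (\<lambda>p. (\<lambda>(x, y). A x y) (cnj (fst p), cnj (snd p)))"
    by (rule continuous_on_compose2[OF c])
  then have "continuous_on (ball 0 e \<times> ball 0 e) (\<lambda>p. cnj ((\<lambda>(x, y). A x y) (cnj (fst p), cnj (snd p))))"
    by (rule continuous_on_cnj)
  then show "continuous_on (ball 0 e \<times> ball 0 e) (\<lambda>(x, y). cnj (A (cnj x) (cnj y)))"
    by (simp only: case_prod_unfold fst_conv snd_conv)
next
  have cnj_ball: "cnj ` ball 0 e = ball 0 e"
  proof (intro equalityI subsetI)
    fix x :: complex assume "x \<in> ball 0 e"
    then show "x \<in> cnj ` ball 0 e" by (intro image_eqI[of _ _ "cnj x"]) auto
  qed auto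
  fix y :: complex assume "y \<in> ball 0 e"
  then show "(\<lambda>x. cnj (A (cnj x) (cnj y))) holomorphic_on ball 0 e"
      "(\<lambda>x. cnj (A (cnj y) (cnj x))) holomorphic_on ball 0 e"
    using assms unfolding sep_holo_def
    by (auto intro!: holomorphic_on_compose_cnj_cnj[unfolded o_def] simp: cnj_ball)
qed

text \<open>
Only the order in the second variable is involved here, so conjugating both variables does not affect it. This
is why the orders of \<open>f\<close> and \<open>ft\<close> can be compared.
\<close>

lemma y_order_conj_fun:
  assumes "y_order (\<lambda>x y. Q (x, y, 0)) k"
  shows "y_order (\<lambda>x y. conj_fun Q (x, y, 0)) k"
proof -
  obtain e A where A: "0 < e" "\<And>d. d \<le> e \<Longrightarrow> sep_holo d A"
    "\<And>x y. norm x < e \<Longrightarrow> norm y < e \<Longrightarrow> Q (x, y, 0) = y ^ k * A x y"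
    "\<And>x. x \<noteq> 0 \<Longrightarrow> norm x < e \<Longrightarrow> A x 0 \<noteq> 0"
    using y_orderE[OF assms] by metis
  show ?thesis
    unfolding y_order_def
    by (rule exI[of _ e], intro conjI A(1) exI[of _ "\<lambda>x y. cnj (A (cnj x) (cnj y))"] allI impI
        sep_holo_cnj A(2) order_refl)
       (use A(3,4) in \<open>simp_all add: conj_fun_apply\<close>)
qed

context segre_germ
begin

text \<open>
On the axis the basic equation gives \<open>g(z, Q(z, x, 0)) = Q'(\<cdot>, 0, 0) = 0\<close>. If \<open>g\<close> had order \<open>j\<close> in \<open>w\<close>, one
could divide by \<open>Q(z, x, 0)\<^sup>j\<close>, which is nonzero for small \<open>x \<noteq> 0\<close> by finite type, and let \<open>x\<close> tend
to \<open>0\<close>: the leading coefficient of \<open>g\<close> would vanish.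
\<close>

lemma g_null_of_ft_null:
  assumes fin: "finite_type_at_0 Q" and ft: "\<forall>\<^sub>F x in nhds 0. ft (x, 0) = 0"
  shows "\<forall>\<^sub>F p in nhds 0. g p = 0"
proof (rule ccontr)
  assume "\<not> ?thesis"
  then obtain j where j: "y_order (\<lambda>x y. g (x, y)) j"
    using y_order_exists[of g] holo(4) unfolding holo_near_0_iff_eventually by blast
  obtain eG G where G: "0 < eG" "\<And>d. d \<le> eG \<Longrightarrow> sep_holo d G"
    "\<And>x y. norm x < eG \<Longrightarrow> norm y < eG \<Longrightarrow> g (x, y) = y ^ j * G x y"
    "\<And>x. x \<noteq> 0 \<Longrightarrow> norm x < eG \<Longrightarrow> G x 0 \<noteq> 0"
    using y_orderE[OF j] by metis
  obtain k where k: "y_order (\<lambda>x y. Q (x, y, 0)) k"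
    using y_order_Q[OF fin] by blast
  obtain eA A where A: "0 < eA" "\<And>d. d \<le> eA \<Longrightarrow> sep_holo d A"
    "\<And>x y. norm x < eA \<Longrightarrow> norm y < eA \<Longrightarrow> Q (x, y, 0) = y ^ k * A x y"
    "\<And>x. x \<noteq> 0 \<Longrightarrow> norm x < eA \<Longrightarrow> A x 0 \<noteq> 0"
    using y_orderE[OF k] by metis
  obtain e0 where e0: "adapted e0" using adapted_exists by blast
  have "\<forall>\<^sub>F z in at 0. norm (f (z, 0)) < e0"
    using eventually_norm_less[OF axis_limits(4)[OF e0, of 0]] adaptedD(1)[OF e0] by simp
  then have "\<forall>\<^sub>F z in at 0. (z \<noteq> 0 \<and> norm z < e0) \<and> (norm z < eA \<and> norm z < eG) \<and> norm (f (z, 0)) < e0"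
    using eventually_neq_at_within[of 0 0] eventually_at_0_norm_less[OF adaptedD(1)[OF e0]]
      eventually_at_0_norm_less[OF A(1)] eventually_at_0_norm_less[OF G(1)]
    by eventually_elim simp
  then obtain z :: complex where z: "z \<noteq> 0" "norm z < e0" "norm z < eA" "norm z < eG" "norm (f (z, 0)) < e0"
    using eventually_happens'[OF at_neq_bot[of "0::complex"]] by blast
  have q: "((\<lambda>x. Q (z, x, 0)) \<longlongrightarrow> 0) (at 0)" by (rule axis_limits[OF e0 z(2)])
  have Anz: "\<forall>\<^sub>F x in at 0. A z x \<noteq> 0"
    by (rule tendsto_imp_eventually_ne[OF sep_holo_at_0[OF A(2)[OF order_refl] z(3) A(1)] A(4)[OF z(1,3)]])
  have ft': "\<forall>\<^sub>F x in at 0. ft (x, 0) = 0"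
    using ft by (simp add: eventually_at_filter eventually_mono)
  have f': "\<forall>\<^sub>F x in at 0. norm (f (z, Q (z, x, 0))) < e0"
    by (rule eventually_norm_less[OF axis_limits(2)[OF e0 z(2)] z(5)])
  have "\<forall>\<^sub>F x in at 0. G z (Q (z, x, 0)) = 0"
    using Anz ft' f' eventually_neq_at_within[of 0 0] eventually_at_0_norm_less[OF adaptedD(1)[OF e0]]
      eventually_at_0_norm_less[OF A(1)] eventually_norm_less[OF q, of eG, simplified, OF G(1)]
  proof eventually_elim
    case (elim x)
    have "g (z, Q (z, x, 0)) = 0"
      using axis_equation[OF e0 z(2) elim(5)] adaptedD(12)[OF e0 elim(3), of 0] adaptedD(1)[OF e0] elim(2) by simp
    moreover have "Q (z, x, 0) \<noteq> 0" using A(3)[OF z(3) elim(6)] elim(1,4) by simp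
    ultimately show ?case using G(3)[OF z(4) elim(7)] by simp
  qed
  then have "((\<lambda>x. G z (Q (z, x, 0))) \<longlongrightarrow> 0) (at 0)" by (rule tendsto_eventually)
  moreover have "((\<lambda>x. G z (Q (z, x, 0))) \<longlongrightarrow> G z 0) (at 0)"
    by (rule sep_holo_tendsto[OF G(2)[OF order_refl] tendsto_const q]) (use z G(1) in auto)
  ultimately have "G z 0 = 0" using tendsto_unique at_neq_bot by blast
  then show False using G(4) z by blast
qed

text \<open>
Here \<open>g(z, w) = Q'(f(z, w), \<phi>(x), 0)\<close> for all \<open>x\<close>, where \<open>\<phi>(x) = ft(x, conj_fun Q (x, z, w))\<close>. If
\<open>f(z, w) \<noteq> 0\<close> then \<open>\<phi>\<close> must be constant: otherwise its values accumulate, being a connected set, so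
\<open>Q'(f(z, w), \<cdot>, 0)\<close> is constant, contrary to finite type. If such points \<open>(z, w)\<close> came arbitrarily close to the
origin, then in the limit \<open>ft(x, 0)\<close> would be constant. Therefore \<open>f\<close> vanishes, and with it \<open>g\<close>.
\<close>

lemma g_null_of_gt_null:
  assumes fin': "finite_type_at_0 Q'" and gt: "\<forall>\<^sub>F p in nhds 0. gt p = 0"
    and ft: "\<not> (\<forall>\<^sub>F x in nhds 0. ft (x, 0) = 0)"
  shows "\<forall>\<^sub>F p in nhds 0. g p = 0"
proof -
  define P where "P = conj_fun Q"
  have nP: "normal_eq P" unfolding P_def by (rule normal_eq_conj_fun[OF nQ])
  obtain m where m: "y_order (\<lambda>x y. Q' (x, y, 0)) m"
    using y_order_Q'[OF fin'] by blast
  obtain eB B where B: "0 < eB" "\<And>d. d \<le> eB \<Longrightarrow> sep_holo d B"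
    "\<And>x y. norm x < eB \<Longrightarrow> norm y < eB \<Longrightarrow> Q' (x, y, 0) = y ^ m * B x y"
    "\<And>x. x \<noteq> 0 \<Longrightarrow> norm x < eB \<Longrightarrow> B x 0 \<noteq> 0"
    using y_orderE[OF m] by metis
  obtain e0 where e0: "adapted e0" using adapted_exists by blast
  define e1 where "e1 = min e0 eB"
  have e1: "adapted e1" "0 < e1" "e1 \<le> eB"
    using adapted_smaller[OF e0, of e1] adaptedD(1)[OF e0] B(1) by (auto simp: e1_def)
  \<comment> \<open>The points \<open>(x, P (x, z, w))\<close> are those that the complexification pairs with \<open>(z, w)\<close>.\<close>
  define \<phi> where "\<phi> = (\<lambda>x p. ft (x, P (x, p)))"
  have P0: "P 0 = 0" using normal_eq_at_0[OF nP] .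
  have "\<forall>\<^sub>F q in nhds 0. ((norm (P q) < e1 \<and> gt (fst q, P q) = 0) \<and> (norm (f (snd q)) < e1 \<and> norm (\<phi> (fst q) (snd q)) < e1)) \<and>
      (holo_at P q \<and> holo_at ft (fst q, P q)) \<and> (case q of (x, z, w) \<Rightarrow> Q (z, x, P (x, z, w)) = w)"
  proof -
    have contP: "isCont P 0" by (rule holo_near_0_isCont) (use nP in \<open>auto simp: normal_eq_def\<close>)
    have c1: "isCont (\<lambda>q. (fst q, P q)) 0" "(\<lambda>q. (fst q, P q)) 0 = 0"
      using contP P0 by (auto simp: zero_prod_def intro!: isCont_Pair isCont_fst)
    have small: "\<forall>\<^sub>F q in nhds 0. norm (h q) < e1" if "isCont h 0" "h 0 = 0"
      for h :: "complex \<times> complex \<times> complex \<Rightarrow> complex"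
      by (rule eventually_nhds_0_compose[OF that]) (use e1(2) in \<open>auto simp: eventually_nhds_0_ball\<close>)
    have "isCont (\<lambda>q. \<phi> (fst q) (snd q)) 0"
      unfolding \<phi>_def using c1 holo(5)[THEN holo_near_0_isCont]
      by (intro isCont_o2[of 0 "\<lambda>q. (fst q, P (fst q, snd q))" ft]) (simp_all add: zero_prod_def)
    moreover have "\<phi> (fst 0) (snd 0) = 0"
      using P0 at_0 by (simp add: \<phi>_def zero_prod_def)
    moreover have "isCont (\<lambda>q. f (snd q)) (0::complex \<times> complex \<times> complex)" "f (snd 0) = 0"
      using holo(3)[THEN holo_near_0_isCont] at_0 by (auto intro!: isCont_o2[of 0 snd f] isCont_snd)
    moreover have "\<forall>\<^sub>F q in nhds 0. case q of (x, z, w) \<Rightarrow> Q (z, x, P (x, z, w)) = w"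
    proof -
      have "\<forall>\<^sub>F (z, x, w) in nhds 0. Q (z, x, P (x, z, w)) = w"
        using nQ by (simp add: normal_eq_def P_def)
      then obtain d where "0 < d" "\<And>z x w. norm z < d \<Longrightarrow> norm x < d \<Longrightarrow> norm w < d \<Longrightarrow> Q (z, x, P (x, z, w)) = w"
        unfolding eventually_nhds_0_prod3_iff by auto
      then show ?thesis
        unfolding eventually_nhds_0_prod3_iff by (intro exI[of _ d]) simp
    qed
    ultimately show ?thesis
      using nP contP P0 eventually_nhds_0_compose[OF c1 gt]
        eventually_nhds_0_compose[OF c1 holo(5)[unfolded holo_near_0_iff_eventually]]
      by (intro eventually_conj small) (auto simp: normal_eq_def holo_near_0_iff_eventually)
  qed
  then obtain e2 where e2: "0 < e2" "\<And>x z w. norm x < e2 \<Longrightarrow> norm z < e2 \<Longrightarrow> norm w < e2 \<Longrightarrow>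
     ((norm (P (x, z, w)) < e1 \<and> gt (x, P (x, z, w)) = 0) \<and> (norm (f (z, w)) < e1 \<and> norm (\<phi> x (z, w)) < e1)) \<and>
      (holo_at P (x, z, w) \<and> holo_at ft (x, P (x, z, w))) \<and> Q (z, x, P (x, z, w)) = w"
    unfolding eventually_nhds_0_prod3_iff by auto
  have "\<forall>\<^sub>F (x, t) in nhds 0. P (x, 0, t) = t"
    using nP by (simp add: normal_eq_def)
  then obtain e3 where e3: "0 < e3" and P_axis: "\<And>x t. norm x < e3 \<Longrightarrow> norm t < e3 \<Longrightarrow> P (x, 0, t) = t"
    unfolding eventually_nhds_0_prod_iff by auto
  define e where "e = min e1 (min e2 e3)"
  have e: "0 < e" "e \<le> e1" "e \<le> e2" "e \<le> e3" using e1(2) e2(1) e3 by (auto simp: e_def)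
  have eq: "g (z, w) = Q' (f (z, w), \<phi> x (z, w), 0)" if "norm x < e" "norm z < e" "norm w < e" for x z w
    using adaptedD(4)[OF e1(1), of z x "P (x, z, w)"] e2(2)[of x z w] that e by (simp add: \<phi>_def)
  have cont\<phi>: "isCont (\<lambda>q. \<phi> (fst q) (snd q)) (x, z, w)" if "norm x < e" "norm z < e" "norm w < e" for x z w
  proof -
    have "isCont P (x, z, w)" "isCont ft (x, P (x, z, w))"
      using e2(2)[of x z w] that e holo_at_imp_isCont by auto
    then show ?thesis
      unfolding \<phi>_def
      by (intro isCont_o2[of _ "\<lambda>q. (fst q, P (fst q, snd q))" ft] isCont_Pair isCont_fst)
         simp_all
  qed
  have const: "\<phi> x (z, w) = \<phi> 0 (z, w)"
    if x: "norm x < e" and p: "norm z < e" "norm w < e" and nz: "f (z, w) \<noteq> 0" for x z w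
  proof (rule ccontr)
    assume ne: "\<phi> x (z, w) \<noteq> \<phi> 0 (z, w)"
    define u where "u = f (z, w)"
    have u: "norm u < eB" "u \<noteq> 0"
      using e2(2)[of 0 z w] p e e1(3) nz by (auto simp: u_def)
    let ?S = "(\<lambda>x. \<phi> x (z, w)) ` ball 0 e"
    have "continuous_on (ball 0 e) (\<lambda>x. \<phi> x (z, w))"
    proof (rule continuous_at_imp_continuous_on, rule ballI)
      fix x :: complex assume "x \<in> ball 0 e"
      then have "isCont (\<lambda>q. \<phi> (fst q) (snd q)) (x, z, w)" using cont\<phi> p by simp
      then show "isCont (\<lambda>x. \<phi> x (z, w)) x"
        using isCont_o2[of x "\<lambda>x. (x, z, w)" "\<lambda>q. \<phi> (fst q) (snd q)"]
        by (simp add: isCont_Pair)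
    qed
    then have "connected ?S" by (rule connected_continuous_image) simp
    moreover have "?S \<noteq> {a}" for a
      using ne x e(1) by (metis centre_in_ball image_eqI mem_ball_0 singletonD)
    moreover have "\<phi> 0 (z, w) \<in> ?S" using e(1) by auto
    ultimately have lim: "\<phi> 0 (z, w) islimpt ?S" by (intro connected_imp_perfect)
    have sub: "?S \<subseteq> ball 0 eB"
    proof
      fix v assume "v \<in> ?S"
      then obtain x where "norm x < e" "v = \<phi> x (z, w)" by auto
      then show "v \<in> ball 0 eB" using e2(2)[of x z w] p e e1(3) by simp
    qed
    have Qu: "Q' (u, y, 0) - g (z, w) = 0" if "norm y < eB" for y
    proof (rule analytic_continuation[where f = "\<lambda>y. Q' (u, y, 0) - g (z, w)", OF _ open_ball connected_ball sub _ lim])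
      have "(\<lambda>y. y ^ m * B u y - g (z, w)) holomorphic_on ball 0 eB"
        using B(2)[OF order_refl] u unfolding sep_holo_def by (intro holomorphic_intros) auto
      then show "(\<lambda>y. Q' (u, y, 0) - g (z, w)) holomorphic_on ball 0 eB"
        by (rule holomorphic_transform) (use B(3) u in auto)
      show "\<phi> 0 (z, w) \<in> ball 0 eB" using sub e(1) by (auto simp: image_subset_iff)
      show "Q' (u, v, 0) - g (z, w) = 0" if v: "v \<in> ?S" for v
      proof -
        obtain x where "norm x < e" "v = \<phi> x (z, w)" using v by auto
        then show ?thesis using eq[of x z w] p by (simp add: u_def)
      qed
      show "y \<in> ball 0 eB" using that by simp
    qed
    have "Q' (u, 0, 0) = 0"
      using adaptedD(12)[OF e1(1), of u 0] e1(2) e2(2)[of 0 z w] p e by (simp add: u_def)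
    then have Q0: "Q' (u, y, 0) = 0" if "norm y < eB" for y
      using Qu[OF that] Qu[of 0] B(1) by simp
    have "\<forall>\<^sub>F y in at 0. B u y = 0"
      using eventually_at_0_norm_less[OF B(1)] eventually_neq_at_within[of 0 0]
    proof eventually_elim
      case (elim y)
      then show ?case using Q0[OF elim(1)] B(3)[OF u(1) elim(1)] by simp
    qed
    then have "((\<lambda>y. B u y) \<longlongrightarrow> 0) (at 0)" by (rule tendsto_eventually)
    then have "B u 0 = 0"
      using sep_holo_at_0[OF B(2)[OF order_refl] u(1) B(1)] tendsto_unique at_neq_bot by blast
    then show False using B(4)[OF u(2,1)] by blast
  qed
  have f_null: "\<forall>\<^sub>F p in nhds 0. f p = 0"
  proof (rule ccontr)
    assume non: "\<not> ?thesis"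
    have "ft (x, 0) = 0" if x: "norm x < e" for x
    proof (rule ccontr)
      assume nz: "ft (x, 0) \<noteq> 0"
      have *: "isCont (\<lambda>p. \<phi> y p) 0" if "norm y < e" for y
        using isCont_o2[of 0 "\<lambda>p. (y, p)" "\<lambda>q. \<phi> (fst q) (snd q)"] cont\<phi>[OF that, of 0 0] e(1)
        by (simp add: zero_prod_def isCont_Pair)
      have "norm (0::complex) < e" using e(1) by simp
      from *[OF x] *[OF this] have "isCont (\<lambda>p. \<phi> x p - \<phi> 0 p) 0" by (rule isCont_diff)
      then have lim: "((\<lambda>p. \<phi> x p - \<phi> 0 p) \<longlongrightarrow> \<phi> x 0 - \<phi> 0 0) (nhds 0)"
        using tendsto_at_iff_tendsto_nhds[of "\<lambda>p. \<phi> x p - \<phi> 0 p" 0] by (simp add: isCont_def)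
      have "P (x, 0, 0) = 0" using P_axis[of x 0] x e by simp
      then have "\<phi> x 0 - \<phi> 0 0 \<noteq> 0"
        using nz at_0 P0 by (simp add: \<phi>_def zero_prod_def)
      with lim have "\<forall>\<^sub>F p in nhds 0. \<phi> x p - \<phi> 0 p \<noteq> 0"
        by (rule tendsto_imp_eventually_ne)
      then obtain d where d: "0 < d" "\<And>z w. norm z < d \<Longrightarrow> norm w < d \<Longrightarrow> \<phi> x (z, w) \<noteq> \<phi> 0 (z, w)"
        unfolding eventually_nhds_0_prod_iff by auto
      obtain z w where "norm z < min d e" "norm w < min d e" "f (z, w) \<noteq> 0"
        using non d(1) e(1) unfolding eventually_nhds_0_prod_iff by (metis min_less_iff_conj)
      then show False using d(2)[of z w] const[OF x, of z w] by simp
    qed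
    then show False using ft e(1) unfolding eventually_nhds_0_ball by blast
  qed
  have "\<forall>\<^sub>F p in nhds 0. f p = 0 \<and> (case p of (z, w) \<Rightarrow> norm z < e \<and> norm w < e)"
    using f_null e(1) by (intro eventually_conj) (auto simp: eventually_nhds_0_prod_iff)
  then show ?thesis
  proof eventually_elim
    case (elim p)
    obtain z w where p: "p = (z, w)" by force
    show ?case
      using eq[of 0 z w] adaptedD(11)[OF e1(1), of "\<phi> 0 (z, w)" 0] e2(2)[of 0 z w] elim e e1(2)
      by (simp add: p)
  qed
qed

lemma not_null_imp_f_nondegenerate:
  assumes fin: "finite_type_at_0 Q" and fin': "finite_type_at_0 Q'"
    and nn: "\<not> transversally_null g gt"
  shows "\<not> (\<forall>\<^sub>F z in nhds 0. f (z, 0) = 0)"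
proof
  assume f: "\<forall>\<^sub>F z in nhds 0. f (z, 0) = 0"
  have gt: "\<forall>\<^sub>F p in nhds 0. gt p = 0"
    by (rule segre_germ.g_null_of_ft_null[OF swap finite_type_conj_fun[OF fin] f])
  have "\<forall>\<^sub>F p in nhds 0. g p = 0"
  proof (cases "\<forall>\<^sub>F x in nhds 0. ft (x, 0) = 0")
    case True
    then show ?thesis by (rule g_null_of_ft_null[OF fin])
  next
    case False
    then show ?thesis by (rule g_null_of_gt_null[OF fin' gt])
  qed
  with gt nn show False unfolding transversally_null_def by blast
qed

end

section \<open>The hypersurface determines its equation\<close>

text \<open>
The antidiagonal \<open>x = cnj z\<close> is totally real. In the coordinates \<open>z = u + \<i> v\<close> and \<open>x = u - \<i> v\<close> it consists
of the points with real \<open>u\<close> and \<open>v\<close>, and the identity theorem applies to \<open>v\<close> and then to \<open>u\<close>.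
\<close>

lemma holo_on_polydisc_eq_0:
  fixes D :: "complex \<times> complex \<Rightarrow> complex"
  assumes e: "0 < e" and holo: "\<And>x y. norm x < e \<Longrightarrow> norm y < e \<Longrightarrow> holo_at D (x, y)"
    and D0: "\<And>z. norm z < e \<Longrightarrow> D (z, cnj z) = 0"
    and zx: "norm z < e / 2" "norm x < e / 2"
  shows "D (z, x) = 0"
proof -
  let ?h = "\<lambda>u v. D (u + \<i> * v, u - \<i> * v)"
  have small: "norm (u + \<i> * v) < e" "norm (u - \<i> * v) < e"
    if "norm u < e / 2" "norm v < e / 2" for u v :: complex
    using that norm_triangle_ineq[of u "\<i> * v"] norm_triangle_ineq4[of u "\<i> * v"]
    by (auto simp: norm_mult)
  have hv: "(\<lambda>v. ?h u v) holomorphic_on ball 0 (e/2)" if "norm u < e / 2" for u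
    unfolding holomorphic_on_open[OF open_ball]
  proof
    fix v :: complex assume "v \<in> ball 0 (e/2)"
    then have h: "holo_at D (u + \<i> * v, u - \<i> * v)" using small[OF that] holo by simp
    show "\<exists>f'. ((\<lambda>v. ?h u v) has_field_derivative f') (at v)"
      by (rule exI, rule has_field_derivative_holo_at_2[of D "\<lambda>v. u + \<i> * v" v "\<lambda>v. u - \<i> * v" "\<i>" "-\<i>", OF h])
        (auto intro!: derivative_eq_intros)
  qed
  have hu: "(\<lambda>u. ?h u v) holomorphic_on ball 0 (e/2)" if "norm v < e / 2" for v
    unfolding holomorphic_on_open[OF open_ball]
  proof
    fix u :: complex assume "u \<in> ball 0 (e/2)"
    then have h: "holo_at D (u + \<i> * v, u - \<i> * v)" using small[of u v] that holo by simp
    show "\<exists>f'. ((\<lambda>u. ?h u v) has_field_derivative f') (at u)"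
      by (rule exI, rule has_field_derivative_holo_at_2[of D "\<lambda>u. u + \<i> * v" u "\<lambda>u. u - \<i> * v" 1 1, OF h])
        (auto intro!: derivative_eq_intros)
  qed
  have lim: "(0::complex) islimpt (complex_of_real ` {-(e/2)<..<e/2})"
  proof (rule connected_imp_perfect)
    show "connected (complex_of_real ` {-(e/2)<..<e/2})"
      by (intro connected_continuous_image continuous_intros) auto
    show "(0::complex) \<in> complex_of_real ` {-(e/2)<..<e/2}"
      using e by (intro image_eqI[of _ _ 0]) auto
    show "complex_of_real ` {-(e/2)<..<e/2} \<noteq> {x}" for x
    proof
      assume eq: "complex_of_real ` {-(e/2)<..<e/2} = {x}"
      have "complex_of_real 0 \<in> {x}" "complex_of_real (e/4) \<in> {x}"
        using e unfolding eq[symmetric] by (auto simp del: of_real_divide of_real_0)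
      then show False using e by simp
    qed
  qed
  have sub: "complex_of_real ` {-(e/2)<..<e/2} \<subseteq> ball 0 (e/2)" by auto
  have c0: "(0::complex) \<in> ball 0 (e/2)" using e by simp
  have 1: "?h (of_real s) v = 0" if "\<bar>s\<bar> < e / 2" "norm v < e / 2" for s v
  proof (rule analytic_continuation[OF hv open_ball connected_ball sub c0 lim])
    show "norm (complex_of_real s) < e/2" using that by simp
    show "?h (of_real s) y = 0" if y: "y \<in> complex_of_real ` {-(e/2)<..<e/2}" for y
    proof -
      obtain t where t: "y = of_real t" "\<bar>t\<bar> < e/2" using y by auto
      have "norm (of_real s + \<i> * of_real t) < e"
        using small(1)[of "of_real s" "of_real t"] \<open>\<bar>s\<bar> < e / 2\<close> t by simp
      moreover have "cnj (of_real s + \<i> * of_real t) = of_real s - \<i> * of_real t" by simp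
      ultimately show ?thesis using D0[of "of_real s + \<i> * of_real t"] t by simp
    qed
    show "v \<in> ball 0 (e/2)" using that by simp
  qed
  have 2: "?h u v = 0" if "norm u < e / 2" "norm v < e / 2" for u v
  proof (rule analytic_continuation[OF hu open_ball connected_ball sub c0 lim])
    show "?h u v = 0" if "u \<in> complex_of_real ` {-(e/2)<..<e/2}" for u
      using that 1[of _ v] \<open>norm v < e / 2\<close> by auto
  qed (use that in auto)
  have "norm ((z + x) / 2) < e / 2" "norm ((z - x) / (2 * \<i>)) < e / 2"
    using zx norm_triangle_ineq[of z x] norm_triangle_ineq4[of z x] by (auto simp: norm_divide norm_mult)
  from 2[OF this] show ?thesis by (simp add: field_simps)
qed

text \<open>
The Lipschitz bound holds because \<open>Q\<close> has derivative \<open>1\<close> in \<open>t\<close> at the origin and this derivative is continuous.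
\<close>

lemma normal_eq_uniform:
  assumes nQ: "normal_eq Q"
  obtains e where "0 < e"
    "\<And>z x t. norm z < e \<Longrightarrow> norm x < e \<Longrightarrow> norm t < e \<Longrightarrow> holo_at Q (z, x, t)"
    "\<And>z x t. norm z < e \<Longrightarrow> norm x < e \<Longrightarrow> norm t < e \<Longrightarrow> Q (z, x, conj_fun Q (x, z, t)) = t"
    "\<And>z x t t'. norm z < e \<Longrightarrow> norm x < e \<Longrightarrow> norm t < e \<Longrightarrow> norm t' < e \<Longrightarrow>
      norm ((Q (z, x, t) - t) - (Q (z, x, t') - t')) \<le> 1/2 * norm (t - t')"
proof -
  have hol: "\<forall>\<^sub>F p in nhds 0. holo_at Q p"
    using nQ by (simp add: normal_eq_def holo_near_0_iff_eventually)
  obtain d where d: "0 < d" "\<And>x t. norm x < d \<Longrightarrow> norm t < d \<Longrightarrow> Q (0, x, t) = t"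
    using nQ unfolding normal_eq_def eventually_nhds_0_prod_iff by auto
  have "((\<lambda>t. Q (0, 0, t)) has_field_derivative dderiv Q (0, 0, 0) (0, 0, 1)) (at 0)"
    using has_field_derivative_holo_at_3[of Q "\<lambda>_. 0" 0 "\<lambda>_. 0" "\<lambda>t. t" 0 0 1]
      eventually_nhds_x_imp_x[OF hol] by (simp add: zero_prod_def)
  moreover have "((\<lambda>t. Q (0, 0, t)) has_field_derivative 1) (at 0)"
    by (rule has_field_derivative_transform_within_open[OF DERIV_ident, of "ball 0 d"])
       (use d in auto)
  ultimately have one: "dderiv Q 0 (0, 0, 1) = 1"
    using DERIV_unique by (auto simp: zero_prod_def)
  have "isCont (\<lambda>p. dderiv Q p (0, 0, 1)) 0" by (rule isCont_dderiv[OF hol])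
  then have "((\<lambda>p. dderiv Q p (0, 0, 1)) \<longlongrightarrow> 1) (nhds 0)"
    using tendsto_at_iff_tendsto_nhds[of "\<lambda>p. dderiv Q p (0, 0, 1)" 0] one by (simp add: isCont_def)
  then have "\<forall>\<^sub>F p in nhds 0. dist (dderiv Q p (0, 0, 1)) 1 < 1/2"
    by (rule tendstoD) simp
  moreover have "\<forall>\<^sub>F (z, x, t) in nhds 0. Q (z, x, conj_fun Q (x, z, t)) = t"
    using nQ by (simp add: normal_eq_def)
  ultimately have "\<forall>\<^sub>F p in nhds 0. (holo_at Q p \<and> dist (dderiv Q p (0, 0, 1)) 1 < 1/2) \<and>
      (case p of (z, x, t) \<Rightarrow> Q (z, x, conj_fun Q (x, z, t)) = t)"
    using hol by (intro eventually_conj)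
  then obtain e where e: "0 < e" "\<And>z x t. norm z < e \<Longrightarrow> norm x < e \<Longrightarrow> norm t < e \<Longrightarrow>
      (holo_at Q (z, x, t) \<and> dist (dderiv Q (z, x, t) (0, 0, 1)) 1 < 1/2) \<and>
      Q (z, x, conj_fun Q (x, z, t)) = t"
    unfolding eventually_nhds_0_prod3_iff by auto
  show thesis
  proof (rule that[of e])
    fix z x t t' :: complex
    assume zx: "norm z < e" "norm x < e" and t: "norm t < e" "norm t' < e"
    show "norm ((Q (z, x, t) - t) - (Q (z, x, t') - t')) \<le> 1/2 * norm (t - t')"
    proof (rule field_differentiable_bound[where S = "ball 0 e" and f = "\<lambda>t. Q (z, x, t) - t"
          and f' = "\<lambda>t. dderiv Q (z, x, t) (0, 0, 1) - 1"])
      fix t :: complex assume "t \<in> ball 0 e"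
      then have h: "holo_at Q (z, x, t)" "norm (dderiv Q (z, x, t) (0, 0, 1) - 1) < 1/2"
        using e(2)[of z x t] zx by (auto simp: dist_norm)
      have "((\<lambda>t. Q (z, x, t)) has_field_derivative dderiv Q (z, x, t) (0, 0, 1)) (at t)"
        using has_field_derivative_holo_at_3[of Q "\<lambda>_. z" t "\<lambda>_. x" "\<lambda>t. t" 0 0 1] h(1) by simp
      from DERIV_diff[OF this DERIV_ident]
      show "((\<lambda>t. Q (z, x, t) - t) has_field_derivative dderiv Q (z, x, t) (0, 0, 1) - 1) (at t within ball 0 e)"
        by (rule has_field_derivative_at_within)
      show "norm (dderiv Q (z, x, t) (0, 0, 1) - 1) \<le> 1/2" using h(2) by simp
    qed (use t in auto)
  qed (use e in auto)
qed

text \<open>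
A point \<open>(z, cnj t)\<close> lies on \<open>M\<close> if and only if \<open>Q(z, cnj z, t) = cnj t\<close>, that is, if \<open>t\<close> is a fixed point of the
antiholomorphic involution \<open>\<sigma>(t) = cnj (Q(z, cnj z, t))\<close>. Near the origin the function
\<open>h(t) = t + Q(z, cnj z, t)\<close> is injective, and \<open>h(\<sigma>(t)) = cnj (h(t))\<close>, so the fixed points of \<open>\<sigma>\<close> are exactly the points where \<open>h\<close> is real. By the
intermediate value theorem there is such a point with every small real part. Hence \<open>Q\<close> and \<open>Q'\<close> agree for
infinitely many \<open>t\<close>, so for all \<open>t\<close>, in particular for \<open>t = 0\<close>; this holds on the antidiagonal
\<open>x = cnj z\<close>, from where it extends.
\<close>

lemma hypersurface_determines_Q:
  assumes M: "normal_coords M Q" and M': "normal_coords M' Q'"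
    and eq: "\<forall>\<^sub>F p in nhds 0. p \<in> M \<longleftrightarrow> p \<in> M'"
  shows "\<forall>\<^sub>F (z, x) in nhds 0. Q (z, x, 0) = Q' (z, x, 0)"
proof -
  have nQ: "normal_eq Q" and nQ': "normal_eq Q'"
    using M M' normal_coords_imp_normal_eq by blast+
  obtain e1 where e1: "0 < e1"
    and holQ: "\<And>z x t. norm z < e1 \<Longrightarrow> norm x < e1 \<Longrightarrow> norm t < e1 \<Longrightarrow> holo_at Q (z, x, t)"
    and inv: "\<And>z x t. norm z < e1 \<Longrightarrow> norm x < e1 \<Longrightarrow> norm t < e1 \<Longrightarrow> Q (z, x, conj_fun Q (x, z, t)) = t"
    and lip: "\<And>z x t t'. norm z < e1 \<Longrightarrow> norm x < e1 \<Longrightarrow> norm t < e1 \<Longrightarrow> norm t' < e1 \<Longrightarrow>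
      norm ((Q (z, x, t) - t) - (Q (z, x, t') - t')) \<le> 1/2 * norm (t - t')"
    by (rule normal_eq_uniform[OF nQ]) blast
  obtain e2 where e2: "0 < e2"
    and holQ': "\<And>z x t. norm z < e2 \<Longrightarrow> norm x < e2 \<Longrightarrow> norm t < e2 \<Longrightarrow> holo_at Q' (z, x, t)"
    using nQ' unfolding normal_eq_def holo_near_0_iff_eventually eventually_nhds_0_prod3_iff by blast
  have "\<forall>\<^sub>F p in nhds 0. ((p \<in> M \<longleftrightarrow> p \<in> M') \<and> (case p of (z, w) \<Rightarrow> (z, w) \<in> M \<longleftrightarrow> w = Q (z, cnj z, cnj w))) \<and>
      (case p of (z, w) \<Rightarrow> (z, w) \<in> M' \<longleftrightarrow> w = Q' (z, cnj z, cnj w))"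
    using eq M M' unfolding normal_coords_def by (intro eventually_conj) blast+
  then obtain e3 where e3: "0 < e3"
    and MM: "\<And>z w. norm z < e3 \<Longrightarrow> norm w < e3 \<Longrightarrow> w = Q (z, cnj z, cnj w) \<longleftrightarrow> w = Q' (z, cnj z, cnj w)"
    unfolding eventually_nhds_0_prod_iff by auto
  define e where "e = min e1 (min e2 e3)"
  have e: "0 < e" "e \<le> e1" "e \<le> e2" "e \<le> e3" using e1 e2 e3 by (auto simp: e_def)
  \<comment> \<open>Points \<open>t = a + \<i> b\<close> with \<open>\<bar>a\<bar> \<le> \<delta> / 4\<close> and \<open>\<bar>b\<bar> \<le> \<delta>\<close> are used; there \<open>Q - t\<close> is smaller than \<open>\<delta>\<close>, so that \<open>Im (t + Q)\<close> has the sign of \<open>b\<close> when \<open>\<bar>b\<bar> = \<delta>\<close>.\<close>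
  define \<delta> where "\<delta> = e / 4"
  have \<delta>: "0 < \<delta>" "2 * \<delta> < e" using e(1) by (auto simp: \<delta>_def)
  have "isCont (\<lambda>z. Q (z, cnj z, 0)) 0"
    using holQ[of 0 0 0] e1 holo_at_imp_isCont
    by (intro isCont_o2[of 0 "\<lambda>z. (z, cnj z, 0)" Q] isCont_Pair continuous_ident isCont_cnj continuous_const) auto
  then have "((\<lambda>z. Q (z, cnj z, 0)) \<longlongrightarrow> 0) (nhds 0)"
    using tendsto_at_iff_tendsto_nhds[of "\<lambda>z. Q (z, cnj z, 0)" 0] normal_eq_at_0[OF nQ]
    by (simp add: isCont_def zero_prod_def)
  then have "\<forall>\<^sub>F z in nhds 0. dist (Q (z, cnj z, 0)) 0 < \<delta> / 4"
    by (rule tendstoD) (use \<delta> in simp)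
  then obtain e4 where e4: "0 < e4" and Qsmall: "\<And>z. norm z < e4 \<Longrightarrow> norm (Q (z, cnj z, 0)) < \<delta> / 4"
    unfolding eventually_nhds_0_ball by auto
  define \<eta> where "\<eta> = min e e4"
  have \<eta>: "0 < \<eta>" "\<eta> \<le> e" "\<eta> \<le> e4" using e e4 by (auto simp: \<eta>_def)
  have near: "norm (Q (z, cnj z, t) - t) < \<delta> / 4 + norm t / 2" if "norm z < \<eta>" "norm t < e" for z t
    using lip[of z "cnj z" t 0] Qsmall[of z] that \<eta> e
      norm_triangle_ineq2[of "Q (z, cnj z, t) - t" "Q (z, cnj z, 0)"] by simp
  have diag: "Q (z, cnj z, 0) = Q' (z, cnj z, 0)" if z: "norm z < \<eta>" for z
  proof -
    have ze: "norm z < e" "norm (cnj z) < e" using z \<eta> by auto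
    have real: "Q (z, cnj z, t) = cnj t" if t: "norm t < 2 * \<delta>" and Im: "Im (t + Q (z, cnj z, t)) = 0" for t
    proof -
      define w' where "w' = cnj (Q (z, cnj z, t))"
      have "norm (Q (z, cnj z, t)) \<le> norm t + norm (Q (z, cnj z, t) - t)"
        using norm_triangle_ineq[of t "Q (z, cnj z, t) - t"] by simp
      then have w': "norm w' < e"
        using near[OF z, of t] t \<delta> by (simp add: w'_def \<delta>_def)
      have te: "norm t < e" using t \<delta> by simp
      have "conj_fun Q (cnj z, z, cnj t) = w'" by (simp add: conj_fun_apply w'_def)
      then have Qw': "Q (z, cnj z, w') = cnj t"
        using inv[of z "cnj z" "cnj t"] ze te e by simp
      have "norm ((Q (z, cnj z, w') - w') - (Q (z, cnj z, t) - t)) \<le> 1/2 * norm (w' - t)"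
        using lip[of z "cnj z" w' t] ze w' te e by simp
      moreover have "Q (z, cnj z, t) = cnj w'" by (simp add: w'_def)
      \<comment> \<open>The difference \<open>t - w'\<close> is real, so it is multiplied by \<open>- 1\<close> when passing from \<open>t, w'\<close> to their images, which contradicts the Lipschitz bound unless it is zero.\<close>
      moreover have "Im w' = Im t"
        using Im by (simp add: w'_def)
      then have "(cnj t - w') - (cnj w' - t) = 2 * (t - w')"
        by (simp add: complex_eq_iff)
      ultimately have "norm (2 * (t - w')) \<le> 1/2 * norm (t - w')"
        using Qw' by (simp add: norm_minus_commute)
      then have "t = w'" unfolding norm_mult by simp
      then show ?thesis by (metis w'_def complex_cnj_cnj)
    qed
    have ex: "\<exists>b. \<bar>b\<bar> \<le> \<delta> \<and> Im (Complex a b + Q (z, cnj z, Complex a b)) = 0" if a: "\<bar>a\<bar> \<le> \<delta> / 4" for a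
    proof -
      have nt: "norm (Complex a b) \<le> \<delta> / 4 + \<delta>" if "\<bar>b\<bar> \<le> \<delta>" for b
        using that a cmod_le[of "Complex a b"] by simp
      have nte: "norm (Complex a b) < e" if "\<bar>b\<bar> \<le> \<delta>" for b
        using nt[OF that] \<delta> by simp
      have ImQ: "\<bar>Im (Q (z, cnj z, Complex a b)) - b\<bar> < \<delta>" if "\<bar>b\<bar> \<le> \<delta>" for b
        using near[OF z nte[OF that]] nt[OF that] abs_Im_le_cmod[of "Q (z, cnj z, Complex a b) - Complex a b"]
        by simp
      have "continuous_on {-\<delta>..\<delta>} (\<lambda>b. Im (Complex a b + Q (z, cnj z, Complex a b)))"
      proof (rule continuous_at_imp_continuous_on, rule ballI)
        fix b assume "b \<in> {-\<delta>..\<delta>}"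
        then have "norm (Complex a b) < e" using nte[of b] by auto
        then have "isCont Q (z, cnj z, Complex a b)"
          by (intro holo_at_imp_isCont holQ) (use ze e in auto)
        moreover have C: "isCont (\<lambda>b. Complex a b) b"
          by (simp add: Complex_eq)
        ultimately have "isCont (\<lambda>b. Q (z, cnj z, Complex a b)) b"
          by (intro isCont_o2[of b "\<lambda>b. (z, cnj z, Complex a b)" Q] isCont_Pair continuous_const)
        with C show "isCont (\<lambda>b. Im (Complex a b + Q (z, cnj z, Complex a b))) b"
          by (intro isCont_Im isCont_add)
      qed
      moreover have "Im (Complex a (-\<delta>) + Q (z, cnj z, Complex a (-\<delta>))) \<le> 0"
        using ImQ[of "-\<delta>"] \<delta> by simp
      moreover have "0 \<le> Im (Complex a \<delta> + Q (z, cnj z, Complex a \<delta>))"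
        using ImQ[of \<delta>] \<delta> by simp
      ultimately obtain b where "-\<delta> \<le> b" "b \<le> \<delta>" "Im (Complex a b + Q (z, cnj z, Complex a b)) = 0"
        using IVT'[of "\<lambda>b. Im (Complex a b + Q (z, cnj z, Complex a b))" "-\<delta>" 0 \<delta>] \<delta>(1) by auto
      then show ?thesis by (auto simp: abs_le_iff)
    qed
    define T where "T = {t. norm t \<le> \<delta> / 4 + \<delta> \<and> Q (z, cnj z, t) = Q' (z, cnj z, t)}"
    have "Re ` T \<supseteq> {0..\<delta> / 4}"
    proof
      fix a assume a: "a \<in> {0..\<delta> / 4}"
      then obtain b where b: "\<bar>b\<bar> \<le> \<delta>" "Im (Complex a b + Q (z, cnj z, Complex a b)) = 0"
        using ex[of a] by auto
      define t where "t = Complex a b"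
      have nt: "norm t \<le> \<delta> / 4 + \<delta>"
        using a b cmod_le[of t] by (simp add: t_def)
      have "Q (z, cnj z, t) = cnj t"
        by (rule real) (use nt b \<delta> in \<open>auto simp: t_def\<close>)
      moreover from this have "Q' (z, cnj z, t) = cnj t"
        using MM[of z "cnj t"] ze nt e \<delta> by simp
      ultimately have "t \<in> T" using nt by (simp add: T_def)
      then show "a \<in> Re ` T" by (intro image_eqI[of _ _ t]) (auto simp: t_def)
    qed
    moreover have "infinite {0..\<delta> / 4}"
      by (rule infinite_Icc) (use \<delta> in simp)
    ultimately have "infinite T"
      using finite_subset finite_imageI by metis
    moreover have "T \<subseteq> cball 0 (\<delta> / 4 + \<delta>)" by (auto simp: T_def)
    ultimately obtain \<xi> where \<xi>: "\<xi> \<in> cball 0 (\<delta> / 4 + \<delta>)" "\<xi> islimpt T"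
      using Heine_Borel_imp_Bolzano_Weierstrass[OF compact_cball] by blast
    have slice: "(\<lambda>t. R (z, cnj z, t)) holomorphic_on ball 0 e"
      if "\<And>t. norm t < e \<Longrightarrow> holo_at R (z, cnj z, t)" for R :: "complex \<times> complex \<times> complex \<Rightarrow> complex"
      unfolding holomorphic_on_open[OF open_ball]
    proof
      fix t :: complex assume "t \<in> ball 0 e"
      then show "\<exists>f'. ((\<lambda>t. R (z, cnj z, t)) has_field_derivative f') (at t)"
        using has_field_derivative_holo_at_3[of R "\<lambda>_. z" t "\<lambda>_. cnj z" "\<lambda>t. t" 0 0 1] that[of t] by auto
    qed
    have "Q (z, cnj z, 0) - Q' (z, cnj z, 0) = 0"
    proof (rule analytic_continuation[of "\<lambda>t. Q (z, cnj z, t) - Q' (z, cnj z, t)" "ball 0 e" T \<xi>])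
      show "(\<lambda>t. Q (z, cnj z, t) - Q' (z, cnj z, t)) holomorphic_on ball 0 e"
        using holQ holQ' ze e by (intro holomorphic_intros slice) auto
    qed (use \<xi> e(1) \<delta> in \<open>auto simp: T_def\<close>)
    then show ?thesis by simp
  qed
  let ?D = "\<lambda>p. Q (fst p, snd p, 0) + - Q' (fst p, snd p, 0)"
  have holD: "holo_at ?D (x, y)" if "norm x < \<eta>" "norm y < \<eta>" for x y
  proof (rule holo_at_add)
    have 1: "holo_at (\<lambda>p::complex \<times> complex. (fst p, snd p, 0::complex)) (x, y)"
      by (intro holo_at_intros)
    show "holo_at (\<lambda>p. Q (fst p, snd p, 0)) (x, y)"
      by (rule holo_at_compose[OF 1]) (use holQ that \<eta> e in simp)
    have "holo_at (\<lambda>p. Q' (fst p, snd p, 0)) (x, y)"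
      by (rule holo_at_compose[OF 1]) (use holQ' that \<eta> e in simp)
    moreover have "holo_at uminus (c::complex)" for c
      unfolding holo_at_complex_iff by (intro derivative_intros)
    ultimately show "holo_at (\<lambda>p. - Q' (fst p, snd p, 0)) (x, y)"
      by (rule holo_at_compose[where G = uminus])
  qed
  have "Q (z, x, 0) = Q' (z, x, 0)" if "norm z < \<eta> / 2" "norm x < \<eta> / 2" for z x
    using holo_on_polydisc_eq_0[OF \<eta>(1) holD _ that] diag by simp
  then show ?thesis
    unfolding eventually_nhds_0_prod_iff using \<eta>(1) by (intro exI[of _ "\<eta> / 2"]) simp
qed

section \<open>Biholomorphic germs\<close>

lemma homeomorphism_map_prod:
  assumes "homeomorphism U V F G" "homeomorphism U' V' F' G'"
  shows "homeomorphism (U \<times> U') (V \<times> V') (map_prod F F') (map_prod G G')"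
proof -
  have c: "continuous_on (A \<times> B) (map_prod h h')" if "continuous_on A h" "continuous_on B h'"
    for A B and h :: "'x::topological_space \<Rightarrow> 'y::topological_space"
      and h' :: "'z::topological_space \<Rightarrow> 'w::topological_space"
    unfolding map_prod_def case_prod_unfold
    by (intro continuous_on_Pair continuous_on_compose2[OF that(1)] continuous_on_compose2[OF that(2)]
        continuous_on_fst continuous_on_snd continuous_on_id) auto
  show ?thesis
    using assms unfolding homeomorphism_def
    by (auto intro!: c simp: map_prod_surj_on)
qed

lemma holo_on_map_prod:
  assumes "holo_on F U" "holo_on G V"
  shows "holo_on (map_prod F G) (U \<times> V)"
  unfolding holo_on_iff_holo_at
proof
  fix p assume p: "p \<in> U \<times> V"
  have "holo_at (\<lambda>p. F (fst p)) p" "holo_at (\<lambda>p. G (snd p)) p"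
    using assms p unfolding holo_on_iff_holo_at
    by (auto intro!: holo_at_compose[where F = fst and G = F] holo_at_compose[where F = snd and G = G]
        holo_at_fst holo_at_snd holo_at_ident)
  then show "holo_at (map_prod F G) p"
    unfolding map_prod_def case_prod_unfold by (rule holo_at_Pair)
qed

lemma biholo_near_0_map_prod:
  assumes "biholo_near_0 F" "biholo_near_0 G"
  shows "biholo_near_0 (map_prod F G)"
proof -
  obtain U V F1 where F: "open U" "0 \<in> U" "open V" "0 \<in> V" "homeomorphism U V F F1"
    "holo_on F U" "holo_on F1 V"
    using assms(1) unfolding biholo_near_0_def by blast
  obtain U' V' G1 where G: "open U'" "0 \<in> U'" "open V'" "0 \<in> V'" "homeomorphism U' V' G G1"
    "holo_on G U'" "holo_on G1 V'"
    using assms(2) unfolding biholo_near_0_def by blast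
  show ?thesis
    unfolding biholo_near_0_def
    using F G
    by (intro exI[of _ "U \<times> U'"] exI[of _ "V \<times> V'"] exI[of _ "map_prod F1 G1"] conjI
        homeomorphism_map_prod holo_on_map_prod) (auto simp: zero_prod_def intro: open_Times)
qed

text \<open>
The differential at the origin is triangular with nonzero diagonal. The real inverse function theorem provides a
differentiable inverse, and its derivative is complex linear as the inverse of a complex linear map.
\<close>

lemma biholo_near_0_triangular:
  fixes f g :: "complex \<times> complex \<Rightarrow> complex"
  assumes hf: "holo_near_0 f" and hg: "holo_near_0 g" and 0: "f 0 = 0" "g 0 = 0"
    and fz: "dderiv f 0 (1, 0) \<noteq> 0" and gz: "dderiv g 0 (1, 0) = 0" and gw: "dderiv g 0 (0, 1) \<noteq> 0"
  shows "biholo_near_0 (\<lambda>p. (f p, g p))"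
proof -
  let ?F = "\<lambda>p. (f p, g p)"
  have "\<forall>\<^sub>F p in nhds 0. holo_at f p \<and> holo_at g p"
    using hf hg unfolding holo_near_0_iff_eventually by (rule eventually_conj)
  then obtain U where U: "open U" "0 \<in> U" "\<And>p. p \<in> U \<Longrightarrow> holo_at f p" "\<And>p. p \<in> U \<Longrightarrow> holo_at g p"
    unfolding eventually_nhds by blast
  define L where "L = (\<lambda>p. Blinfun (\<lambda>v. (dderiv f p v, dderiv g p v)))"
  have der: "(?F has_derivative (\<lambda>v. (dderiv f p v, dderiv g p v))) (at p)" if "p \<in> U" for p
    using U(3,4)[OF that] by (intro has_derivative_Pair has_derivative_dderiv)
  have L: "blinfun_apply (L p) = (\<lambda>v. (dderiv f p v, dderiv g p v))" if "p \<in> U" for p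
    unfolding L_def using has_derivative_bounded_linear[OF der[OF that]] by (rule bounded_linear_Blinfun_apply)
  have contL: "continuous_on U L"
  proof (rule continuous_on_blinfun_componentwise)
    fix i :: "complex \<times> complex"
    have "continuous_on U (\<lambda>p. (dderiv f p i, dderiv g p i))"
    proof (rule continuous_at_imp_continuous_on, rule ballI)
      fix p assume "p \<in> U"
      then have "\<forall>\<^sub>F y in nhds p. holo_at f y" "\<forall>\<^sub>F y in nhds p. holo_at g y"
        using U unfolding eventually_nhds by blast+
      then show "isCont (\<lambda>p. (dderiv f p i, dderiv g p i)) p"
        by (intro isCont_Pair isCont_dderiv)
    qed
    then show "continuous_on U (\<lambda>p. blinfun_apply (L p) i)"
      by (rule continuous_on_eq) (simp add: L)
  qed
  define a b d where "a = dderiv f 0 (1, 0)" and "b = dderiv f 0 (0, 1)" and "d = dderiv g 0 (0, 1)"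
  have ad: "a \<noteq> 0" "d \<noteq> 0" using fz gw by (auto simp: a_def d_def)
  have L0: "blinfun_apply (L 0) v = (fst v * a + snd v * b, snd v * d)" for v
    using dderiv_prod2[of f 0 "fst v" "snd v"] dderiv_prod2[of g 0 "fst v" "snd v"] U(2,3,4) gz
    by (simp add: L a_def b_def d_def)
  define I where "I = Blinfun (\<lambda>v::complex \<times> complex. ((fst v - snd v * (b / d)) / a, snd v / d))"
  have "bounded_linear (\<lambda>v::complex \<times> complex. ((fst v - snd v * (b / d)) / a, snd v / d))"
    unfolding divide_inverse
    by (intro bounded_linear_Pair bounded_linear_compose[OF bounded_linear_mult_left] bounded_linear_sub
        bounded_linear_fst bounded_linear_snd)
  then have I: "blinfun_apply I v = ((fst v - snd v * (b / d)) / a, snd v / d)" for v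
    unfolding I_def by (simp add: bounded_linear_Blinfun_apply)
  have inv: "I o\<^sub>L L 0 = id_blinfun"
    by (rule blinfun_eqI) (simp add: I L0 ad)
  obtain U' V G G' where G: "open U'" "U' \<subseteq> U" "0 \<in> U'" "open V" "?F 0 \<in> V" "homeomorphism U' V ?F G"
    "\<And>y. y \<in> V \<Longrightarrow> (G has_derivative G' y) (at y)"
    "\<And>y. y \<in> V \<Longrightarrow> G' y = inv (blinfun_apply (L (G y)))"
    "\<And>y. y \<in> V \<Longrightarrow> bij (blinfun_apply (L (G y)))"
  proof (rule inverse_function_theorem[of U ?F L 0 I])
    show "(?F has_derivative blinfun_apply (L x)) (at x)" if "x \<in> U" for x
      using der[OF that] L[OF that] by simp
  qed (use U contL inv in auto)
  have "holo_on ?F U'"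
    unfolding holo_on_iff_holo_at using U(3,4) G(2) by (auto intro!: holo_at_Pair)
  moreover have "holo_on G V"
    unfolding holo_on_def
  proof
    fix y assume y: "y \<in> V"
    then have Gy: "G y \<in> U" using G(2,6) unfolding homeomorphism_def by blast
    let ?L = "blinfun_apply (L (G y))"
    have "?L (c *\<^sub>C v) = c *\<^sub>C ?L v" for c v
      using dderiv_cscale[OF U(3)[OF Gy]] dderiv_cscale[OF U(4)[OF Gy]]
      by (simp add: L[OF Gy] cscale_prod_def cscale_complex_def)
    then have "G' y (c *\<^sub>C v) = c *\<^sub>C G' y v" for c v
      using G(9)[OF y] unfolding G(8)[OF y] by (metis bij_inv_eq_iff)
    then show "\<exists>D. (G has_derivative D) (at y) \<and> (\<forall>c v. D (c *\<^sub>C v) = c *\<^sub>C D v)"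
      using G(7)[OF y] by blast
  qed
  ultimately show ?thesis
    unfolding biholo_near_0_def
    using G(1,3,4,5,6) 0 by (intro exI[of _ U'] exI[of _ V] exI[of _ G]) (auto simp: zero_prod_def)
qed

section \<open>The equivalence and its consequences\<close>

lemma eventually_deriv_eq_0_iff:
  fixes h :: "complex \<Rightarrow> complex"
  assumes "\<forall>\<^sub>F x in nhds 0. holo_at h x" "h 0 = 0"
  shows "(\<forall>\<^sub>F x in nhds 0. deriv h x = 0) \<longleftrightarrow> (\<forall>\<^sub>F x in nhds 0. h x = 0)"
proof
  assume "\<forall>\<^sub>F x in nhds 0. deriv h x = 0"
  then have "\<forall>\<^sub>F x in nhds 0. deriv h x = 0 \<and> holo_at h x"
    using assms(1) by (rule eventually_conj)
  then obtain e where e: "0 < e" "\<And>x. norm x < e \<Longrightarrow> deriv h x = 0 \<and> holo_at h x"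
    unfolding eventually_nhds_0_ball by blast
  have "(h has_field_derivative 0) (at x within ball 0 e)" if "x \<in> ball 0 e" for x
    using e(2)[of x] that DERIV_deriv_iff_field_differentiable[of h x]
    by (auto simp: holo_at_complex_iff intro: has_field_derivative_at_within)
  then obtain c where c: "\<And>x. x \<in> ball 0 e \<Longrightarrow> h x = c"
    using has_field_derivative_zero_constant[OF convex_ball] by blast
  have "h x = 0" if "norm x < e" for x
    using c[of x] c[of 0] that e(1) assms(2) by simp
  then show "\<forall>\<^sub>F x in nhds 0. h x = 0"
    unfolding eventually_nhds_0_ball using e(1) by blast
next
  assume "\<forall>\<^sub>F x in nhds 0. h x = 0"
  then have "\<forall>\<^sub>F x in nhds 0. \<forall>\<^sub>F y in nhds x. h y = 0"
    by (simp add: eventually_eventually)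
  then show "\<forall>\<^sub>F x in nhds 0. deriv h x = 0"
  proof eventually_elim
    case (elim x)
    then have "deriv h x = deriv (\<lambda>_. 0) x" by (intro deriv_cong_ev) auto
    then show ?case by simp
  qed
qed

context segre_germ
begin

lemma totally_segre_nondegenerate_iff:
  "totally_segre_nondegenerate_at_0 f ft \<longleftrightarrow>
    \<not> (\<forall>\<^sub>F z in nhds 0. f (z, 0) = 0) \<and> \<not> (\<forall>\<^sub>F x in nhds 0. ft (x, 0) = 0)"
  unfolding totally_segre_nondegenerate_at_0_def
  using eventually_deriv_eq_0_iff[OF holo_at_axis[OF holo(3)]]
    eventually_deriv_eq_0_iff[OF holo_at_axis[OF holo(5)]] at_0
  by (simp add: zero_prod_def)

text \<open>
The orders \<open>k\<close> and \<open>m\<close> of the two equations satisfy \<open>k = m * s\<close> with \<open>s\<close> the order of \<open>ft\<close>. Exchanging the factors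
leaves \<open>k\<close> and \<open>m\<close> unchanged and replaces \<open>s\<close> by the order of \<open>f\<close>.
\<close>

lemma nondegenerate_imp_equal_orders:
  assumes fin': "finite_type_at_0 Q'"
    and f: "\<not> (\<forall>\<^sub>F z in nhds 0. f (z, 0) = 0)" and ft: "\<not> (\<forall>\<^sub>F x in nhds 0. ft (x, 0) = 0)"
  shows "zorder (\<lambda>z. f (z, 0)) 0 = zorder (\<lambda>x. ft (x, 0)) 0"
proof -
  obtain k m s where 1: "y_order (\<lambda>x y. Q (x, y, 0)) k" "y_order (\<lambda>x y. Q' (x, y, 0)) m"
    "zorder (\<lambda>x. ft (x, 0)) 0 = int s" "k = m * s" "0 < k"
    by (rule segre_nondegenerate_imp_transversal[OF fin' f ft])
  obtain k' m' r where 2: "y_order (\<lambda>x y. conj_fun Q (x, y, 0)) k'" "y_order (\<lambda>x y. conj_fun Q' (x, y, 0)) m'"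
    "zorder (\<lambda>x. f (x, 0)) 0 = int r" "k' = m' * r"
    by (rule segre_germ.segre_nondegenerate_imp_transversal[OF swap finite_type_conj_fun[OF fin'] ft f])
  have "k' = k" "m' = m"
    using y_order_cong_unique[OF 2(1) y_order_conj_fun[OF 1(1)]]
      y_order_cong_unique[OF 2(2) y_order_conj_fun[OF 1(2)]] by (simp_all add: case_prod_unfold)
  then show ?thesis using 1 2 by simp
qed

lemma biholo_first_component:
  assumes "zorder (\<lambda>z. f (z, 0)) 0 = 1" "\<not> (\<forall>\<^sub>F z in nhds 0. f (z, 0) = 0)"
    and d: "d \<noteq> 0" "((\<lambda>w. g (0, w)) has_field_derivative d) (at 0)"
  shows "biholo_near_0 (\<lambda>p. (f p, g p))"
proof (rule biholo_near_0_triangular[OF holo(3,4) at_0(3,4)])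
  have hf: "holo_at f (0, 0)" and hg: "holo_at g (0, 0)"
    using eventually_nhds_x_imp_x holo(3,4) unfolding holo_near_0_iff_eventually zero_prod_def by blast+
  have "f (0, 0) = 0" using at_0 by (simp add: zero_prod_def)
  then obtain r e C where r: "0 < r" "zorder (\<lambda>z. f (z, 0)) 0 = int r" and e: "0 < e"
    and C: "isCont C 0" "\<And>x. norm x < e \<Longrightarrow> f (x, 0) = x ^ r * C x \<and> C x \<noteq> 0"
    by (rule factor_zero_at_0[OF holo_at_axis[OF holo(3)] _ assms(2)]) (rule that)
  have "r = 1" using r assms(1) by simp
  have "((\<lambda>x. f (x, 0)) has_field_derivative C 0) (at 0)"
  proof (rule has_field_derivative_0_mult)
    show "\<forall>\<^sub>F x in nhds 0. f (x, 0) = x * C x"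
      unfolding eventually_nhds_0_ball using e C(2) \<open>r = 1\<close> by auto
    show "(C \<longlongrightarrow> C 0) (at 0)" using C(1) by (simp add: isCont_def)
  qed
  moreover have "((\<lambda>x. f (x, 0)) has_field_derivative dderiv f (0, 0) (1, 0)) (at 0)"
    using has_field_derivative_holo_at_2[of f "\<lambda>t. t" 0 "\<lambda>_. 0" 1 0] hf by simp
  ultimately have "dderiv f (0, 0) (1, 0) = C 0" by (rule DERIV_unique[symmetric])
  then show "dderiv f 0 (1, 0) \<noteq> 0"
    using C(2)[of 0] e by (simp add: zero_prod_def)
  have "((\<lambda>x. g (x, 0)) has_field_derivative dderiv g (0, 0) (1, 0)) (at 0)"
    using has_field_derivative_holo_at_2[of g "\<lambda>t. t" 0 "\<lambda>_. 0" 1 0] hg by simp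
  moreover have "((\<lambda>x. g (x, 0)) has_field_derivative 0) (at 0)"
    using DERIV_cong_ev[OF refl g_axis refl] by simp
  ultimately show "dderiv g 0 (1, 0) = 0"
    using DERIV_unique by (auto simp: zero_prod_def)
  have "((\<lambda>w. g (0, w)) has_field_derivative dderiv g (0, 0) (0, 1)) (at 0)"
    using has_field_derivative_holo_at_2[of g "\<lambda>_. 0" 0 "\<lambda>t. t" 0 1] hg by simp
  then show "dderiv g 0 (0, 1) \<noteq> 0"
    using d DERIV_unique by (auto simp: zero_prod_def)
qed

text \<open>
Equal equations have equal orders \<open>k = m\<close>, and \<open>k = m * s\<close> then gives \<open>s = 1\<close>.
\<close>

lemma nondegenerate_imp_biholo:
  assumes fin': "finite_type_at_0 Q'"
    and f: "\<not> (\<forall>\<^sub>F z in nhds 0. f (z, 0) = 0)" and ft: "\<not> (\<forall>\<^sub>F x in nhds 0. ft (x, 0) = 0)"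
    and QQ': "\<forall>\<^sub>F (z, x) in nhds 0. Q (z, x, 0) = Q' (z, x, 0)"
  shows "biholo_near_0 (segre_map f g ft gt)"
proof -
  obtain k m s d where 1: "y_order (\<lambda>x y. Q (x, y, 0)) k" "y_order (\<lambda>x y. Q' (x, y, 0)) m"
    "zorder (\<lambda>x. ft (x, 0)) 0 = int s" "k = m * s" "0 < k"
    and d: "d \<noteq> 0" "((\<lambda>w. g (0, w)) has_field_derivative d) (at 0)"
      "((\<lambda>t. gt (0, t)) has_field_derivative d) (at 0)"
    by (rule segre_nondegenerate_imp_transversal[OF fin' f ft])
  have "k = m" by (rule y_order_cong_unique[OF 1(1,2) QQ'])
  then have s: "zorder (\<lambda>x. ft (x, 0)) 0 = 1" using 1(3-5) by simp
  have r: "zorder (\<lambda>z. f (z, 0)) 0 = 1"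
    using nondegenerate_imp_equal_orders[OF fin' f ft] s by simp
  have "biholo_near_0 (map_prod (\<lambda>p. (f p, g p)) (\<lambda>p. (ft p, gt p)))"
    by (rule biholo_near_0_map_prod[OF biholo_first_component[OF r f d(1,2)]
          segre_germ.biholo_first_component[OF swap s ft d(1,3)]])
  moreover have "map_prod (\<lambda>p. (f p, g p)) (\<lambda>p. (ft p, gt p)) = segre_map f g ft gt"
    by (auto simp: segre_map_def fun_eq_iff)
  ultimately show ?thesis by simp
qed

lemma segre_transversal_imp_not_null:
  assumes "segre_transversal_at_0 g gt"
  shows "\<not> transversally_null g gt"
proof
  assume "transversally_null g gt"
  then have "\<forall>\<^sub>F p in nhds 0. gt p = 0" by (simp add: transversally_null_def)
  then have "\<forall>\<^sub>F t in nhds (0::complex). gt (0, t) = 0"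
    by (rule eventually_nhds_0_compose[of "\<lambda>t. (0, t)", rotated 2])
       (auto simp: zero_prod_def intro!: isCont_Pair)
  then have "deriv (\<lambda>t. gt (0, t)) 0 = deriv (\<lambda>_. 0) 0" by (intro deriv_cong_ev) auto
  then show False using assms by (simp add: segre_transversal_at_0_def)
qed

end

lemma lowest_taylor_term_imp_zorder:
  assumes "lowest_taylor_term h c r"
  shows "zorder h 0 = int r"
proof -
  obtain F where F: "h has_fps_expansion F" "fps_nth F r = c" "\<forall>k<r. fps_nth F k = 0" and c: "c \<noteq> 0"
    using assms unfolding lowest_taylor_term_def by blast
  have "F \<noteq> 0" using F(2) c by auto
  moreover have "subdegree F = r" using F(2,3) c by (intro subdegreeI) auto
  ultimately show ?thesis using has_fps_expansion_zorder_0[OF F(1)] by simp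
qed

lemma zorder_imp_lowest_taylor_term:
  assumes "\<forall>\<^sub>F x in nhds 0. holo_at h x" "\<not> (\<forall>\<^sub>F x in nhds 0. h x = 0)" "zorder h 0 = int r"
  shows "\<exists>c. lowest_taylor_term h c r"
proof -
  obtain e where e: "0 < e" "\<And>x. norm x < e \<Longrightarrow> holo_at h x"
    using assms(1) unfolding eventually_nhds_0_ball by blast
  have "h holomorphic_on ball 0 e"
    using e(2) by (auto simp: holomorphic_on_open holo_at_complex_iff field_differentiable_def)
  then have "h has_fps_expansion fps_expansion h 0"
    using e(1) by (intro has_fps_expansion_fps_expansion[of "ball 0 e"]) auto
  then obtain F where F: "h has_fps_expansion F" by blast
  have "F \<noteq> 0"
  proof
    assume "F = 0"
    then have "\<forall>\<^sub>F x in nhds 0. h x = 0"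
      using F by (simp add: has_fps_expansion_0_iff)
    then show False using assms(2) by blast
  qed
  then have sd: "subdegree F = r"
    using has_fps_expansion_zorder_0[OF F] assms(3) by simp
  have "lowest_taylor_term h (fps_nth F r) r"
    unfolding lowest_taylor_term_def
    using F \<open>F \<noteq> 0\<close> sd nth_subdegree_nonzero[OF \<open>F \<noteq> 0\<close>] nth_less_subdegree_zero
    by (intro conjI exI[of _ F]) auto
  then show ?thesis ..
qed

theorem theorem1p6:
  fixes M M' :: "(complex \<times> complex) set"
    and Q Q' :: "complex \<times> complex \<times> complex \<Rightarrow> complex"
    and f g ft gt :: "complex \<times> complex \<Rightarrow> complex"
  assumes "normal_coords M Q" and "normal_coords M' Q'"
    and "finite_type_at_0 Q'"
    and "is_HSPM Q Q' f g ft gt"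
  shows "(totally_segre_nondegenerate_at_0 f ft \<longleftrightarrow>
            finite_type_at_0 Q \<and> \<not> transversally_null g gt) \<and>
         (totally_segre_nondegenerate_at_0 f ft \<longleftrightarrow>
            finite_type_at_0 Q \<and> segre_transversal_at_0 g gt) \<and>
         (totally_segre_nondegenerate_at_0 f ft \<longrightarrow>
            zorder (\<lambda>z. f (z, 0)) 0 = zorder (\<lambda>\<zeta>. ft (\<zeta>, 0)) 0 \<and>
            (\<forall>c r. lowest_taylor_term (\<lambda>z. f (z, 0)) c r \<longrightarrow>
                (\<exists>c'. lowest_taylor_term (\<lambda>\<zeta>. ft (\<zeta>, 0)) c' r)) \<and>
            ((\<forall>\<^sub>F p in nhds 0. p \<in> M \<longleftrightarrow> p \<in> M') \<longrightarrow>
                biholo_near_0 (segre_map f g ft gt)))"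
proof -
  interpret segre_germ Q Q' f g ft gt
    by standard (use assms normal_coords_imp_normal_eq in blast)+
  note fin' = assms(3)
  have nondeg_imp: "finite_type_at_0 Q \<and> segre_transversal_at_0 g gt"
    if "totally_segre_nondegenerate_at_0 f ft"
  proof -
    have ax: "\<not> (\<forall>\<^sub>F z in nhds 0. f (z, 0) = 0)" "\<not> (\<forall>\<^sub>F x in nhds 0. ft (x, 0) = 0)"
      using that unfolding totally_segre_nondegenerate_iff by blast+
    obtain d where "d \<noteq> 0" "((\<lambda>w. g (0, w)) has_field_derivative d) (at 0)"
      "((\<lambda>t. gt (0, t)) has_field_derivative d) (at 0)"
      by (rule segre_nondegenerate_imp_transversal[OF fin' ax])
    then show ?thesis
      using finite_type_source[OF fin' ax] DERIV_imp_deriv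
      unfolding segre_transversal_at_0_def by metis
  qed
  have not_null_imp: "totally_segre_nondegenerate_at_0 f ft"
    if "finite_type_at_0 Q" "\<not> transversally_null g gt"
    unfolding totally_segre_nondegenerate_iff
  proof
    show "\<not> (\<forall>\<^sub>F z in nhds 0. f (z, 0) = 0)"
      by (rule not_null_imp_f_nondegenerate[OF that(1) fin' that(2)])
    show "\<not> (\<forall>\<^sub>F x in nhds 0. ft (x, 0) = 0)"
      by (rule segre_germ.not_null_imp_f_nondegenerate[OF swap finite_type_conj_fun[OF that(1)]
            finite_type_conj_fun[OF fin']])
         (use that(2) in \<open>auto simp: transversally_null_def\<close>)
  qed
  have consequences: "zorder (\<lambda>z. f (z, 0)) 0 = zorder (\<lambda>\<zeta>. ft (\<zeta>, 0)) 0 \<and>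
            (\<forall>c r. lowest_taylor_term (\<lambda>z. f (z, 0)) c r \<longrightarrow>
                (\<exists>c'. lowest_taylor_term (\<lambda>\<zeta>. ft (\<zeta>, 0)) c' r)) \<and>
            ((\<forall>\<^sub>F p in nhds 0. p \<in> M \<longleftrightarrow> p \<in> M') \<longrightarrow>
                biholo_near_0 (segre_map f g ft gt))"
    if "totally_segre_nondegenerate_at_0 f ft"
  proof -
    have ax: "\<not> (\<forall>\<^sub>F z in nhds 0. f (z, 0) = 0)" "\<not> (\<forall>\<^sub>F x in nhds 0. ft (x, 0) = 0)"
      using that unfolding totally_segre_nondegenerate_iff by blast+
    note ord = nondegenerate_imp_equal_orders[OF fin' ax]
    show ?thesis
    proof (intro conjI allI impI)
      show "zorder (\<lambda>z. f (z, 0)) 0 = zorder (\<lambda>\<zeta>. ft (\<zeta>, 0)) 0" by (rule ord)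
      show "\<exists>c'. lowest_taylor_term (\<lambda>\<zeta>. ft (\<zeta>, 0)) c' r"
        if "lowest_taylor_term (\<lambda>z. f (z, 0)) c r" for c r
        using zorder_imp_lowest_taylor_term[OF holo_at_axis[OF holo(5)] ax(2)]
          lowest_taylor_term_imp_zorder[OF that] ord by simp
      show "biholo_near_0 (segre_map f g ft gt)" if "\<forall>\<^sub>F p in nhds 0. p \<in> M \<longleftrightarrow> p \<in> M'"
        by (rule nondegenerate_imp_biholo[OF fin' ax hypersurface_determines_Q[OF assms(1,2) that]])
    qed
  qed
  have iff_null: "totally_segre_nondegenerate_at_0 f ft \<longleftrightarrow>
      finite_type_at_0 Q \<and> \<not> transversally_null g gt"
    using nondeg_imp not_null_imp segre_transversal_imp_not_null by blast
  have iff_transversal: "totally_segre_nondegenerate_at_0 f ft \<longleftrightarrow>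
      finite_type_at_0 Q \<and> segre_transversal_at_0 g gt"
    using nondeg_imp not_null_imp segre_transversal_imp_not_null by blast
  show ?thesis
    by (rule conjI[OF iff_null conjI[OF iff_transversal impI]]) (rule consequences)
qed

end
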